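(* Assume that $K$ and $f$ are continuous non-negative functions defined on $\mathbb S^2\setminus\{\mathbf n,\mathbf s\}$ such that: (1) for any $\theta,\theta'$ on the same geodesic passing through $\mathbf n$ and $\mathbf s$, $K(\theta)\ge K(\theta')$ if $\theta_3>\theta'_3\ge0$, and $K(\theta)\ge K(\theta')$ if $\theta_3<\theta'_3\le0$; (2) for any $\theta,\theta'$ on the same geodesic passing through $\mathbf n$ and $\mathbf s$, $f(\theta)\ge f(\theta')$ if $\theta_3>\theta'_3\ge0$, and $f(\theta)\ge f(\theta')$ if $\theta_3<\theta'_3\le0$; (3) $f^2+\left(K-\frac1{|\mathbb S^2|}\int_{\mathbb S^2}K\right)^2$ is not identically zero, i.e. it is not the case that $f\equiv0$ and $K$ is constant. If both $K$ and $f$ are rotationally symmetric about the line through $\mathbf n$ and $\mathbf s$, then any solution $v\in C^2(\mathbb S^2\setminus\{\mathbf n,\mathbf s\})$ of $$-\Delta_{\mathbb S^2}v+1=K(\theta)e^{2v}+f(\theta)\quad\text{on }\mathbb S^2\setminus\{\mathbf n,\mathbf s\}$$ satisfying $$\limsup_{\theta\to\mathbf n}\frac{v(\theta)}{\log d(\theta,\mathbf n)}\le0\quad\text{and}\quad\limsup_{\theta\to\mathbf s}\frac{v(\theta)}{\log d(\theta,\mathbf s)}\le0$$ must be rotationally symmetric about the line through $\mathbf n$ and $\mathbf s$.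
   Context: $\mathbb S^2\subset\mathbb R^3$ is the unit sphere with its standard metric, points written $\theta=(\theta_1,\theta_2,\theta_3)$; $\mathbf n=(0,0,1)$, $\mathbf s=(0,0,-1)$; $\Delta_{\mathbb S^2}$ is the Laplace–Beltrami operator and $d(\cdot,\cdot)$ the geodesic distance on $\mathbb S^2$. *)

theory Defs
  imports "HOL-Analysis.Analysis"
begin

abbreviation S2 :: "(real^3) set" where
  "S2 \<equiv> sphere 0 1"

definition north :: "real^3" where
  "north = axis 3 1"

definition south :: "real^3" where
  "south = - axis 3 1"

abbreviation punctured_S2 :: "(real^3) set" where
  "punctured_S2 \<equiv> S2 - {north, south}"

definition geodesic_dist :: "real^3 \<Rightarrow> real^3 \<Rightarrow> real" where
  "geodesic_dist x y = arccos (x \<bullet> y)"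

text \<open>The maximal geodesics of the sphere.\<close>

definition great_circle :: "(real^3) set \<Rightarrow> bool" where
  "great_circle C \<longleftrightarrow> (\<exists>P. subspace P \<and> dim P = 2 \<and> C = S2 \<inter> P)"

text \<open>
  Functions on the sphere are functions on the ambient space of which only the values on
  the sphere (or on the subset in question) are used. As \<open>sgn x = x /\<^sub>R norm x\<close>, the function
  \<open>\<lambda>x. u (sgn x)\<close> is the extension of \<open>u\<close> that is constant along rays from the origin.
  At a point of the sphere its derivative agrees with that of \<open>u\<close> in tangential
  directions and vanishes in the normal direction.
\<close>

definition C2_on :: "('a::real_normed_vector \<Rightarrow> 'b::real_normed_vector) \<Rightarrow> 'a set \<Rightarrow> bool" where
  "C2_on g W \<longleftrightarrow> open W \<and>
     (\<exists>(g' :: 'a \<Rightarrow> 'a \<Rightarrow>\<^sub>L 'b) (g'' :: 'a \<Rightarrow> 'a \<Rightarrow>\<^sub>L ('a \<Rightarrow>\<^sub>L 'b)).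
        (\<forall>x\<in>W. (g has_derivative blinfun_apply (g' x)) (at x)) \<and>
        (\<forall>x\<in>W. (g' has_derivative blinfun_apply (g'' x)) (at x)) \<and>
        continuous_on W g'')"

text \<open>Here \<open>U\<close> is a relatively open subset of the sphere.\<close>

definition sphere_C2_on :: "(real^3 \<Rightarrow> real) \<Rightarrow> (real^3) set \<Rightarrow> bool" where
  "sphere_C2_on u U \<longleftrightarrow> C2_on (\<lambda>x. u (sgn x)) {x. sgn x \<in> U}"

definition sphere_grad :: "(real^3 \<Rightarrow> real) \<Rightarrow> real^3 \<Rightarrow> real^3" where
  "sphere_grad u \<theta> = (THE D. GDERIV (\<lambda>x. u (sgn x)) \<theta> :> D)"

text \<open>
  For a tangential field \<open>X\<close> this is the trace of the Levi-Civita covariant derivative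
  \<open>w \<mapsto> \<nabla>\<^sub>w X\<close> on the tangent plane at \<open>\<theta>\<close>. The covariant derivative is the tangential part
  of the directional derivative; the normal direction contributes nothing to
  the trace below because the extended field is constant in that direction.
\<close>

definition sphere_div :: "(real^3 \<Rightarrow> real^3) \<Rightarrow> real^3 \<Rightarrow> real" where
  "sphere_div X \<theta> = (\<Sum>b\<in>Basis. frechet_derivative (\<lambda>x. X (sgn x)) (at \<theta>) b \<bullet> b)"

definition sphere_laplacian :: "(real^3 \<Rightarrow> real) \<Rightarrow> real^3 \<Rightarrow> real" where
  "sphere_laplacian u \<theta> = sphere_div (sphere_grad u) \<theta>"

text \<open>Invariance under all rotations about the line through the two poles.\<close>

definition rotationally_symmetric :: "(real^3 \<Rightarrow> real) \<Rightarrow> bool" where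
  "rotationally_symmetric g \<longleftrightarrow>
     (\<forall>Q::real^3^3. rotation_matrix Q \<and> Q *v north = north \<longrightarrow>
        (\<forall>\<theta>\<in>punctured_S2. g (Q *v \<theta>) = g \<theta>))"

definition increasing_to_poles :: "(real^3 \<Rightarrow> real) \<Rightarrow> bool" where
  "increasing_to_poles g \<longleftrightarrow>
     (\<forall>C. great_circle C \<and> north \<in> C \<and> south \<in> C \<longrightarrow>
        (\<forall>\<theta>\<in>C - {north, south}. \<forall>\<theta>'\<in>C - {north, south}.
           (\<theta>$3 > \<theta>'$3 \<and> \<theta>'$3 \<ge> 0 \<longrightarrow> g \<theta> \<ge> g \<theta>') \<and>
           (\<theta>$3 < \<theta>'$3 \<and> \<theta>'$3 \<le> 0 \<longrightarrow> g \<theta> \<ge> g \<theta>')))"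

end

theory Submission
  imports Defs
begin

text \<open>
  Two points of the sphere with the same height \<open>\<theta>$3\<close> are exchanged by the reflection in a plane
  through the poles, orthogonal to some horizontal unit vector \<open>a\<close>. It therefore suffices to show
  that the value of \<open>v\<close> does not decrease when a point with \<open>a \<bullet> \<theta> < 0\<close> is reflected; replacing
  \<open>a\<close> by \<open>- a\<close> gives equality. This is done by the method of moving planes, in conformal coordinates
  adapted to \<open>a\<close> and not to the axis of symmetry.

  Let \<open>b\<close> be horizontal with \<open>a\<close>, \<open>b\<close>, \<open>north\<close> orthonormal. The Mercator coordinates with axis \<open>a\<close>,
  \<open>\<theta> = tanh s a + (cos \<psi> b + sin \<psi> north) / cosh s\<close>, are conformal with factor \<open>1 / cosh s\<close>, so
  \<open>U = v - ln (cosh s)\<close> satisfies \<open>- \<Delta>U = K exp (2 U) + f / (cosh s)\<^sup>2\<close> on a cylinder. The two poles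
  become the points \<open>s = 0\<close>, \<open>cos \<psi> = 0\<close>, and the reflection in question becomes
  \<open>s \<mapsto> - s\<close>. The height is \<open>sin \<psi> / cosh s\<close>; hence axially symmetric functions that grow from the
  equator to the poles become even in \<open>s\<close> and decreasing in \<open>\<bar>s\<bar>\<close>, as moving planes require.

  For \<open>l < 0\<close> the function \<open>U (2 l - s, \<psi>) - U (s, \<psi>)\<close> on \<open>s < l\<close> is superharmonic where it is
  nonnegative and satisfies a linear differential inequality where it is negative. It is nonnegative
  for very negative \<open>l\<close>, because \<open>U + \<bar>s\<bar>\<close> is bounded below everywhere and bounded above away from the poles. If it is
  nonnegative for some \<open>l\<close>, then it is positive by the strong minimum principle: otherwise it vanishes
  identically, the coefficients are symmetric about \<open>s = l\<close> as well as about \<open>s = 0\<close>, and then \<open>f\<close>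
  vanishes and \<open>K\<close> is constant. Superharmonicity turns positivity into a uniform positive lower bound at any
  distance from \<open>s = l\<close>, which survives a small change of \<open>l\<close>, and a minimum principle for narrow
  strips covers the rest. So \<open>l\<close> can be moved up to \<open>0\<close>, which is the claim.

  The poles could spoil the minimum principles. The hypothesis on the upper limits says that near
  a pole \<open>v\<close> is bounded below by arbitrarily small multiples of the logarithm of the distance, and
  this is what makes an isolated singularity removable for superharmonic functions: adding a small multiple of a
  harmonic function with a logarithmic pole pushes all minima away from the singularity.
\<close>

section \<open>The Laplacian in two variables and the comparison principle\<close>

text \<open>
  Second derivatives are taken along the two coordinate lines separately. This is all that the
  second derivative test at a minimum uses, and it reduces everything to functions of one variable.
\<close>

definition has_second_derivative :: "(real \<Rightarrow> real) \<Rightarrow> real \<Rightarrow> real \<Rightarrow> bool" where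
  "has_second_derivative \<phi> a x \<longleftrightarrow>
     (\<exists>\<phi>'. (\<forall>\<^sub>F y in nhds x. (\<phi> has_real_derivative \<phi>' y) (at y)) \<and>
           (\<phi>' has_real_derivative a) (at x))"

definition has_laplacian :: "(real \<times> real \<Rightarrow> real) \<Rightarrow> real \<Rightarrow> real \<times> real \<Rightarrow> bool" where
  "has_laplacian u L z \<longleftrightarrow>
     (\<exists>a b. has_second_derivative (\<lambda>t. u (t, snd z)) a (fst z) \<and>
            has_second_derivative (\<lambda>t. u (fst z, t)) b (snd z) \<and> L = a + b)"

lemma has_second_derivativeI:
  assumes "\<And>y. y \<in> S \<Longrightarrow> (\<phi> has_real_derivative \<phi>' y) (at y)" "open S" "x \<in> S"
    and "(\<phi>' has_real_derivative a) (at x)"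
  shows "has_second_derivative \<phi> a x"
  unfolding has_second_derivative_def
  using assms by (intro exI[of _ \<phi>']) (auto simp: eventually_nhds)

lemma has_second_derivative_add:
  assumes "has_second_derivative f a x" "has_second_derivative g b x"
  shows "has_second_derivative (\<lambda>t. f t + g t) (a + b) x"
proof -
  obtain f' g' where
    f: "\<forall>\<^sub>F y in nhds x. (f has_real_derivative f' y) (at y)" "(f' has_real_derivative a) (at x)" and
    g: "\<forall>\<^sub>F y in nhds x. (g has_real_derivative g' y) (at y)" "(g' has_real_derivative b) (at x)"
    using assms unfolding has_second_derivative_def by blast
  have "\<forall>\<^sub>F y in nhds x. ((\<lambda>t. f t + g t) has_real_derivative f' y + g' y) (at y)"
    using f(1) g(1) by eventually_elim (rule DERIV_add)
  with DERIV_add[OF f(2) g(2)] show ?thesis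
    unfolding has_second_derivative_def by (intro exI[of _ "\<lambda>y. f' y + g' y"]) auto
qed

lemma has_second_derivative_cmult:
  assumes "has_second_derivative f a x"
  shows "has_second_derivative (\<lambda>t. c * f t) (c * a) x"
proof -
  obtain f' where
    f: "\<forall>\<^sub>F y in nhds x. (f has_real_derivative f' y) (at y)" "(f' has_real_derivative a) (at x)"
    using assms unfolding has_second_derivative_def by blast
  have "\<forall>\<^sub>F y in nhds x. ((\<lambda>t. c * f t) has_real_derivative c * f' y) (at y)"
    using f(1) by eventually_elim (rule DERIV_cmult)
  with DERIV_cmult[OF f(2)] show ?thesis
    unfolding has_second_derivative_def by (intro exI[of _ "\<lambda>y. c * f' y"]) auto
qed

lemma has_second_derivative_reflect:
  assumes "has_second_derivative f a (c - x)"
  shows "has_second_derivative (\<lambda>t. f (c - t)) a x"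
proof -
  obtain f' where
    f: "\<forall>\<^sub>F y in nhds (c - x). (f has_real_derivative f' y) (at y)"
       "(f' has_real_derivative a) (at (c - x))"
    using assms unfolding has_second_derivative_def by blast
  have lim: "((\<lambda>t. c - t) \<longlongrightarrow> c - x) (nhds x)"
    by (intro tendsto_diff tendsto_const filterlim_ident)
  have "\<forall>\<^sub>F y in nhds x. (f has_real_derivative f' (c - y)) (at (c - y))"
    using f(1) lim by (rule eventually_compose_filterlim)
  hence 1: "\<forall>\<^sub>F y in nhds x. ((\<lambda>t. f (c - t)) has_real_derivative - f' (c - y)) (at y)"
  proof eventually_elim
    case (elim y)
    have "((\<lambda>t. c - t) has_real_derivative -1) (at y)" by (auto intro!: derivative_eq_intros)
    from DERIV_chain2[OF elim this] show ?case by simp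
  qed
  have "((\<lambda>t. c - t) has_real_derivative -1) (at x)" by (auto intro!: derivative_eq_intros)
  from DERIV_chain2[OF f(2) this]
  have "((\<lambda>t. f' (c - t)) has_real_derivative - a) (at x)" by simp
  hence "((\<lambda>t. - f' (c - t)) has_real_derivative a) (at x)"
    using DERIV_minus by fastforce
  with 1 show ?thesis unfolding has_second_derivative_def by (intro exI[of _ "\<lambda>y. - f' (c - y)"]) auto
qed

lemma has_second_derivative_local_min:
  assumes "has_second_derivative \<phi> a x" and min: "\<forall>\<^sub>F y in nhds x. \<phi> x \<le> \<phi> y"
  shows "a \<ge> 0"
proof (rule ccontr)
  assume "\<not> a \<ge> 0"
  hence a: "a < 0" by simp
  obtain \<phi>' where
    f: "\<forall>\<^sub>F y in nhds x. (\<phi> has_real_derivative \<phi>' y) (at y)" "(\<phi>' has_real_derivative a) (at x)"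
    using assms unfolding has_second_derivative_def by blast
  obtain d where d: "d > 0" "\<And>y. dist y x < d \<Longrightarrow> (\<phi> has_real_derivative \<phi>' y) (at y) \<and> \<phi> x \<le> \<phi> y"
    using eventually_conj[OF f(1) min] unfolding eventually_nhds_metric by auto
  have "\<phi>' x = 0"
    using DERIV_local_min[of \<phi> "\<phi>' x" x d] d by (auto simp: dist_real_def abs_minus_commute)
  moreover obtain e where e: "e > 0" "\<And>h. 0 < h \<Longrightarrow> h < e \<Longrightarrow> \<phi>' x > \<phi>' (x + h)"
    using DERIV_neg_dec_right[OF f(2) a] by auto
  ultimately have neg: "\<And>h. 0 < h \<Longrightarrow> h < e \<Longrightarrow> \<phi>' (x + h) < 0" by auto
  define h where "h = min d e / 2"
  have h: "0 < h" "h < d" "h < e" using d e by (auto simp: h_def min_def)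
  obtain z where z: "z > x" "z < x + h" "\<phi> (x + h) - \<phi> x = (x + h - x) * \<phi>' z"
    using MVT2[of x "x + h" \<phi> \<phi>'] h d by (auto simp: dist_real_def)
  have "\<phi>' z < 0" using neg[of "z - x"] z h by simp
  hence "h * \<phi>' z < 0" using h by (simp add: mult_pos_neg)
  hence "\<phi> (x + h) < \<phi> x" using z by simp
  thus False using d(2)[of "x + h"] h by (auto simp: dist_real_def)
qed

lemma has_laplacianI:
  assumes "has_second_derivative (\<lambda>t. u (t, \<psi>)) a s" "has_second_derivative (\<lambda>t. u (s, t)) b \<psi>"
    and "L = a + b"
  shows "has_laplacian u L (s, \<psi>)"
  using assms unfolding has_laplacian_def by auto

lemma has_laplacian_add:
  assumes "has_laplacian u L z" "has_laplacian w M z"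
  shows "has_laplacian (\<lambda>z. u z + w z) (L + M) z"
proof -
  obtain a b a' b' where
    "has_second_derivative (\<lambda>t. u (t, snd z)) a (fst z)"
    "has_second_derivative (\<lambda>t. u (fst z, t)) b (snd z)" "L = a + b"
    "has_second_derivative (\<lambda>t. w (t, snd z)) a' (fst z)"
    "has_second_derivative (\<lambda>t. w (fst z, t)) b' (snd z)" "M = a' + b'"
    using assms unfolding has_laplacian_def by blast
  thus ?thesis unfolding has_laplacian_def
    by (intro exI[of _ "a + a'"] exI[of _ "b + b'"]) (auto intro: has_second_derivative_add)
qed

lemma has_laplacian_cmult:
  assumes "has_laplacian u L z"
  shows "has_laplacian (\<lambda>z. c * u z) (c * L) z"
proof -
  obtain a b where
    "has_second_derivative (\<lambda>t. u (t, snd z)) a (fst z)"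
    "has_second_derivative (\<lambda>t. u (fst z, t)) b (snd z)" "L = a + b"
    using assms unfolding has_laplacian_def by blast
  thus ?thesis unfolding has_laplacian_def
    by (intro exI[of _ "c * a"] exI[of _ "c * b"])
       (auto intro: has_second_derivative_cmult simp: distrib_left)
qed

lemma has_laplacian_diff:
  assumes "has_laplacian u L z" "has_laplacian w M z"
  shows "has_laplacian (\<lambda>z. u z - w z) (L - M) z"
  using has_laplacian_add[OF assms(1) has_laplacian_cmult[OF assms(2), of "-1"]] by simp

lemma has_laplacian_reflect:
  assumes "has_laplacian u L (c - fst z, snd z)"
  shows "has_laplacian (\<lambda>z. u (c - fst z, snd z)) L z"
  using assms unfolding has_laplacian_def by (auto intro!: has_second_derivative_reflect)

text \<open>
  These polynomials serve as strictly superharmonic comparison functions (\<open>r > 0\<close>) and as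
  harmonic perturbations of prescribed slope (\<open>r = 0\<close>).
\<close>

lemma has_laplacian_quadratic:
  "has_laplacian (\<lambda>z. p + q * (fst z - s0) - r * (fst z - s0)\<^sup>2) (- 2 * r) z"
proof -
  obtain s \<psi> where z: "z = (s, \<psi>)" by (cases z)
  have 1: "has_second_derivative (\<lambda>t. p + q * (t - s0) - r * (t - s0)\<^sup>2) (- 2 * r) s"
    by (rule has_second_derivativeI[of UNIV _ "\<lambda>t. q - 2 * r * (t - s0)"])
       (auto intro!: derivative_eq_intros)
  have 2: "has_second_derivative (\<lambda>t. p + q * (s - s0) - r * (s - s0)\<^sup>2) 0 \<psi>"
    by (rule has_second_derivativeI[of UNIV _ "\<lambda>t. 0"]) (auto intro!: derivative_eq_intros)
  show ?thesis unfolding z by (rule has_laplacianI) (use 1 2 in auto)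
qed

lemma has_laplacian_const: "has_laplacian (\<lambda>z. c) 0 z"
  using has_laplacian_quadratic[of c 0 0 0 z] by simp

lemma has_laplacian_local_min:
  assumes "has_laplacian u L z" and ev: "\<forall>\<^sub>F w in nhds z. u z \<le> u w"
  shows "L \<ge> 0"
proof -
  obtain a b where ab:
      "has_second_derivative (\<lambda>t. u (t, snd z)) a (fst z)"
      "has_second_derivative (\<lambda>t. u (fst z, t)) b (snd z)" "L = a + b"
    using assms(1) unfolding has_laplacian_def by blast
  have l1: "((\<lambda>t. (t, snd z)) \<longlongrightarrow> z) (nhds (fst z))"
    by (subst prod.collapse[of z, symmetric]) (intro tendsto_Pair filterlim_ident tendsto_const)
  have l2: "((\<lambda>t. (fst z, t)) \<longlongrightarrow> z) (nhds (snd z))"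
    by (subst prod.collapse[of z, symmetric]) (intro tendsto_Pair filterlim_ident tendsto_const)
  have "a \<ge> 0"
    by (rule has_second_derivative_local_min[OF ab(1)])
       (use eventually_compose_filterlim[OF ev l1] in simp)
  moreover have "b \<ge> 0"
    by (rule has_second_derivative_local_min[OF ab(2)])
       (use eventually_compose_filterlim[OF ev l2] in simp)
  ultimately show ?thesis using ab(3) by simp
qed

text \<open>
  If \<open>u\<close> is negative somewhere, let \<open>- m\<close> be the minimum of \<open>u / g\<close>. Then \<open>u + m g\<close> is nonnegative
  and vanishes at the minimum point, so its Laplacian is nonnegative there, which the hypothesis on the
  Laplacians excludes. Working with \<open>u + m g\<close> avoids differentiating a quotient.

  Compactness is required only up to points with the same values of \<open>u\<close> and \<open>g\<close>, so that
  the lemma covers functions on the cylinder, which are periodic in the second coordinate.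
\<close>

lemma comparison_principle:
  fixes u g :: "real \<times> real \<Rightarrow> real"
  assumes "open \<Omega>" and cont: "continuous_on \<Omega> u" "continuous_on \<Omega> g"
    and g_pos: "\<And>z. z \<in> \<Omega> \<Longrightarrow> g z > 0"
    and lap: "\<And>z. z \<in> \<Omega> \<Longrightarrow> u z < 0 \<Longrightarrow>
       \<exists>L M. has_laplacian u L z \<and> has_laplacian g M z \<and> L * g z < u z * M"
    and compact: "\<And>\<eta>. \<eta> > 0 \<Longrightarrow> \<exists>C. compact C \<and> C \<subseteq> \<Omega> \<and>
       (\<forall>z\<in>\<Omega>. u z \<le> - \<eta> * g z \<longrightarrow> (\<exists>y\<in>C. u y = u z \<and> g y = g z))"
    and "z \<in> \<Omega>"
  shows "u z \<ge> 0"
proof (rule ccontr)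
  assume "\<not> u z \<ge> 0"
  hence uz: "u z < 0" by simp
  define \<eta> where "\<eta> = - u z / g z"
  have gz: "g z > 0" using g_pos \<open>z \<in> \<Omega>\<close> by auto
  have \<eta>: "\<eta> > 0" using uz gz by (auto simp: \<eta>_def divide_neg_pos)
  obtain C where C: "compact C" "C \<subseteq> \<Omega>"
      "\<And>z. z \<in> \<Omega> \<Longrightarrow> u z \<le> - \<eta> * g z \<Longrightarrow> \<exists>y\<in>C. u y = u z \<and> g y = g z"
    using compact[OF \<eta>] by blast
  have zle: "u z \<le> - \<eta> * g z" using gz by (simp add: \<eta>_def)
  then obtain y1 where y1: "y1 \<in> C" "u y1 = u z" "g y1 = g z" using C(3) \<open>z \<in> \<Omega>\<close> by blast
  have "continuous_on C (\<lambda>z. u z / g z)"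
    using C(2) continuous_on_subset[OF cont(1) C(2)] continuous_on_subset[OF cont(2) C(2)]
    by (intro continuous_on_divide ballI) (use g_pos in force)+
  then obtain y0 where y0: "y0 \<in> C" "\<And>y. y \<in> C \<Longrightarrow> u y0 / g y0 \<le> u y / g y"
    using continuous_attains_inf[OF C(1)] y1(1) by blast
  define m where "m = - u y0 / g y0"
  have y0\<Omega>: "y0 \<in> \<Omega>" using y0(1) C(2) by auto
  have gy0: "g y0 > 0" using g_pos[OF y0\<Omega>] .
  have m\<eta>: "m \<ge> \<eta>" using y0(2)[OF y1(1)] y1 by (simp add: m_def \<eta>_def)
  have contact: "u y0 + m * g y0 = 0" using gy0 by (simp add: m_def)
  have above: "u x + m * g x \<ge> 0" if x: "x \<in> \<Omega>" for x
  proof (cases "u x \<le> - \<eta> * g x")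
    case True
    then obtain y where y: "y \<in> C" "u y = u x" "g y = g x" using C(3) x by blast
    have "- m \<le> u x / g x" using y0(2)[OF y(1)] y by (simp add: m_def)
    thus ?thesis using g_pos[OF x] by (simp add: field_simps)
  next
    case False
    have "\<eta> * g x \<le> m * g x" using m\<eta> g_pos[OF x] by (simp add: mult_right_mono)
    thus ?thesis using False by simp
  qed
  have uy0: "u y0 = - m * g y0" using contact by simp
  have "u y0 < 0" using m\<eta> \<eta> gy0 uy0 by simp
  then obtain L M where L: "has_laplacian u L y0" "has_laplacian g M y0" "L * g y0 < u y0 * M"
    using lap[OF y0\<Omega>] by blast
  have "has_laplacian (\<lambda>z. u z + m * g z) (L + m * M) y0"
    by (intro has_laplacian_add has_laplacian_cmult L)
  moreover have "\<forall>\<^sub>F z in nhds y0. u y0 + m * g y0 \<le> u z + m * g z"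
    using eventually_nhds_in_open[OF \<open>open \<Omega>\<close> y0\<Omega>]
    by eventually_elim (use above contact in simp)
  ultimately have "L + m * M \<ge> 0" by (rule has_laplacian_local_min)
  hence "(L + m * M) * g y0 \<ge> 0" using gy0 by simp
  thus False using L(3) uy0 by (simp add: algebra_simps)
qed

section \<open>Harmonic barriers\<close>

text \<open>
  This is \<open>\<bar>sinh (s - s0 + \<i> (\<psi> - \<pi>/2))\<bar>\<^sup>2\<close>, the squared modulus of a holomorphic function that is periodic
  in \<open>\<psi>\<close> and vanishes exactly at the two points \<open>s = s0\<close>, \<open>\<psi> = \<plusminus> \<pi>/2\<close> of the cylinder. Its logarithm is
  therefore a harmonic function with logarithmic poles at these points, and it measures
  the distance to them.
\<close>

definition pole_gap :: "real \<Rightarrow> real \<times> real \<Rightarrow> real" where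
  "pole_gap s0 z = (sinh (fst z - s0))\<^sup>2 + (cos (snd z))\<^sup>2"

lemma pole_gap_nonneg: "pole_gap s0 z \<ge> 0"
  by (simp add: pole_gap_def)

lemma pole_gap_pos_iff: "pole_gap s0 z > 0 \<longleftrightarrow> fst z \<noteq> s0 \<or> cos (snd z) \<noteq> 0"
  unfolding pole_gap_def by (simp add: sum_power2_gt_zero_iff)

lemma continuous_on_pole_gap [continuous_intros]: "continuous_on A (pole_gap s0)"
  unfolding pole_gap_def by (intro continuous_intros)

lemma has_laplacian_ln_pole_gap:
  assumes "pole_gap s0 z > 0"
  shows "has_laplacian (\<lambda>z. ln (pole_gap s0 z)) 0 z"
proof -
  obtain s \<psi> where z: "z = (s, \<psi>)" by (cases z)
  define S where "S = sinh (s - s0)"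
  define C where "C = cosh (s - s0)"
  define c where "c = cos \<psi>"
  define n where "n = sin \<psi>"
  have CS: "C\<^sup>2 = 1 + S\<^sup>2" using cosh_square_eq[of "s - s0"] by (simp add: C_def S_def)
  have nc: "n\<^sup>2 = 1 - c\<^sup>2" by (simp add: n_def c_def sin_squared_eq)
  define D where "D = S\<^sup>2 + c\<^sup>2"
  have D: "D > 0" using assms by (simp add: z pole_gap_def D_def S_def c_def)
  have quot: "(p * D - q) / (D * D) = p / D - q / D\<^sup>2" for p q
    using D by (simp add: power2_eq_square diff_divide_distrib)
  have 1: "has_second_derivative (\<lambda>t. ln ((sinh (t - s0))\<^sup>2 + c\<^sup>2))
      ((2 * C\<^sup>2 + 2 * S\<^sup>2) / D - (2 * S * C)\<^sup>2 / D\<^sup>2) s"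
  proof (rule has_second_derivativeI[of "{t. (sinh (t - s0))\<^sup>2 + c\<^sup>2 > 0}" _
        "\<lambda>t. 2 * sinh (t - s0) * cosh (t - s0) / ((sinh (t - s0))\<^sup>2 + c\<^sup>2)"])
    show "open {t. (sinh (t - s0))\<^sup>2 + c\<^sup>2 > 0}"
      by (intro open_Collect_less continuous_intros)
    have "((\<lambda>t. 2 * sinh (t - s0) * cosh (t - s0) / ((sinh (t - s0))\<^sup>2 + c\<^sup>2)) has_real_derivative
        ((2 * C\<^sup>2 + 2 * S\<^sup>2) * D - (2 * S * C) * (2 * S * C)) / (D * D)) (at s)"
      using D
      by (auto intro!: derivative_eq_intros simp: S_def[symmetric] C_def[symmetric] D_def[symmetric])
         (simp add: power2_eq_square[of C] power2_eq_square[of S] algebra_simps)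
    thus "((\<lambda>t. 2 * sinh (t - s0) * cosh (t - s0) / ((sinh (t - s0))\<^sup>2 + c\<^sup>2)) has_real_derivative
        (2 * C\<^sup>2 + 2 * S\<^sup>2) / D - (2 * S * C)\<^sup>2 / D\<^sup>2) (at s)"
      unfolding quot power2_eq_square[of "2 * S * C"] .
  qed (use D in \<open>auto intro!: derivative_eq_intros simp: D_def S_def divide_simps\<close>)
  have 2: "has_second_derivative (\<lambda>t. ln (S\<^sup>2 + (cos t)\<^sup>2))
      ((2 * n\<^sup>2 - 2 * c\<^sup>2) / D - (2 * c * n)\<^sup>2 / D\<^sup>2) \<psi>"
  proof (rule has_second_derivativeI[of "{t. S\<^sup>2 + (cos t)\<^sup>2 > 0}" _
        "\<lambda>t. - 2 * cos t * sin t / (S\<^sup>2 + (cos t)\<^sup>2)"])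
    show "open {t. S\<^sup>2 + (cos t)\<^sup>2 > 0}"
      by (intro open_Collect_less continuous_intros)
    have "((\<lambda>t. - 2 * cos t * sin t / (S\<^sup>2 + (cos t)\<^sup>2)) has_real_derivative
        ((2 * n\<^sup>2 - 2 * c\<^sup>2) * D - (2 * c * n) * (2 * c * n)) / (D * D)) (at \<psi>)"
      using D
      by (auto intro!: derivative_eq_intros simp: c_def[symmetric] n_def[symmetric] D_def[symmetric])
         (simp add: power2_eq_square[of c] power2_eq_square[of n] divide_simps, simp add: algebra_simps)
    thus "((\<lambda>t. - 2 * cos t * sin t / (S\<^sup>2 + (cos t)\<^sup>2)) has_real_derivative
        (2 * n\<^sup>2 - 2 * c\<^sup>2) / D - (2 * c * n)\<^sup>2 / D\<^sup>2) (at \<psi>)"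
      unfolding quot power2_eq_square[of "2 * c * n"] .
  qed (use D in \<open>auto intro!: derivative_eq_intros simp: D_def c_def divide_simps\<close>)
  have "((2 * C\<^sup>2 + 2 * S\<^sup>2) / D - (2 * S * C)\<^sup>2 / D\<^sup>2) +
        ((2 * n\<^sup>2 - 2 * c\<^sup>2) / D - (2 * c * n)\<^sup>2 / D\<^sup>2) = 0"
  proof -
    have "(2 * C\<^sup>2 + 2 * S\<^sup>2 + (2 * n\<^sup>2 - 2 * c\<^sup>2)) * D = (2 * S * C)\<^sup>2 + (2 * c * n)\<^sup>2"
      unfolding power_mult_distrib CS nc D_def by algebra
    thus ?thesis using D by (simp add: divide_simps power2_eq_square[of D]) (simp add: algebra_simps)
  qed
  thus ?thesis unfolding z
    by (intro has_laplacianI[OF _ _ sym]) (use 1 2 in \<open>auto simp: pole_gap_def S_def c_def\<close>)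
qed

lemma has_second_derivative_ln_quadratic:
  assumes "(s - a)\<^sup>2 + k > (0::real)"
  shows "has_second_derivative (\<lambda>t. ln ((t - a)\<^sup>2 + k))
           (2 / ((s - a)\<^sup>2 + k) - (2 * (s - a))\<^sup>2 / ((s - a)\<^sup>2 + k)\<^sup>2) s"
proof (rule has_second_derivativeI[of "{t. (t - a)\<^sup>2 + k > 0}" _ "\<lambda>t. 2 * (t - a) / ((t - a)\<^sup>2 + k)"])
  show "open {t. (t - a)\<^sup>2 + k > 0}"
    by (intro open_Collect_less continuous_intros)
  define D where "D = (s - a)\<^sup>2 + k"
  have D: "D > 0" using assms by (simp add: D_def)
  have quot: "(p * D - q) / (D * D) = p / D - q / D\<^sup>2" for p q
    using D by (simp add: power2_eq_square diff_divide_distrib)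
  have "((\<lambda>t. 2 * (t - a) / ((t - a)\<^sup>2 + k)) has_real_derivative
      (2 * D - 2 * (s - a) * (2 * (s - a))) / (D * D)) (at s)"
    using D by (auto intro!: derivative_eq_intros simp: D_def)
  thus "((\<lambda>t. 2 * (t - a) / ((t - a)\<^sup>2 + k)) has_real_derivative
     (2 / ((s - a)\<^sup>2 + k) - (2 * (s - a))\<^sup>2 / ((s - a)\<^sup>2 + k)\<^sup>2)) (at s)"
    unfolding D_def[symmetric] quot power2_eq_square[of "2 * (s - a)"] .
qed (use assms in \<open>auto intro!: derivative_eq_intros simp: divide_simps\<close>)

lemma has_laplacian_ln_dist:
  assumes "z \<noteq> y"
  shows "has_laplacian (\<lambda>z. ln ((dist z y)\<^sup>2)) 0 z"
proof -
  obtain s \<psi> a b where z: "z = (s, \<psi>)" "y = (a, b)" by (cases z, cases y)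
  have eq: "(dist (t, t') y)\<^sup>2 = (t - a)\<^sup>2 + (t' - b)\<^sup>2" for t t'
    by (simp add: z dist_Pair_Pair dist_real_def)
  define D where "D = (s - a)\<^sup>2 + (\<psi> - b)\<^sup>2"
  have D: "D > 0" using assms by (auto simp: D_def z sum_power2_gt_zero_iff)
  have 1: "has_second_derivative (\<lambda>t. ln ((t - a)\<^sup>2 + (\<psi> - b)\<^sup>2)) (2 / D - (2 * (s - a))\<^sup>2 / D\<^sup>2) s"
    using has_second_derivative_ln_quadratic[of s a "(\<psi> - b)\<^sup>2"] D by (simp add: D_def)
  have 2: "has_second_derivative (\<lambda>t. ln ((s - a)\<^sup>2 + (t - b)\<^sup>2)) (2 / D - (2 * (\<psi> - b))\<^sup>2 / D\<^sup>2) \<psi>"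
    using has_second_derivative_ln_quadratic[of \<psi> b "(s - a)\<^sup>2"] D by (simp add: D_def add.commute)
  have "(2 * (s - a))\<^sup>2 + (2 * (\<psi> - b))\<^sup>2 = 4 * D" by (simp add: D_def power2_eq_square algebra_simps)
  hence "(2 * (s - a))\<^sup>2 / D\<^sup>2 + (2 * (\<psi> - b))\<^sup>2 / D\<^sup>2 = 4 * D / D\<^sup>2"
    unfolding add_divide_distrib[symmetric] by simp
  also have "\<dots> = 4 / D" using D by (simp add: power2_eq_square)
  finally have "0 = (2 / D - (2 * (s - a))\<^sup>2 / D\<^sup>2) + (2 / D - (2 * (\<psi> - b))\<^sup>2 / D\<^sup>2)" by simp
  show ?thesis unfolding z(1)
  proof (rule has_laplacianI)
    show "has_second_derivative (\<lambda>t. ln ((dist (t, \<psi>) y)\<^sup>2)) (2 / D - (2 * (s - a))\<^sup>2 / D\<^sup>2) s"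
      unfolding eq by (rule 1)
    show "has_second_derivative (\<lambda>t. ln ((dist (s, t) y)\<^sup>2)) (2 / D - (2 * (\<psi> - b))\<^sup>2 / D\<^sup>2) \<psi>"
      unfolding eq by (rule 2)
  qed fact
qed

section \<open>Minimum principles on the cylinder\<close>

text \<open>
  Functions on the cylinder are represented by functions on the plane. This form of periodicity avoids
  multiples of the period and is immediate for functions built from \<open>cos \<psi>\<close> and \<open>sin \<psi>\<close>.
\<close>

definition angular :: "(real \<times> real \<Rightarrow> real) \<Rightarrow> bool" where
  "angular h \<longleftrightarrow> (\<forall>s \<psi> \<psi>'. cos \<psi> = cos \<psi>' \<and> sin \<psi> = sin \<psi>' \<longrightarrow> h (s, \<psi>) = h (s, \<psi>'))"

lemma angularI:
  assumes "\<And>s \<psi> \<psi>'. cos \<psi> = cos \<psi>' \<Longrightarrow> sin \<psi> = sin \<psi>' \<Longrightarrow> h (s, \<psi>) = h (s, \<psi>')"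
  shows "angular h"
  using assms unfolding angular_def by blast

lemma angularD: "angular h \<Longrightarrow> cos \<psi> = cos \<psi>' \<Longrightarrow> sin \<psi> = sin \<psi>' \<Longrightarrow> h (s, \<psi>) = h (s, \<psi>')"
  unfolding angular_def by blast

lemma compact_sublevel_strip:
  fixes \<alpha> \<beta> :: real
  assumes cont: "continuous_on {z. \<alpha> \<le> fst z \<and> fst z \<le> \<beta> \<and> 0 \<le> snd z \<and> snd z \<le> 2 * pi \<and> r \<le> pole_gap s0 z} w"
  shows "compact {z. \<alpha> \<le> fst z \<and> fst z \<le> \<beta> \<and> 0 \<le> snd z \<and> snd z \<le> 2 * pi \<and> r \<le> pole_gap s0 z \<and> w z \<le> (0::real)}"
proof -
  let ?A = "{z. \<alpha> \<le> fst z \<and> fst z \<le> \<beta> \<and> 0 \<le> snd z \<and> snd z \<le> 2 * pi \<and> r \<le> pole_gap s0 z}"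
  have "?A = ({\<alpha>..\<beta>} \<times> {0..2*pi}) \<inter> {z. r \<le> pole_gap s0 z}" by auto
  moreover have "closed {z. r \<le> pole_gap s0 z}" by (intro closed_Collect_le continuous_intros)
  moreover have "compact ({\<alpha>..\<beta>} \<times> {0..2*pi})" by (intro compact_Times) auto
  ultimately have A: "compact ?A" by (metis compact_Int_closed)
  have "closedin (top_of_set ?A) (?A \<inter> w -` {..0})"
    by (rule continuous_closedin_preimage[OF cont]) auto
  hence "compact (?A \<inter> w -` {..0})" using A closedin_compact by blast
  moreover have "?A \<inter> w -` {..0} = {z. \<alpha> \<le> fst z \<and> fst z \<le> \<beta> \<and> 0 \<le> snd z \<and> snd z \<le> 2 * pi \<and> r \<le> pole_gap s0 z \<and> w z \<le> 0}"
    by auto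
  ultimately show ?thesis by simp
qed

lemma angular_representative:
  obtains \<psi>' where "0 \<le> \<psi>'" "\<psi>' \<le> 2 * pi" "cos \<psi>' = cos \<psi>" "sin \<psi>' = sin \<psi>"
  using sincos_total_2pi[of "cos \<psi>" "sin \<psi>"] sin_cos_squared_add2[of \<psi>] by (metis less_imp_le)

text \<open>
  The logarithm of \<open>pole_gap\<close> tends to minus infinity at the two punctures, so \<open>h\<close> minus any small positive
  multiple of it has no minimum near them. The comparison principle, with a
  strictly superharmonic quadratic as comparison function, then applies to the perturbed function,
  and the multiple tends to zero.
\<close>

lemma punctured_strip_minimum_principle:
  fixes h :: "real \<times> real \<Rightarrow> real"
  assumes s0: "\<alpha> \<le> s0" "s0 \<le> \<beta>"
    and cont: "continuous_on {z. \<alpha> \<le> fst z \<and> fst z \<le> \<beta> \<and> pole_gap s0 z > 0} h"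
    and ang: "angular h"
    and lap: "\<And>z. \<alpha> < fst z \<Longrightarrow> fst z < \<beta> \<Longrightarrow> pole_gap s0 z > 0 \<Longrightarrow> \<exists>L\<le>0. has_laplacian h L z"
    and bdry: "\<And>\<psi>. h (\<alpha>, \<psi>) \<ge> c" "\<And>\<psi>. h (\<beta>, \<psi>) \<ge> c"
    and growth: "\<And>\<epsilon>. \<epsilon> > 0 \<Longrightarrow> \<exists>r>0. \<forall>z. \<alpha> < fst z \<and> fst z < \<beta> \<and> 0 < pole_gap s0 z \<and> pole_gap s0 z < r \<longrightarrow>
        h z \<ge> \<epsilon> * ln (pole_gap s0 z)"
    and z: "\<alpha> < fst z" "fst z < \<beta>" "pole_gap s0 z > 0"
  shows "h z \<ge> c"
proof -
  define B where "B = ln ((sinh (\<beta> - \<alpha>))\<^sup>2 + 1)"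
  have B0: "B \<ge> 0" by (simp add: B_def)
  have B: "ln (pole_gap s0 z) \<le> B" if z: "\<alpha> \<le> fst z" "fst z \<le> \<beta>" "pole_gap s0 z > 0" for z
  proof -
    have "\<bar>fst z - s0\<bar> \<le> \<beta> - \<alpha>" using z s0 by auto
    hence "\<bar>sinh (fst z - s0)\<bar> \<le> sinh (\<beta> - \<alpha>)"
      using sinh_real_le_iff[of "\<bar>fst z - s0\<bar>" "\<beta> - \<alpha>"] by simp
    hence "(sinh (fst z - s0))\<^sup>2 \<le> (sinh (\<beta> - \<alpha>))\<^sup>2"
      using power_mono[of "\<bar>sinh (fst z - s0)\<bar>" "sinh (\<beta> - \<alpha>)" 2] by simp
    moreover have "(cos (snd z))\<^sup>2 \<le> 1" by (simp add: abs_square_le_1)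
    ultimately have "pole_gap s0 z \<le> (sinh (\<beta> - \<alpha>))\<^sup>2 + 1" by (simp add: pole_gap_def)
    thus ?thesis using z(3) by (simp add: B_def)
  qed
  have main: "h z - c + \<epsilon> * (B - ln (pole_gap s0 z)) \<ge> 0" if \<epsilon>: "\<epsilon> > 0" for \<epsilon>
  proof -
    define u where "u z = h z - c + \<epsilon> * (B - ln (pole_gap s0 z))" for z
    define g where "g z = 1 + (\<beta> - \<alpha>)\<^sup>2 + 0 * (fst z - \<alpha>) - 1 * (fst z - \<alpha>)\<^sup>2" for z :: "real \<times> real"
    define \<Omega> where "\<Omega> = {z. \<alpha> < fst z \<and> fst z < \<beta> \<and> pole_gap s0 z > 0}"
    have g1: "g z > 0" if "\<alpha> \<le> fst z" "fst z \<le> \<beta>" for z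
    proof -
      have "(fst z - \<alpha>)\<^sup>2 \<le> (\<beta> - \<alpha>)\<^sup>2" using that by (intro power_mono) auto
      thus ?thesis by (simp add: g_def)
    qed
    obtain r0 where r0: "r0 > 0" "\<And>z. \<alpha> < fst z \<Longrightarrow> fst z < \<beta> \<Longrightarrow> 0 < pole_gap s0 z \<Longrightarrow> pole_gap s0 z < r0 \<Longrightarrow>
        h z \<ge> \<epsilon> / 2 * ln (pole_gap s0 z)"
      using growth[of "\<epsilon> / 2"] \<epsilon> by auto
    (* growth is used with epsilon / 2; the other half of the singular term has to outweigh the constant c *)
    define r where "r = min r0 (exp (- 2 * \<bar>c\<bar> / \<epsilon>))"
    have r: "r > 0" using r0 by (simp add: r_def)
    have near: "u z \<ge> 0" if z: "z \<in> \<Omega>" "pole_gap s0 z < r" for z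
    proof -
      have p: "pole_gap s0 z > 0" using z by (simp add: \<Omega>_def)
      have "ln (pole_gap s0 z) < ln (exp (- 2 * \<bar>c\<bar> / \<epsilon>))"
        using p z by (subst ln_less_cancel_iff) (auto simp: r_def)
      hence "\<epsilon> / 2 * ln (pole_gap s0 z) \<le> - \<bar>c\<bar>" using \<epsilon> by (simp add: field_simps)
      moreover have "h z \<ge> \<epsilon> / 2 * ln (pole_gap s0 z)" using r0(2) z by (simp add: \<Omega>_def r_def)
      moreover have "\<epsilon> * B \<ge> 0" using \<epsilon> B0 by simp
      ultimately show ?thesis unfolding u_def right_diff_distrib by linarith
    qed
    have contu: "continuous_on {z. \<alpha> \<le> fst z \<and> fst z \<le> \<beta> \<and> pole_gap s0 z > 0} u"
      unfolding u_def by (intro continuous_intros cont) auto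
    have contg: "continuous_on A g" for A unfolding g_def by (intro continuous_intros)
    have "u z \<ge> 0"
    proof (rule comparison_principle[of \<Omega> u g])
      have "\<Omega> = {z. \<alpha> < fst z} \<inter> {z. fst z < \<beta>} \<inter> {z. 0 < pole_gap s0 z}" by (auto simp: \<Omega>_def)
      thus "open \<Omega>" by (auto intro!: open_Int open_Collect_less continuous_intros)
      show "continuous_on \<Omega> u" by (rule continuous_on_subset[OF contu]) (auto simp: \<Omega>_def)
      show "continuous_on \<Omega> g" by (rule contg)
      show "g z > 0" if "z \<in> \<Omega>" for z using g1 that by (auto simp: \<Omega>_def)
      show "z \<in> \<Omega>" using z by (simp add: \<Omega>_def)
      show "\<exists>L M. has_laplacian u L z \<and> has_laplacian g M z \<and> L * g z < u z * M"
        if z: "z \<in> \<Omega>" "u z < 0" for z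
      proof -
        obtain L where L: "L \<le> 0" "has_laplacian h L z" using lap[of z] z unfolding \<Omega>_def by blast
        have "has_laplacian u (L - 0 + \<epsilon> * (0 - 0)) z" unfolding u_def
          using z by (intro has_laplacian_add has_laplacian_diff has_laplacian_cmult L(2)
              has_laplacian_const has_laplacian_ln_pole_gap) (auto simp: \<Omega>_def)
        moreover have "has_laplacian g (- 2 * 1) z" unfolding g_def by (rule has_laplacian_quadratic)
        moreover have "g z > 0" using g1 z by (auto simp: \<Omega>_def)
        hence "L * g z \<le> 0" using L by (simp add: mult_nonpos_nonneg)
        ultimately show ?thesis using z(2) by (intro exI[of _ L] exI[of _ "-2"]) auto
      qed
      show "\<exists>C. compact C \<and> C \<subseteq> \<Omega> \<and> (\<forall>z\<in>\<Omega>. u z \<le> - \<eta> * g z \<longrightarrow> (\<exists>y\<in>C. u y = u z \<and> g y = g z))"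
        if \<eta>: "\<eta> > 0" for \<eta>
      proof (intro exI conjI ballI impI)
        let ?C = "{z. \<alpha> \<le> fst z \<and> fst z \<le> \<beta> \<and> 0 \<le> snd z \<and> snd z \<le> 2 * pi \<and> r \<le> pole_gap s0 z \<and> u z + \<eta> * g z \<le> 0}"
        show "compact ?C"
          by (rule compact_sublevel_strip, intro continuous_intros contg, rule continuous_on_subset[OF contu])
             (use r in auto)
        show "?C \<subseteq> \<Omega>"
        proof
          fix z assume z: "z \<in> ?C"
          hence gz: "\<eta> * g z > 0" using g1[of z] \<eta> by simp
          have p: "pole_gap s0 z > 0" using z r by simp
          have nn: "\<epsilon> * (B - ln (pole_gap s0 z)) \<ge> 0" using B[of z] p z \<epsilon> by simp
          have "h z < c" using z gz nn unfolding u_def by auto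
          hence "fst z \<noteq> \<alpha>" "fst z \<noteq> \<beta>" using bdry[of "snd z"] by (metis not_le prod.collapse)+
          thus "z \<in> \<Omega>" using z p by (auto simp: \<Omega>_def)
        qed
        fix z assume z: "z \<in> \<Omega>" "u z \<le> - \<eta> * g z"
        obtain \<psi> where \<psi>: "0 \<le> \<psi>" "\<psi> \<le> 2 * pi" "cos \<psi> = cos (snd z)" "sin \<psi> = sin (snd z)"
          using angular_representative by blast
        let ?y = "(fst z, \<psi>)"
        have "h ?y = h z" using angularD[OF ang \<psi>(3,4)] by (metis prod.collapse)
        moreover have pg: "pole_gap s0 ?y = pole_gap s0 z" using \<psi> by (simp add: pole_gap_def)
        ultimately have uy: "u ?y = u z" by (simp add: u_def)
        have gy: "g ?y = g z" by (simp add: g_def)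
        have "\<eta> * g z > 0" using g1[of z] \<eta> z by (simp add: \<Omega>_def)
        hence "\<not> pole_gap s0 z < r" using near[OF z(1)] z(2) by auto
        thus "\<exists>y\<in>?C. u y = u z \<and> g y = g z"
          using uy gy pg \<psi> z by (intro bexI[of _ ?y]) (auto simp: \<Omega>_def)
      qed
    qed
    thus ?thesis by (simp add: u_def)
  qed
  show ?thesis
  proof (rule ccontr)
    assume "\<not> h z \<ge> c"
    hence d: "c - h z > 0" by simp
    define k where "k = B - ln (pole_gap s0 z)"
    have k: "k \<ge> 0" using B[of z] z by (simp add: k_def)
    define \<epsilon> where "\<epsilon> = (c - h z) / (2 * (k + 1))"
    have "\<epsilon> > 0" using d k by (simp add: \<epsilon>_def)
    hence "c - h z \<le> \<epsilon> * k" using main[of \<epsilon>] unfolding k_def by linarith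
    moreover have "\<epsilon> * k \<le> (c - h z) / 2"
    proof -
      have "\<epsilon> * k \<le> \<epsilon> * (k + 1)" using \<open>\<epsilon> > 0\<close> by simp
      also have "\<epsilon> * (k + 1) = (c - h z) / 2" using k by (simp add: \<epsilon>_def divide_simps)
      finally show ?thesis .
    qed
    ultimately have "c - h z \<le> (c - h z) / 2" by (rule order_trans)
    thus False using d by simp
  qed
qed

text \<open>
  A lower bound on \<open>h\<close> near the infinite end is enough: adding \<open>\<epsilon> (\<beta> - s)\<close>, which is harmonic, lifts
  \<open>h\<close> above \<open>c\<close> far to the left and reduces the claim to a finite strip.
\<close>

lemma punctured_half_cylinder_minimum_principle:
  fixes h :: "real \<times> real \<Rightarrow> real"
  assumes s0: "s0 \<le> \<beta>"
    and cont: "continuous_on {z. fst z \<le> \<beta> \<and> pole_gap s0 z > 0} h"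
    and ang: "angular h"
    and lap: "\<And>z. fst z < \<beta> \<Longrightarrow> pole_gap s0 z > 0 \<Longrightarrow> \<exists>L\<le>0. has_laplacian h L z"
    and bdry: "\<And>\<psi>. h (\<beta>, \<psi>) \<ge> c"
    and below: "\<And>z. fst z \<le> \<alpha>0 \<Longrightarrow> h z \<ge> m"
    and growth: "\<And>\<epsilon>. \<epsilon> > 0 \<Longrightarrow> \<exists>r>0. \<forall>z. fst z < \<beta> \<and> 0 < pole_gap s0 z \<and> pole_gap s0 z < r \<longrightarrow>
        h z \<ge> \<epsilon> * ln (pole_gap s0 z)"
    and z: "fst z < \<beta>" "pole_gap s0 z > 0"
  shows "h z \<ge> c"
proof -
  have main: "h z + \<epsilon> * (\<beta> - fst z) \<ge> c" if \<epsilon>: "\<epsilon> > 0" for \<epsilon>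
  proof -
    define \<alpha> where "\<alpha> = min (min \<alpha>0 (fst z - 1)) (min s0 (\<beta> - (c - m) / \<epsilon>))"
    have \<alpha>: "\<alpha> \<le> \<alpha>0" "\<alpha> < fst z" "\<alpha> \<le> s0" "\<alpha> \<le> \<beta> - (c - m) / \<epsilon>" by (auto simp: \<alpha>_def)
    define h' where "h' z = h z + (0 + (- \<epsilon>) * (fst z - \<beta>) - 0 * (fst z - \<beta>)\<^sup>2)" for z
    have "h' z \<ge> c"
    proof (rule punctured_strip_minimum_principle[of \<alpha> s0 \<beta> h'])
      show "continuous_on {z. \<alpha> \<le> fst z \<and> fst z \<le> \<beta> \<and> 0 < pole_gap s0 z} h'"
        unfolding h'_def
        by (intro continuous_intros continuous_on_subset[OF cont]) auto
      show "angular h'" 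
      proof (rule angularI)
        fix s \<psi> \<psi>' :: real
        assume "cos \<psi> = cos \<psi>'" "sin \<psi> = sin \<psi>'"
        from angularD[OF ang this] show "h' (s, \<psi>) = h' (s, \<psi>')" by (simp add: h'_def)
      qed
      show "\<exists>L\<le>0. has_laplacian h' L z"
        if z: "\<alpha> < fst z" "fst z < \<beta>" "0 < pole_gap s0 z" for z
      proof -
        obtain L where "L \<le> 0" "has_laplacian h L z" using lap z by blast
        moreover from this(2) have "has_laplacian h' (L + (-2) * 0) z" unfolding h'_def
          by (rule has_laplacian_add[OF _ has_laplacian_quadratic])
        ultimately show ?thesis by (intro exI[of _ L]) simp
      qed
      show "h' (\<alpha>, \<psi>) \<ge> c" for \<psi>
      proof -
        have "h (\<alpha>, \<psi>) \<ge> m" using below[of "(\<alpha>, \<psi>)"] \<alpha>(1) by simp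
        moreover have "(c - m) / \<epsilon> \<le> \<beta> - \<alpha>" using \<alpha>(4) by linarith
        hence "c - m \<le> (\<beta> - \<alpha>) * \<epsilon>" using \<epsilon> by (simp only: pos_divide_le_eq)
        moreover have "h' (\<alpha>, \<psi>) = h (\<alpha>, \<psi>) + (\<beta> - \<alpha>) * \<epsilon>" by (simp add: h'_def algebra_simps)
        ultimately show ?thesis by linarith
      qed
      show "h' (\<beta>, \<psi>) \<ge> c" for \<psi> using bdry by (simp add: h'_def)
      show "\<exists>r>0. \<forall>z. \<alpha> < fst z \<and> fst z < \<beta> \<and> 0 < pole_gap s0 z \<and> pole_gap s0 z < r \<longrightarrow> \<epsilon>' * ln (pole_gap s0 z) \<le> h' z"
        if \<epsilon>': "\<epsilon>' > 0" for \<epsilon>'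
      proof -
        obtain r where r: "r > 0" "\<And>z. fst z < \<beta> \<Longrightarrow> 0 < pole_gap s0 z \<Longrightarrow> pole_gap s0 z < r \<Longrightarrow> h z \<ge> \<epsilon>' * ln (pole_gap s0 z)"
          using growth[OF \<epsilon>'] by blast
        have "\<epsilon>' * ln (pole_gap s0 z) \<le> h' z" if "fst z < \<beta>" "0 < pole_gap s0 z" "pole_gap s0 z < r" for z
        proof -
          have "\<epsilon> * (\<beta> - fst z) \<ge> 0" using that(1) \<epsilon> by simp
          moreover have "h' z = h z + \<epsilon> * (\<beta> - fst z)" by (simp add: h'_def algebra_simps)
          ultimately show ?thesis using r(2)[OF that] by linarith
        qed
        thus ?thesis using r(1) by blast
      qed
    qed (fact \<alpha> s0 z)+
    moreover have "h' z = h z + \<epsilon> * (\<beta> - fst z)" by (simp add: h'_def algebra_simps)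
    ultimately show ?thesis by simp
  qed
  show ?thesis
  proof (rule ccontr)
    assume "\<not> h z \<ge> c"
    hence d: "c - h z > 0" by simp
    define \<epsilon> where "\<epsilon> = (c - h z) / (2 * (\<beta> - fst z))"
    have "\<epsilon> > 0" using d z by (simp add: \<epsilon>_def)
    moreover have "\<epsilon> * (\<beta> - fst z) = (c - h z) / 2" using z by (simp add: \<epsilon>_def divide_simps)
    ultimately show False using main[of \<epsilon>] d by simp
  qed
qed

text \<open>
  On a strip whose width is small compared with \<open>1 / sqrt q\<close> there is a positive concave quadratic \<open>g\<close>
  with \<open>- \<Delta>g > q g\<close>, so the zeroth order term of the inequality cannot destroy the minimum principle.
\<close>

lemma narrow_strip_minimum_principle:
  fixes u :: "real \<times> real \<Rightarrow> real"
  assumes "\<alpha> < \<beta>" and q: "q * (\<beta> - \<alpha>)\<^sup>2 < 1" "q \<ge> 0"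
    and cont: "continuous_on {z. \<alpha> \<le> fst z \<and> fst z \<le> \<beta>} u"
    and ang: "angular u"
    and lap: "\<And>z. \<alpha> < fst z \<Longrightarrow> fst z < \<beta> \<Longrightarrow> u z < 0 \<Longrightarrow> \<exists>L. has_laplacian u L z \<and> L \<le> q * (- u z)"
    and bdry: "\<And>\<psi>. u (\<alpha>, \<psi>) \<ge> 0" "\<And>\<psi>. u (\<beta>, \<psi>) \<ge> 0"
    and z: "\<alpha> < fst z" "fst z < \<beta>"
  shows "u z \<ge> 0"
proof -
  define w where "w = (\<beta> - \<alpha>)\<^sup>2"
  have w: "w > 0" using \<open>\<alpha> < \<beta>\<close> by (simp add: w_def)
  (* g takes values in [1/2, 1], and - Laplace g = 2 kappa = 1 / w exceeds q *)
  define \<kappa> where "\<kappa> = 1 / (2 * w)"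
  have \<kappa>: "\<kappa> > 0" "\<kappa> * w = 1 / 2" "q < 2 * \<kappa>" using w q by (auto simp: \<kappa>_def field_simps w_def)
  define g where "g z = 1 + 0 * (fst z - \<alpha>) - \<kappa> * (fst z - \<alpha>)\<^sup>2" for z :: "real \<times> real"
  have g1: "g z > 0" "g z \<le> 1" if "\<alpha> \<le> fst z" "fst z \<le> \<beta>" for z
  proof -
    have "(fst z - \<alpha>)\<^sup>2 \<le> w" unfolding w_def using that by (intro power_mono) auto
    hence "\<kappa> * (fst z - \<alpha>)\<^sup>2 \<le> \<kappa> * w" using \<kappa> by (intro mult_left_mono) auto
    thus "g z > 0" using \<kappa>(2) by (simp add: g_def)
    show "g z \<le> 1" using \<kappa> by (simp add: g_def)
  qed
  have contg: "continuous_on A g" for A unfolding g_def by (intro continuous_intros)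
  define \<Omega> where "\<Omega> = {z :: real \<times> real. \<alpha> < fst z \<and> fst z < \<beta>}"
  show ?thesis
  proof (rule comparison_principle[of \<Omega> u g])
    have "\<Omega> = {z. \<alpha> < fst z} \<inter> {z. fst z < \<beta>}" by (auto simp: \<Omega>_def)
    thus "open \<Omega>" by (auto intro!: open_Int open_Collect_less continuous_intros)
    show "continuous_on \<Omega> u" by (rule continuous_on_subset[OF cont]) (auto simp: \<Omega>_def)
    show "continuous_on \<Omega> g" by (rule contg)
    show "g z > 0" if "z \<in> \<Omega>" for z using g1 that by (auto simp: \<Omega>_def)
    show "z \<in> \<Omega>" using z by (simp add: \<Omega>_def)
    show "\<exists>L M. has_laplacian u L z \<and> has_laplacian g M z \<and> L * g z < u z * M"
      if z: "z \<in> \<Omega>" "u z < 0" for z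
    proof -
      obtain L where L: "has_laplacian u L z" "L \<le> q * (- u z)" using lap[of z] z unfolding \<Omega>_def by blast
      have G: "has_laplacian g (- 2 * \<kappa>) z" unfolding g_def by (rule has_laplacian_quadratic)
      have gz: "0 < g z" "g z \<le> 1" using g1[of z] z by (auto simp: \<Omega>_def)
      have "L * g z \<le> q * (- u z) * g z" using L gz by (intro mult_right_mono) auto
      also have "\<dots> \<le> q * (- u z) * 1" using gz z q by (intro mult_left_mono mult_nonneg_nonneg) auto
      also have "\<dots> < 2 * \<kappa> * (- u z)" using \<kappa>(3) z by simp
      finally have "L * g z < u z * (- 2 * \<kappa>)" by (simp add: algebra_simps)
      thus ?thesis using L G by blast
    qed
    show "\<exists>C. compact C \<and> C \<subseteq> \<Omega> \<and> (\<forall>z\<in>\<Omega>. u z \<le> - \<eta> * g z \<longrightarrow> (\<exists>y\<in>C. u y = u z \<and> g y = g z))"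
      if \<eta>: "\<eta> > 0" for \<eta>
    proof (intro exI conjI ballI impI)
      let ?C = "{z. \<alpha> \<le> fst z \<and> fst z \<le> \<beta> \<and> 0 \<le> snd z \<and> snd z \<le> 2 * pi \<and> 0 \<le> pole_gap 0 z \<and> u z + \<eta> * g z \<le> 0}"
      show "compact ?C"
        by (rule compact_sublevel_strip, intro continuous_intros contg, rule continuous_on_subset[OF cont]) auto
      show "?C \<subseteq> \<Omega>"
      proof
        fix z assume z: "z \<in> ?C"
        hence gz: "\<eta> * g z > 0" using g1[of z] \<eta> by simp
        have "u z < 0" using z gz by auto
        hence "fst z \<noteq> \<alpha>" "fst z \<noteq> \<beta>" using bdry[of "snd z"] by (metis not_le prod.collapse)+
        thus "z \<in> \<Omega>" using z by (auto simp: \<Omega>_def)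
      qed
      fix z assume z: "z \<in> \<Omega>" "u z \<le> - \<eta> * g z"
      obtain \<psi> where \<psi>: "0 \<le> \<psi>" "\<psi> \<le> 2 * pi" "cos \<psi> = cos (snd z)" "sin \<psi> = sin (snd z)"
        using angular_representative by blast
      let ?y = "(fst z, \<psi>)"
      have uy: "u ?y = u z" using angularD[OF ang \<psi>(3,4)] by (metis prod.collapse)
      have gy: "g ?y = g z" by (simp add: g_def)
      show "\<exists>y\<in>?C. u y = u z \<and> g y = g z"
        using uy gy \<psi> z by (intro bexI[of _ ?y]) (auto simp: \<Omega>_def pole_gap_nonneg)
    qed
  qed
qed

text \<open>
  Positivity at the centre of a disc spreads to the whole disc: on an annulus the function lies above
  a small multiple of the harmonic function that vanishes on the outer circle and has a logarithmic
  pole at the centre. Hence the set of points with positive value is open and relatively closed.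
\<close>

lemma strong_minimum_principle:
  fixes u :: "real \<times> real \<Rightarrow> real"
  assumes "open \<Omega>" "connected \<Omega>" and cont: "continuous_on \<Omega> u"
    and nonneg: "\<And>z. z \<in> \<Omega> \<Longrightarrow> u z \<ge> 0"
    and lap: "\<And>z. z \<in> \<Omega> \<Longrightarrow> \<exists>L\<le>0. has_laplacian u L z"
    and y: "y \<in> \<Omega>" "u y > 0" and z: "z \<in> \<Omega>"
  shows "u z > 0"
proof -
  have spread: "u x > 0" if y: "u y > 0" "cball y R \<subseteq> \<Omega>" and x: "x \<in> ball y R" for x y R
  proof (cases "x = y")
    case False
    have R: "R > 0" using x zero_le_dist[of y x] by (simp only: mem_ball)
    have y\<Omega>: "y \<in> \<Omega>" using y(2) R by auto
    have "isCont u y" using cont \<open>open \<Omega>\<close> y\<Omega> by (simp add: continuous_on_eq_continuous_at)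
    then obtain \<rho>0 where \<rho>0: "\<rho>0 > 0" "\<And>w. dist w y < \<rho>0 \<Longrightarrow> dist (u w) (u y) < u y / 2"
      unfolding continuous_at_eps_delta using y(1) half_gt_zero by blast
    define \<rho> where "\<rho> = min \<rho>0 (dist x y) / 2"
    have \<rho>: "0 < \<rho>" "\<rho> < \<rho>0" "\<rho> < dist x y" "\<rho> < R"
      using \<rho>0(1) False x R zero_less_dist_iff[of x y] by (auto simp: \<rho>_def min_def dist_commute)
    (* the barrier then equals u y / 2 on the inner circle, where u exceeds this value *)
    define \<tau> where "\<tau> = (u y / 2) / (ln (R\<^sup>2) - ln (\<rho>\<^sup>2))"
    have "\<rho>\<^sup>2 < R\<^sup>2" using \<rho> by (intro power_strict_mono) auto
    hence lnpos: "ln (R\<^sup>2) - ln (\<rho>\<^sup>2) > 0" using \<rho> R by simp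
    have \<tau>: "\<tau> > 0" "\<tau> * (ln (R\<^sup>2) - ln (\<rho>\<^sup>2)) = u y / 2"
      using lnpos y by (simp add: \<tau>_def) (metis \<tau>_def lnpos nonzero_eq_divide_eq less_irrefl)
    define h where "h w = u w - \<tau> * (ln (R\<^sup>2) - ln ((dist w y)\<^sup>2))" for w
    define g where "g w = 1 + R\<^sup>2 + 0 * (fst w - fst y) - 1 * (fst w - fst y)\<^sup>2" for w :: "real \<times> real"
    have g1: "g w > 0" if "dist w y \<le> R" for w
    proof -
      have "\<bar>fst w - fst y\<bar> \<le> \<bar>R\<bar>" using dist_fst_le[of w y] that by (simp add: dist_real_def)
      hence "(fst w - fst y)\<^sup>2 \<le> R\<^sup>2" by (simp add: abs_le_square_iff)
      thus ?thesis by (simp add: g_def)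
    qed
    have contg: "continuous_on A g" for A unfolding g_def by (intro continuous_intros)
    define A where "A = {w. \<rho> \<le> dist w y \<and> dist w y \<le> R}"
    have A\<Omega>: "A \<subseteq> \<Omega>" using y(2) by (auto simp: A_def dist_commute)
    have conth: "continuous_on A h" unfolding h_def
      by (intro continuous_intros continuous_on_subset[OF cont A\<Omega>]) (use \<rho> in \<open>auto simp: A_def\<close>)
    define \<Omega>' where "\<Omega>' = {w. \<rho> < dist w y \<and> dist w y < R}"
    have "h x \<ge> 0"
    proof (rule comparison_principle[of \<Omega>' h g])
      have "\<Omega>' = {w. \<rho> < dist w y} \<inter> {w. dist w y < R}" by (auto simp: \<Omega>'_def)
      thus "open \<Omega>'" by (auto intro!: open_Int open_Collect_less continuous_intros)
      show "continuous_on \<Omega>' h" by (rule continuous_on_subset[OF conth]) (auto simp: \<Omega>'_def A_def)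
      show "continuous_on \<Omega>' g" by (rule contg)
      show "g w > 0" if "w \<in> \<Omega>'" for w using g1 that by (auto simp: \<Omega>'_def)
      show "x \<in> \<Omega>'" using x \<rho> by (simp add: \<Omega>'_def dist_commute)
      show "\<exists>L M. has_laplacian h L w \<and> has_laplacian g M w \<and> L * g w < h w * M"
        if w: "w \<in> \<Omega>'" "h w < 0" for w
      proof -
        have "w \<in> \<Omega>" using w A\<Omega> by (auto simp: \<Omega>'_def A_def)
        then obtain L where L: "L \<le> 0" "has_laplacian u L w" using lap by blast
        have "w \<noteq> y" using w \<rho> by (auto simp: \<Omega>'_def)
        hence "has_laplacian h (L - \<tau> * (0 - 0)) w" unfolding h_def
          by (intro has_laplacian_diff has_laplacian_cmult L(2) has_laplacian_const has_laplacian_ln_dist)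
        moreover have "has_laplacian g (- 2 * 1) w" unfolding g_def by (rule has_laplacian_quadratic)
        moreover have "g w > 0" using g1 w by (auto simp: \<Omega>'_def)
        hence "L * g w \<le> 0" using L by (simp add: mult_nonpos_nonneg)
        ultimately show ?thesis using w(2) by (intro exI[of _ L] exI[of _ "-2"]) auto
      qed
      show "\<exists>C. compact C \<and> C \<subseteq> \<Omega>' \<and> (\<forall>z\<in>\<Omega>'. h z \<le> - \<eta> * g z \<longrightarrow> (\<exists>y\<in>C. h y = h z \<and> g y = g z))"
        if \<eta>: "\<eta> > 0" for \<eta>
      proof (intro exI conjI ballI impI)
        let ?C = "A \<inter> (\<lambda>w. h w + \<eta> * g w) -` {..0}"
        have "A = cball y R \<inter> {w. \<rho> \<le> dist w y}" by (auto simp: A_def dist_commute)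
        moreover have "closed {w. \<rho> \<le> dist w y}" by (intro closed_Collect_le continuous_intros)
        ultimately have cA: "compact A" by (metis compact_Int_closed compact_cball)
        have "closedin (top_of_set A) ?C"
          by (rule continuous_closedin_preimage) (intro continuous_intros conth contg, auto)
        thus "compact ?C" using cA closedin_compact by blast
        show "?C \<subseteq> \<Omega>'"
        proof
          fix w assume w: "w \<in> ?C"
          hence wA: "\<rho> \<le> dist w y" "dist w y \<le> R" by (auto simp: A_def)
          have "\<eta> * g w > 0" using g1[of w] \<eta> wA by simp
          hence neg: "h w < 0" using w by auto
          have "dist w y \<noteq> R"
          proof
            assume "dist w y = R"
            hence "h w = u w" by (simp add: h_def)
            thus False using neg nonneg[of w] w A\<Omega> by auto
          qed
          moreover have "dist w y \<noteq> \<rho>"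
          proof
            assume e: "dist w y = \<rho>"
            hence "h w = u w - u y / 2" using \<tau>(2) by (simp add: h_def)
            moreover have "u w > u y / 2" using \<rho>0(2)[of w] e \<rho> by (simp add: dist_real_def abs_if split: if_splits)
            ultimately show False using neg by simp
          qed
          ultimately show "w \<in> \<Omega>'" using wA by (auto simp: \<Omega>'_def)
        qed
        fix w assume "w \<in> \<Omega>'" "h w \<le> - \<eta> * g w"
        thus "\<exists>y\<in>?C. h y = h w \<and> g y = g w" by (intro bexI[of _ w]) (auto simp: \<Omega>'_def A_def)
      qed
    qed
    moreover have "(dist x y)\<^sup>2 < R\<^sup>2" using x by (intro power_strict_mono) (auto simp: dist_commute)
    hence "\<tau> * (ln (R\<^sup>2) - ln ((dist x y)\<^sup>2)) > 0" using \<tau> False R by simp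
    ultimately show "u x > 0" by (simp add: h_def)
  qed (use y in auto)
  define P where "P = {w \<in> \<Omega>. u w > 0}"
  have "openin (top_of_set \<Omega>) P"
    unfolding openin_contains_ball
  proof (intro conjI ballI)
    fix w assume w: "w \<in> P"
    then obtain R where R: "R > 0" "cball w R \<subseteq> \<Omega>"
      using \<open>open \<Omega>\<close> by (auto simp: P_def open_contains_cball)
    show "\<exists>e>0. ball w e \<inter> \<Omega> \<subseteq> P"
      using spread[of w R] w R by (intro exI[of _ R]) (auto simp: P_def)
  qed (auto simp: P_def)
  moreover have "openin (top_of_set \<Omega>) (\<Omega> - P)"
    unfolding openin_contains_ball
  proof (intro conjI ballI)
    fix w assume w: "w \<in> \<Omega> - P"
    then obtain R where R: "R > 0" "cball w R \<subseteq> \<Omega>"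
      using \<open>open \<Omega>\<close> by (auto simp: open_contains_cball)
    have "x \<notin> P" if x: "x \<in> ball w (R / 3)" for x
    proof
      assume "x \<in> P"
      have "cball x (R / 2) \<subseteq> \<Omega>"
      proof
        fix t assume "t \<in> cball x (R / 2)"
        hence "dist w t \<le> R" using x dist_triangle[of w t x] R by auto
        thus "t \<in> \<Omega>" using R by auto
      qed
      moreover have "w \<in> ball x (R / 2)" using x R by (auto simp: dist_commute)
      ultimately have "u w > 0" using spread[of x "R / 2" w] \<open>x \<in> P\<close> by (auto simp: P_def)
      thus False using w by (auto simp: P_def)
    qed
    thus "\<exists>e>0. ball w e \<inter> \<Omega> \<subseteq> \<Omega> - P" using R(1) by (intro exI[of _ "R / 3"]) auto
  qed auto
  hence "closedin (top_of_set \<Omega>) P"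
    by (simp add: closedin_def P_def)
  ultimately have "P = {} \<or> P = \<Omega>" using \<open>connected \<Omega>\<close> by (simp add: connected_clopen)
  thus ?thesis using y z unfolding P_def by blast
qed

lemma pole_gap_reflect: "pole_gap 0 (c - fst z, snd z) = pole_gap c z"
proof -
  have "sinh (c - fst z) = - sinh (fst z - c)" by (metis minus_diff_eq sinh_minus)
  thus ?thesis by (simp add: pole_gap_def)
qed

lemma pole_gap_pos_off_axis: "fst z \<noteq> s0 \<Longrightarrow> pole_gap s0 z > 0"
  by (simp add: pole_gap_pos_iff)

text \<open>
  The bootstrapping argument of moving planes: the supremum of the positions reached from the left
  is itself reached, and cannot be negative.
\<close>

lemma continuity_method:
  fixes admissible :: "real \<Rightarrow> bool"
  assumes far: "\<exists>l0<0. \<forall>l\<le>l0. admissible l"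
    and right: "\<And>l. l < 0 \<Longrightarrow> admissible l \<Longrightarrow> \<exists>d>0. \<forall>m. l \<le> m \<and> m < l + d \<longrightarrow> admissible m"
    and limit: "\<And>l. l \<le> 0 \<Longrightarrow> (\<And>m. m < l \<Longrightarrow> admissible m) \<Longrightarrow> admissible l"
    and "l \<le> 0"
  shows "admissible l"
proof (rule limit[OF \<open>l \<le> 0\<close>], rule ccontr)
  fix b assume b: "b < l" and bad: "\<not> admissible b"
  define A where "A = {a. \<forall>m\<le>a. admissible m}"
  have ne: "A \<noteq> {}" using far unfolding A_def by blast
  have ub: "a \<le> b" if "a \<in> A" for a
  proof (rule ccontr)
    assume "\<not> a \<le> b"
    hence "admissible b" using that unfolding A_def by (metis mem_Collect_eq linear)
    thus False using bad by blast
  qed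
  have bdd: "bdd_above A" using ub by (rule bdd_aboveI)
  define T where "T = Sup A"
  have T: "T \<le> b" unfolding T_def using ne ub by (rule cSup_least)
  have below: "admissible m" if m: "m < T" for m
  proof -
    have "m < Sup A" using m by (simp only: T_def)
    then obtain a where a: "a \<in> A" "m < a" using less_cSupD[OF ne] by blast
    from a(1) have "\<forall>m\<le>a. admissible m" unfolding A_def by blast
    thus ?thesis using less_imp_le[OF a(2)] by blast
  qed
  have T0: "T < 0" using T b \<open>l \<le> 0\<close> by linarith
  have "admissible T" by (rule limit[OF less_imp_le[OF T0]]) (rule below)
  then obtain d where d: "d > 0" "\<And>m. T \<le> m \<Longrightarrow> m < T + d \<Longrightarrow> admissible m"
    using right[OF T0] by blast
  have "admissible m" if m: "m \<le> T + d / 2" for m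
  proof (cases "m < T")
    case False
    show ?thesis by (rule d(2)) (use False m d(1) in linarith)+
  qed (rule below)
  hence "T + d / 2 \<in> A" unfolding A_def by blast
  hence "T + d / 2 \<le> T" unfolding T_def using bdd by (rule cSup_upper)
  thus False using d(1) by linarith
qed
section \<open>Moving planes on the cylinder\<close>

text \<open>
  The problem on the cylinder. The singular points are \<open>s = 0\<close>, \<open>cos \<psi> = 0\<close>. The assumptions \<open>U_asymp\<close> and
  \<open>U_unif\<close> express that the ends of the cylinder are regular points of the sphere, and \<open>U_growth\<close>
  that the singular points are removable from below. The last assumption excludes
  coefficients with a second line of symmetry.
\<close>

locale cylinder_equation =
  fixes U k F :: "real \<times> real \<Rightarrow> real"
  assumes U_angular: "angular U"
    and U_cont: "continuous_on {z. pole_gap 0 z > 0} U"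
    and U_eq: "pole_gap 0 z > 0 \<Longrightarrow> has_laplacian U (- (k z * exp (2 * U z) + F z)) z"
    and k_nonneg: "pole_gap 0 z > 0 \<Longrightarrow> k z \<ge> 0"
    and F_nonneg: "pole_gap 0 z > 0 \<Longrightarrow> F z \<ge> 0"
    and k_mono: "\<bar>s'\<bar> \<le> \<bar>s\<bar> \<Longrightarrow> pole_gap 0 (s, \<psi>) > 0 \<Longrightarrow> pole_gap 0 (s', \<psi>) > 0 \<Longrightarrow> k (s, \<psi>) \<le> k (s', \<psi>)"
    and F_mono: "\<bar>s'\<bar> \<le> \<bar>s\<bar> \<Longrightarrow> pole_gap 0 (s, \<psi>) > 0 \<Longrightarrow> pole_gap 0 (s', \<psi>) > 0 \<Longrightarrow> F (s, \<psi>) \<le> F (s', \<psi>)"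
    and k_bounded: "b > 0 \<Longrightarrow> \<exists>M. \<forall>z. \<bar>fst z\<bar> \<ge> b \<longrightarrow> k z \<le> M"
    and U_growth: "\<epsilon> > 0 \<Longrightarrow> \<exists>r>0. \<forall>z. 0 < pole_gap 0 z \<and> pole_gap 0 z < r \<longrightarrow> U z \<ge> \<epsilon> * ln (pole_gap 0 z)"
    and U_asymp: "b > 0 \<Longrightarrow> \<exists>C. \<forall>z. \<bar>fst z\<bar> \<ge> b \<longrightarrow> \<bar>U z + \<bar>fst z\<bar>\<bar> \<le> C"
    and U_unif: "b > 0 \<Longrightarrow> e > 0 \<Longrightarrow> \<exists>d>0. \<forall>s s' \<psi>. s \<le> - b \<and> s' \<le> s \<and> s - s' \<le> d \<longrightarrow> \<bar>U (s', \<psi>) - U (s, \<psi>)\<bar> \<le> e"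
    and nondegenerate: "l < 0 \<Longrightarrow> \<exists>s \<psi>. s < l \<and> pole_gap (2 * l) (s, \<psi>) > 0 \<and>
          (k (2 * l - s, \<psi>) \<noteq> k (s, \<psi>) \<or> F (2 * l - s, \<psi>) \<noteq> F (s, \<psi>))"
begin

definition excess :: "real \<Rightarrow> real \<times> real \<Rightarrow> real" where
  "excess l z = U (2 * l - fst z, snd z) - U z"

text \<open>
  At the reflected poles, \<open>s = 2 l\<close> and \<open>cos \<psi> = 0\<close>, the excess involves the meaningless value of \<open>U\<close> at a pole.
\<close>

definition admissible :: "real \<Rightarrow> bool" where
  "admissible l \<longleftrightarrow> (\<forall>z. fst z < l \<and> pole_gap (2 * l) z > 0 \<longrightarrow> excess l z \<ge> 0)"

lemma admissibleD: "admissible l \<Longrightarrow> fst z < l \<Longrightarrow> pole_gap (2 * l) z > 0 \<Longrightarrow> excess l z \<ge> 0"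
  unfolding admissible_def by blast

lemma angular_excess: "angular (excess l)"
proof (rule angularI)
  fix s \<psi> \<psi>' :: real
  assume "cos \<psi> = cos \<psi>'" "sin \<psi> = sin \<psi>'"
  from angularD[OF U_angular this] show "excess l (s, \<psi>) = excess l (s, \<psi>')" by (simp add: excess_def)
qed

lemma U_cont_reflect: "continuous_on {z. pole_gap c z > 0} (\<lambda>z. U (c - fst z, snd z))"
proof (rule continuous_on_compose2[OF U_cont])
  show "(\<lambda>z. (c - fst z, snd z)) ` {z. pole_gap c z > 0} \<subseteq> {z. pole_gap 0 z > 0}"
    using pole_gap_reflect by (intro image_subsetI) simp
qed (intro continuous_intros)

lemma continuous_on_excess:
  assumes "\<And>z. z \<in> S \<Longrightarrow> pole_gap (2 * l) z > 0" "\<And>z. z \<in> S \<Longrightarrow> fst z < 0"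
  shows "continuous_on S (excess l)"
proof -
  have "S \<subseteq> {z. pole_gap (2 * l) z > 0}" using assms(1) by blast
  moreover have "pole_gap 0 z > 0" if "z \<in> S" for z
    using assms(2)[OF that] by (intro pole_gap_pos_off_axis) simp
  hence "S \<subseteq> {z. pole_gap 0 z > 0}" by blast
  ultimately show ?thesis unfolding excess_def
    by (intro continuous_on_diff continuous_on_subset[OF U_cont_reflect] continuous_on_subset[OF U_cont])
qed

lemma excess_laplacian:
  assumes l: "l \<le> 0" and z: "fst z < l" "pole_gap (2 * l) z > 0"
  defines "z' \<equiv> (2 * l - fst z, snd z)"
  shows "has_laplacian (excess l) (k z * exp (2 * U z) + F z - (k z' * exp (2 * U z') + F z')) z"
    and "0 \<le> k z" "k z \<le> k z'" "F z \<le> F z'"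
proof -
  have p: "pole_gap 0 z > 0" using l z by (intro pole_gap_pos_off_axis) auto
  have p': "pole_gap 0 z' > 0" using z by (simp add: z'_def pole_gap_reflect)
  have "has_laplacian (\<lambda>z. U (2 * l - fst z, snd z)) (- (k z' * exp (2 * U z') + F z')) z"
    by (rule has_laplacian_reflect) (use U_eq[OF p'] in \<open>simp add: z'_def\<close>)
  from has_laplacian_diff[OF this U_eq[OF p]]
  show "has_laplacian (excess l) (k z * exp (2 * U z) + F z - (k z' * exp (2 * U z') + F z')) z"
    unfolding excess_def by (simp add: algebra_simps)
  show "0 \<le> k z" by (rule k_nonneg[OF p])
  have "\<bar>2 * l - fst z\<bar> \<le> \<bar>fst z\<bar>" using l z by auto
  thus "k z \<le> k z'" "F z \<le> F z'"
    using k_mono[of "2 * l - fst z" "fst z" "snd z"] F_mono[of "2 * l - fst z" "fst z" "snd z"] p p'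
    by (auto simp: z'_def)
qed

lemma excess_superharmonic:
  assumes l: "l \<le> 0" and z: "fst z < l" "pole_gap (2 * l) z > 0" and "excess l z \<ge> 0"
  shows "\<exists>L\<le>0. has_laplacian (excess l) L z"
proof -
  define z' where "z' = (2 * l - fst z, snd z)"
  note * = excess_laplacian[OF l z, folded z'_def]
  have "U z \<le> U z'" using assms(4) by (simp add: excess_def z'_def)
  hence "k z * exp (2 * U z) \<le> k z' * exp (2 * U z')" using *(2,3) by (intro mult_mono) auto
  hence "k z * exp (2 * U z) + F z - (k z' * exp (2 * U z') + F z') \<le> 0" using *(4) by simp
  thus ?thesis using *(1) by blast
qed

text \<open>
  Reflection increases both coefficients, so only the difference of the exponentials can have the
  wrong sign; the tangent line inequality for the exponential makes it linear in the excess.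
\<close>

lemma excess_subsolution:
  assumes l: "l \<le> 0" and z: "fst z < l" "pole_gap (2 * l) z > 0"
    and q: "2 * k z * exp (2 * U z) \<le> q" and neg: "excess l z < 0"
  shows "\<exists>L. has_laplacian (excess l) L z \<and> L \<le> q * (- excess l z)"
proof -
  define z' where "z' = (2 * l - fst z, snd z)"
  note * = excess_laplacian[OF l z, folded z'_def]
  have U': "U z' = U z + excess l z" by (simp add: excess_def z'_def)
  have "k z * exp (2 * U z) + F z - (k z' * exp (2 * U z') + F z') \<le> k z * exp (2 * U z) - k z * exp (2 * U z')"
    using *(4) mult_right_mono[OF *(3) exp_ge_zero, of "2 * U z'"] by linarith
  also have "\<dots> = k z * exp (2 * U z) * (1 - exp (2 * excess l z))"
    by (simp add: U' algebra_simps exp_add)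
  also have "\<dots> \<le> k z * exp (2 * U z) * (- 2 * excess l z)"
  proof (rule mult_left_mono)
    show "1 - exp (2 * excess l z) \<le> - 2 * excess l z"
      using exp_ge_add_one_self[of "2 * excess l z"] by linarith
  qed (use *(2) in simp)
  also have "\<dots> = 2 * k z * exp (2 * U z) * (- excess l z)" by simp
  also have "\<dots> \<le> q * (- excess l z)" using q neg by (intro mult_right_mono) auto
  finally show ?thesis using *(1) by blast
qed

text \<open>
  \<open>U\<close> is superharmonic, so its values on \<open>\<bar>s\<bar> = 1\<close> bound it from below near the poles as well.
\<close>

lemma U_lower_bound: "\<exists>C. \<forall>z. pole_gap 0 z > 0 \<longrightarrow> U z \<ge> - \<bar>fst z\<bar> - C"
proof -
  obtain C0 where C0: "\<And>z. \<bar>fst z\<bar> \<ge> 1 \<Longrightarrow> \<bar>U z + \<bar>fst z\<bar>\<bar> \<le> C0" using U_asymp[OF zero_less_one] by blast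
  have C0_nonneg: "C0 \<ge> 0" using C0[of "(1, 0)"] by simp
  have "U z \<ge> - \<bar>fst z\<bar> - (C0 + 1)" if p: "pole_gap 0 z > 0" for z
  proof (cases "\<bar>fst z\<bar> \<ge> 1")
    case True
    thus ?thesis using C0[OF True] by linarith
  next
    case False
    have "U z \<ge> - 1 - C0"
    proof (rule punctured_strip_minimum_principle[of "-1" 0 1 U])
      show "continuous_on {z. - 1 \<le> fst z \<and> fst z \<le> 1 \<and> 0 < pole_gap 0 z} U"
        by (rule continuous_on_subset[OF U_cont]) auto
      show "angular U" by (rule U_angular)
      show "\<exists>L\<le>0. has_laplacian U L z" if "0 < pole_gap 0 z" for z
      proof -
        have "k z * exp (2 * U z) + F z \<ge> 0" using k_nonneg[OF that] F_nonneg[OF that] by simp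
        thus ?thesis using U_eq[OF that] by (intro exI[of _ "- (k z * exp (2 * U z) + F z)"]) simp
      qed
      show "- 1 - C0 \<le> U (- 1, \<psi>)" "- 1 - C0 \<le> U (1, \<psi>)" for \<psi>
        using C0[of "(-1, \<psi>)"] C0[of "(1, \<psi>)"] by auto
      show "\<exists>r>0. \<forall>z. - 1 < fst z \<and> fst z < 1 \<and> 0 < pole_gap 0 z \<and> pole_gap 0 z < r \<longrightarrow> \<epsilon> * ln (pole_gap 0 z) \<le> U z"
        if "\<epsilon> > 0" for \<epsilon> using U_growth[OF that] by blast
    qed (use False p in auto)
    thus ?thesis using abs_ge_zero[of "fst z"] by linarith
  qed
  thus ?thesis by blast
qed

lemma excess_on_axis: "excess l (l, \<psi>) = 0"
  by (simp add: excess_def)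

text \<open>
  Outside the strip \<open>l - C < s < l\<close> the sign is decided by \<open>U \<ge> - \<bar>s\<bar> - C\<close>, valid everywhere, and
  \<open>U \<le> - \<bar>s\<bar> + C\<close>, valid for \<open>\<bar>s\<bar> \<ge> 1\<close>. In the
  strip, whose width does not depend on \<open>l\<close>, the coefficient \<open>2 k exp (2 U)\<close> is of order
  \<open>exp (2 l)\<close>, so for very negative \<open>l\<close> the strip is narrow enough.
\<close>

lemma admissible_far_left: "\<exists>l0<0. \<forall>l\<le>l0. admissible l"
proof -
  obtain C1 where C1: "\<And>z. pole_gap 0 z > 0 \<Longrightarrow> U z \<ge> - \<bar>fst z\<bar> - C1" using U_lower_bound by blast
  obtain C2 where C2: "\<And>z. \<bar>fst z\<bar> \<ge> 1 \<Longrightarrow> \<bar>U z + \<bar>fst z\<bar>\<bar> \<le> C2" using U_asymp[OF zero_less_one] by blast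
  obtain M where M: "\<And>z. \<bar>fst z\<bar> \<ge> 1 \<Longrightarrow> k z \<le> M" using k_bounded[OF zero_less_one] by blast
  define C where "C = max 1 (max C1 C2)"
  have C: "C \<ge> 1" "C1 \<le> C" "C2 \<le> C" by (auto simp: C_def)
  define W where "W = 2 * \<bar>M\<bar> * exp (2 * C) * C\<^sup>2"
  have W: "W \<ge> 0" by (simp add: W_def)
  (* the first bound keeps the reflected pole s = 2 l out of the strip; the second gives W exp (2 l) < 1 *)
  define l0 where "l0 = min (- C - 1) (- W)"
  have "admissible l" if l: "l \<le> l0" for l
    unfolding admissible_def
  proof (intro allI impI, elim conjE)
    have lC: "l \<le> - C - 1" "l \<le> - W" using l by (auto simp: l0_def)
    have far: "excess l z \<ge> 0" if z: "fst z \<le> l - C" "pole_gap (2 * l) z > 0" for z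
    proof -
      have "U (2 * l - fst z, snd z) \<ge> - \<bar>2 * l - fst z\<bar> - C1"
        using C1[of "(2 * l - fst z, snd z)"] z by (simp add: pole_gap_reflect)
      moreover have "U z \<le> fst z + C2" using C2[of z] z lC C by (simp add: abs_le_iff)
      ultimately have "excess l z \<ge> - \<bar>2 * l - fst z\<bar> - fst z - 2 * C" using C unfolding excess_def by linarith
      moreover have "- \<bar>2 * l - fst z\<bar> - fst z - 2 * C \<ge> 0"
        using z lC C by (cases "fst z \<le> 2 * l") auto
      ultimately show ?thesis by linarith
    qed
    fix z assume z: "fst z < l" "pole_gap (2 * l) z > 0"
    show "excess l z \<ge> 0"
    proof (cases "fst z \<le> l - C")
      case False
      define q where "q = 2 * \<bar>M\<bar> * exp (2 * (l + C))"
      have off: "pole_gap (2 * l) z > 0" if "l - C \<le> fst z" for z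
        using that lC C by (intro pole_gap_pos_off_axis) auto
      show ?thesis
      proof (rule narrow_strip_minimum_principle[of "l - C" l q "excess l"])
        have "q * (l - (l - C))\<^sup>2 = W * exp (2 * l)"
          by (simp add: q_def W_def exp_add[symmetric] algebra_simps)
        also have "\<dots> \<le> W * exp (2 * (- W))" using lC W by (intro mult_left_mono) auto
        also have "\<dots> < 1"
        proof -
          have "W < exp (2 * W)" using exp_ge_add_one_self[of "2 * W"] W by linarith
          hence "W / exp (2 * W) < 1" by simp
          thus ?thesis by (simp add: exp_minus divide_inverse)
        qed
        finally show "q * (l - (l - C))\<^sup>2 < 1" .
        show "q \<ge> 0" by (simp add: q_def)
        show "continuous_on {z. l - C \<le> fst z \<and> fst z \<le> l} (excess l)"
          by (rule continuous_on_excess) (use off lC C in auto)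
        show "angular (excess l)" by (rule angular_excess)
        show "\<exists>L. has_laplacian (excess l) L z \<and> L \<le> q * - excess l z"
          if z: "l - C < fst z" "fst z < l" "excess l z < 0" for z
        proof (rule excess_subsolution)
          have "1 \<le> \<bar>fst z\<bar>" "fst z < 0" using z lC C by auto
          hence "U z \<le> l + C" using C2[of z] C z by (simp add: abs_le_iff)
          moreover have "k z \<le> \<bar>M\<bar>" using M[of z] \<open>1 \<le> \<bar>fst z\<bar>\<close> by linarith
          ultimately show "2 * k z * exp (2 * U z) \<le> q"
            unfolding q_def by (intro mult_mono[of "2 * k z"]) auto
        qed (use z off lC C in auto)
        show "0 \<le> excess l (l - C, \<psi>)" for \<psi> using far[of "(l - C, \<psi>)"] off[of "(l - C, \<psi>)"] by simp
        show "0 \<le> excess l (l, \<psi>)" for \<psi> by (simp add: excess_on_axis)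
      qed (use z False C in auto)
    qed (use far z in auto)
  qed
  moreover have "l0 < 0" using C by (simp add: l0_def min_less_iff_disj)
  ultimately show ?thesis by blast
qed

lemma connected_punctured_half_plane: "connected {z. fst z < l \<and> pole_gap s0 z > 0}"
proof -
  have "{z::real \<times> real. fst z = s0 \<and> cos (snd z) = 0} \<subseteq> (\<lambda>i::int. (s0, of_int i * (pi / 2))) ` UNIV"
  proof
    fix z :: "real \<times> real" assume "z \<in> {z. fst z = s0 \<and> cos (snd z) = 0}"
    then obtain i :: int where "fst z = s0" "snd z = of_int i * (pi / 2)" by (auto simp: cos_zero_iff_int)
    hence "z = (s0, of_int i * (pi / 2))" by (metis prod.collapse)
    thus "z \<in> (\<lambda>i::int. (s0, of_int i * (pi / 2))) ` UNIV" by blast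
  qed
  hence c: "countable {z::real \<times> real. fst z = s0 \<and> cos (snd z) = 0}"
    by (rule countable_subset) auto
  have "{z::real \<times> real. fst z < l} = {..<l} \<times> UNIV" by auto
  hence "convex {z::real \<times> real. fst z < l}" by (simp add: convex_Times)
  moreover have "open {z::real \<times> real. fst z < l}" by (intro open_Collect_less continuous_intros)
  ultimately have "connected ({z::real \<times> real. fst z < l} - {z. fst z = s0 \<and> cos (snd z) = 0})"
    by (intro connected_open_diff_countable c) (auto intro: convex_connected)
  also have "{z::real \<times> real. fst z < l} - {z. fst z = s0 \<and> cos (snd z) = 0} = {z. fst z < l \<and> pole_gap s0 z > 0}"
    by (auto simp: pole_gap_pos_iff)
  finally show ?thesis .
qed

lemma open_punctured_half_plane: "open {z. fst z < l \<and> pole_gap s0 z > 0}"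
proof -
  have "{z. fst z < l \<and> pole_gap s0 z > 0} = {z. fst z < l} \<inter> {z. 0 < pole_gap s0 z}" by auto
  thus ?thesis by (auto intro!: open_Int open_Collect_less continuous_intros)
qed

text \<open>
  By the strong minimum principle one positive value suffices. If the excess vanished identically, its
  Laplacian would vanish too. That Laplacian is a sum of
  two nonpositive terms, one for each coefficient, so both coefficients would be symmetric about \<open>s = l\<close>.
\<close>

lemma excess_pos:
  assumes l: "l < 0" and "admissible l" and z: "fst z < l" "pole_gap (2 * l) z > 0"
  shows "excess l z > 0"
proof -
  let ?\<Omega> = "{z. fst z < l \<and> pole_gap (2 * l) z > 0}"
  have "\<exists>y\<in>?\<Omega>. excess l y > 0"
  proof (rule ccontr)
    assume "\<not> ?thesis"
    hence zero: "excess l w = 0" if "w \<in> ?\<Omega>" for w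
      using admissibleD[OF \<open>admissible l\<close>, of w] that by (intro antisym) (blast intro: leI, blast)
    obtain s \<psi> where s: "s < l" "pole_gap (2 * l) (s, \<psi>) > 0"
        "k (2 * l - s, \<psi>) \<noteq> k (s, \<psi>) \<or> F (2 * l - s, \<psi>) \<noteq> F (s, \<psi>)"
      using nondegenerate[OF l] by blast
    define w where "w = (s, \<psi>)"
    define w' where "w' = (2 * l - s, \<psi>)"
    have w: "w \<in> ?\<Omega>" using s by (simp add: w_def)
    have lap: "has_laplacian (excess l) (k w * exp (2 * U w) + F w - (k w' * exp (2 * U w') + F w')) w"
      and le: "k w \<le> k w'" "F w \<le> F w'"
      using excess_laplacian[of l w] l s by (auto simp: w_def w'_def)
    have "\<forall>\<^sub>F x in nhds w. excess l w \<le> excess l x"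
      using eventually_nhds_in_open[OF open_punctured_half_plane w]
      by eventually_elim (use zero w in simp)
    with lap have "k w * exp (2 * U w) + F w - (k w' * exp (2 * U w') + F w') \<ge> 0"
      by (rule has_laplacian_local_min)
    moreover have U': "U w' = U w" using zero[OF w] by (simp add: excess_def w_def w'_def)
    ultimately have "(k w' - k w) * exp (2 * U w) + (F w' - F w) \<le> 0" by (simp add: algebra_simps)
    moreover have "(k w' - k w) * exp (2 * U w) + (F w' - F w) > 0"
    proof (cases "k w' = k w")
      case True
      thus ?thesis using s(3) le by (simp add: w_def w'_def)
    next
      case False
      hence "(k w' - k w) * exp (2 * U w) > 0" using le by simp
      thus ?thesis using le by linarith
    qed
    ultimately show False by linarith
  qed
  then obtain y where y: "y \<in> ?\<Omega>" "excess l y > 0" by blast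
  show ?thesis
  proof (rule strong_minimum_principle[of ?\<Omega> "excess l" y z])
    show "continuous_on ?\<Omega> (excess l)" by (rule continuous_on_excess) (use l in auto)
    show "\<exists>L\<le>0. has_laplacian (excess l) L z" if "z \<in> ?\<Omega>" for z
      using excess_superharmonic[of l z] admissibleD[OF \<open>admissible l\<close>, of z] that l by auto
  qed (use y z admissibleD[OF \<open>admissible l\<close>] open_punctured_half_plane connected_punctured_half_plane in auto)
qed

text \<open>
  The minimum over the circle \<open>s = l - \<delta>\<close> is positive and, by superharmonicity, bounds
  the excess on the whole half cylinder, uniformly up to the infinite end and up to the reflected pole.
\<close>

lemma excess_bounded_below:
  assumes l: "l < 0" and "admissible l" and \<delta>: "\<delta> > 0" "\<delta> < - l"
  shows "\<exists>\<eta>>0. \<forall>z. fst z \<le> l - \<delta> \<and> pole_gap (2 * l) z > 0 \<longrightarrow> excess l z \<ge> \<eta>"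
proof -
  define \<beta> where "\<beta> = l - \<delta>"
  have \<beta>: "\<beta> < l" "2 * l < \<beta>" using \<delta> by (auto simp: \<beta>_def)
  have "continuous_on ({\<beta>} \<times> {0..2*pi}) (excess l)"
    by (rule continuous_on_excess) (use \<beta> l in \<open>auto intro: pole_gap_pos_off_axis\<close>)
  moreover have "compact ({\<beta>} \<times> {0..2*pi})" by (intro compact_Times) auto
  ultimately obtain y where y: "y \<in> {\<beta>} \<times> {0..2*pi}" "\<And>w. w \<in> {\<beta>} \<times> {0..2*pi} \<Longrightarrow> excess l y \<le> excess l w"
    using continuous_attains_inf[of "{\<beta>} \<times> {0..2*pi}" "excess l"] by auto
  define \<eta> where "\<eta> = excess l y"
  have \<eta>: "\<eta> > 0" unfolding \<eta>_def using y(1) \<beta> by (intro excess_pos[OF l \<open>admissible l\<close>] pole_gap_pos_off_axis) auto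
  have bdry: "excess l (\<beta>, \<psi>) \<ge> \<eta>" for \<psi>
  proof -
    obtain \<psi>' where "0 \<le> \<psi>'" "\<psi>' \<le> 2 * pi" "cos \<psi>' = cos \<psi>" "sin \<psi>' = sin \<psi>"
      using angular_representative by blast
    with angularD[OF angular_excess this(3,4), of l \<beta>] y(2)[of "(\<beta>, \<psi>')"] show ?thesis by (simp add: \<eta>_def)
  qed
  have "min (- \<beta>) 1 > 0" using \<beta> l by simp
  then obtain C where C: "\<And>z. \<bar>fst z\<bar> \<ge> min (- \<beta>) 1 \<Longrightarrow> \<bar>U z + \<bar>fst z\<bar>\<bar> \<le> C" using U_asymp by blast
  have "excess l z \<ge> \<eta>" if z: "fst z \<le> \<beta>" "pole_gap (2 * l) z > 0" for z
  proof (cases "fst z = \<beta>")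
    case True
    thus ?thesis using bdry[of "snd z"] by (metis prod.collapse)
  next
    case False
    show ?thesis
    proof (rule punctured_half_cylinder_minimum_principle[of "2 * l" \<beta> "excess l" \<eta> "2 * l - 1" "- 2 * l - 2 * C"])
      show "continuous_on {z. fst z \<le> \<beta> \<and> 0 < pole_gap (2 * l) z} (excess l)"
        by (rule continuous_on_excess) (use \<beta> l in auto)
      show "\<exists>L\<le>0. has_laplacian (excess l) L z" if "fst z < \<beta>" "0 < pole_gap (2 * l) z" for z
        using excess_superharmonic[of l z] admissibleD[OF \<open>admissible l\<close>, of z] that l \<beta> by auto
      show "- 2 * l - 2 * C \<le> excess l z" if z: "fst z \<le> 2 * l - 1" for z
      proof -
        have "\<bar>fst z\<bar> \<ge> min (- \<beta>) 1" "\<bar>2 * l - fst z\<bar> \<ge> min (- \<beta>) 1" using z l \<beta> by auto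
        from C[OF this(1)] C[of "(2 * l - fst z, snd z)"] this(2) show ?thesis
          using z l by (simp add: excess_def abs_le_iff)
      qed
      show "\<exists>r>0. \<forall>z. fst z < \<beta> \<and> 0 < pole_gap (2 * l) z \<and> pole_gap (2 * l) z < r \<longrightarrow> \<epsilon> * ln (pole_gap (2 * l) z) \<le> excess l z"
        if \<epsilon>: "\<epsilon> > 0" for \<epsilon>
      proof -
        obtain r where r: "r > 0" "\<And>z. 0 < pole_gap 0 z \<Longrightarrow> pole_gap 0 z < r \<Longrightarrow> U z \<ge> \<epsilon> / 2 * ln (pole_gap 0 z)"
          using U_growth[of "\<epsilon> / 2"] \<epsilon> by auto
        define r' where "r' = min r (exp (- 2 * C / \<epsilon>))"
        have "\<epsilon> * ln (pole_gap (2 * l) z) \<le> excess l z"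
          if z: "fst z < \<beta>" "0 < pole_gap (2 * l) z" "pole_gap (2 * l) z < r'" for z
        proof -
          have "ln (pole_gap (2 * l) z) < ln (exp (- 2 * C / \<epsilon>))"
            using z by (subst ln_less_cancel_iff) (auto simp: r'_def)
          hence 1: "\<epsilon> / 2 * ln (pole_gap (2 * l) z) \<le> - C" using \<epsilon> by (simp add: field_simps)
          have "U (2 * l - fst z, snd z) \<ge> \<epsilon> / 2 * ln (pole_gap (2 * l) z)"
            using r(2)[of "(2 * l - fst z, snd z)"] z by (simp add: pole_gap_reflect r'_def)
          moreover have "\<bar>fst z\<bar> \<ge> min (- \<beta>) 1" using z \<beta> l by auto
          hence "U z \<le> C" using C[of z] by linarith
          ultimately have "excess l z \<ge> \<epsilon> / 2 * ln (pole_gap (2 * l) z) - C" by (simp add: excess_def)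
          moreover have "\<epsilon> * ln (pole_gap (2 * l) z) = \<epsilon> / 2 * ln (pole_gap (2 * l) z) + \<epsilon> / 2 * ln (pole_gap (2 * l) z)"
            by simp
          ultimately show ?thesis using 1 by linarith
        qed
        moreover have "r' > 0" using r by (simp add: r'_def)
        ultimately show ?thesis by blast
      qed
    qed (use z False \<beta> bdry angular_excess in auto)
  qed
  thus ?thesis using \<eta> unfolding \<beta>_def by blast
qed

text \<open>
  Reflecting \<open>(s, \<psi>)\<close> at \<open>m\<close> gives the same point as reflecting \<open>(s - 2 (m - l), \<psi>)\<close> at \<open>l\<close>. So \<open>excess m\<close> and a
  translate of \<open>excess l\<close> differ by an increment of \<open>U\<close> over a short segment far from the poles; the possibly
  unbounded values of \<open>U\<close> near a pole cancel. Uniform continuity of \<open>U\<close> then preserves the lower bound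
  away from the axis of reflection.
\<close>

lemma admissible_slightly_right:
  assumes l: "l < 0" and "admissible l"
  shows "\<exists>d>0. \<forall>m. l \<le> m \<and> m < l + d \<longrightarrow> admissible m"
proof -
  have b: "- l / 2 > 0" using l by simp
  obtain C where C: "\<And>z. \<bar>fst z\<bar> \<ge> - l / 2 \<Longrightarrow> \<bar>U z + \<bar>fst z\<bar>\<bar> \<le> C" using U_asymp[OF b] by blast
  obtain M where M: "\<And>z. \<bar>fst z\<bar> \<ge> - l / 2 \<Longrightarrow> k z \<le> M" using k_bounded[OF b] by blast
  define q where "q = 2 * \<bar>M\<bar> * exp (2 * C)"
  have q: "q \<ge> 0" by (simp add: q_def)
  (* a strip of width 2 delta has to be narrow for q and free of the reflected pole *)
  define \<delta> where "\<delta> = min (- l / 4) (1 / (2 * (q + 1)))"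
  have \<delta>: "\<delta> > 0" "\<delta> \<le> - l / 4" using l q by (auto simp: \<delta>_def)
  have q\<delta>: "q * (2 * \<delta>)\<^sup>2 < 1"
  proof -
    have "2 * \<delta> \<le> 2 * (1 / (2 * (q + 1)))" unfolding \<delta>_def by (intro mult_left_mono) auto
    also have "2 * (1 / (2 * (q + 1))) = 1 / (q + 1)" using q by (simp add: divide_simps)
    finally have "2 * \<delta> \<le> 1 / (q + 1)" .
    hence "(2 * \<delta>)\<^sup>2 \<le> (1 / (q + 1))\<^sup>2" using \<delta> by (intro power_mono) auto
    hence "q * (2 * \<delta>)\<^sup>2 \<le> q * (1 / (q + 1))\<^sup>2" using q by (intro mult_left_mono)
    also have "\<dots> < 1"
    proof -
      have "(q + 1)\<^sup>2 = q * q + 2 * q + 1" by algebra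
      hence "q < (q + 1)\<^sup>2" using mult_nonneg_nonneg[OF q q] q by linarith
      thus ?thesis using q by (simp add: power_divide)
    qed
    finally show ?thesis .
  qed
  obtain \<eta> where \<eta>: "\<eta> > 0" "\<And>z. fst z \<le> l - \<delta> \<Longrightarrow> pole_gap (2 * l) z > 0 \<Longrightarrow> excess l z \<ge> \<eta>"
    using excess_bounded_below[OF l \<open>admissible l\<close> \<delta>(1)] \<delta> l by auto
  have "- (l - \<delta>) > 0" using \<delta> l by simp
  then obtain d1 where d1: "d1 > 0" "\<And>s s' \<psi>. s \<le> l - \<delta> \<Longrightarrow> s' \<le> s \<Longrightarrow> s - s' \<le> d1 \<Longrightarrow> \<bar>U (s', \<psi>) - U (s, \<psi>)\<bar> \<le> \<eta>"
    using U_unif[of "- (l - \<delta>)" \<eta>] \<eta>(1) by auto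
  define d where "d = min \<delta> (d1 / 2)"
  have "admissible m" if m: "l \<le> m" "m < l + d" for m
    unfolding admissible_def
  proof (intro allI impI, elim conjE)
    have m\<delta>: "m < l + \<delta>" "2 * (m - l) \<le> d1" using m by (auto simp: d_def)
    have m0: "m < l / 2" using m\<delta> \<delta> by auto
    have left: "excess m z \<ge> 0" if z: "fst z \<le> l - \<delta>" "pole_gap (2 * m) z > 0" for z
    proof -
      define s' where "s' = fst z - 2 * (m - l)"
      have s': "s' \<le> fst z" "fst z - s' \<le> d1" using m m\<delta> by (auto simp: s'_def)
      have "pole_gap (2 * l) (s', snd z) = pole_gap (2 * m) z"
        by (simp add: pole_gap_def s'_def)
      hence "excess l (s', snd z) \<ge> \<eta>" using \<eta>(2)[of "(s', snd z)"] z s' by simp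
      moreover have "\<bar>U (s', snd z) - U (fst z, snd z)\<bar> \<le> \<eta>" using d1(2) z(1) s' by blast
      moreover have "excess m z = excess l (s', snd z) + (U (s', snd z) - U (fst z, snd z))"
        by (simp add: excess_def s'_def algebra_simps)
      ultimately show ?thesis by linarith
    qed
    fix z assume z: "fst z < m" "pole_gap (2 * m) z > 0"
    show "excess m z \<ge> 0"
    proof (cases "fst z \<le> l - \<delta>")
      case False
      have off: "pole_gap (2 * m) z > 0" if "l - \<delta> \<le> fst z" for z
        using that m\<delta> \<delta> l by (intro pole_gap_pos_off_axis) auto
      show ?thesis
      proof (rule narrow_strip_minimum_principle[of "l - \<delta>" m q "excess m"])
        have "(m - (l - \<delta>))\<^sup>2 \<le> (2 * \<delta>)\<^sup>2" using m m\<delta> \<delta> by (intro power_mono) auto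
        hence "q * (m - (l - \<delta>))\<^sup>2 \<le> q * (2 * \<delta>)\<^sup>2" using q by (intro mult_left_mono)
        thus "q * (m - (l - \<delta>))\<^sup>2 < 1" using q\<delta> by linarith
        show "continuous_on {z. l - \<delta> \<le> fst z \<and> fst z \<le> m} (excess m)"
          by (rule continuous_on_excess) (use off m0 l in auto)
        show "angular (excess m)" by (rule angular_excess)
        show "\<exists>L. has_laplacian (excess m) L z \<and> L \<le> q * - excess m z"
          if z: "l - \<delta> < fst z" "fst z < m" "excess m z < 0" for z
        proof (rule excess_subsolution)
          have b: "- l / 2 \<le> \<bar>fst z\<bar>" using z m0 by auto
          have "U z \<le> C" using C[OF b] by linarith
          moreover have "k z \<le> \<bar>M\<bar>" using M[OF b] by linarith
          ultimately show "2 * k z * exp (2 * U z) \<le> q"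
            unfolding q_def by (intro mult_mono[of "2 * k z"]) auto
        qed (use z off m0 l in auto)
        show "0 \<le> excess m (l - \<delta>, \<psi>)" for \<psi> using left[of "(l - \<delta>, \<psi>)"] off[of "(l - \<delta>, \<psi>)"] by simp
        show "0 \<le> excess m (m, \<psi>)" for \<psi> by (simp add: excess_on_axis)
      qed (use z False m \<delta> q in auto)
    qed (use left z in auto)
  qed
  moreover have "d > 0" using \<delta> d1 by (simp add: d_def)
  ultimately show ?thesis by blast
qed

lemma admissible_limit:
  assumes l: "l \<le> 0" and admissible: "\<And>m. m < l \<Longrightarrow> admissible m"
  shows "admissible l"
  unfolding admissible_def
proof (intro allI impI, elim conjE)
  fix z assume z: "fst z < l" "pole_gap (2 * l) z > 0"
  have "open {z. 0 < pole_gap 0 z}" by (intro open_Collect_less continuous_intros)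
  hence "isCont U (2 * l - fst z, snd z)"
    using U_cont z by (simp add: continuous_on_eq_continuous_at pole_gap_reflect)
  hence "((\<lambda>m. U (2 * m - fst z, snd z)) \<longlongrightarrow> U (2 * l - fst z, snd z)) (at_left l)"
    by (rule isCont_tendsto_compose) (intro tendsto_intros)
  hence "((\<lambda>m. excess m z) \<longlongrightarrow> excess l z) (at_left l)"
    unfolding excess_def by (intro tendsto_intros)
  moreover have "\<forall>\<^sub>F m in at_left l. excess m z \<ge> 0"
  proof -
    have "((\<lambda>m. pole_gap (2 * m) z) \<longlongrightarrow> pole_gap (2 * l) z) (at_left l)"
      unfolding pole_gap_def by (intro tendsto_intros)
    hence "\<forall>\<^sub>F m in at_left l. pole_gap (2 * m) z > 0" using z(2) by (rule order_tendstoD(1))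
    moreover have "\<forall>\<^sub>F m in at_left l. fst z < m"
      using z(1) by (intro eventually_at_leftI[of "fst z"]) auto
    moreover have "\<forall>\<^sub>F m in at_left l. m < l" by (simp add: eventually_at_filter)
    ultimately show ?thesis by eventually_elim (auto intro: admissibleD admissible)
  qed
  ultimately show "excess l z \<ge> 0" by (rule tendsto_lowerbound) simp
qed

lemma reflection_inequality:
  assumes "s < 0"
  shows "U (- s, \<psi>) \<ge> U (s, \<psi>)"
proof -
  have g: "admissible 0"
  proof (rule continuity_method[of admissible])
    show "\<exists>l0<0. \<forall>l\<le>l0. admissible l" by (rule admissible_far_left)
    show "\<exists>d>0. \<forall>m. l \<le> m \<and> m < l + d \<longrightarrow> admissible m" if "l < 0" "admissible l" for l
      using that by (rule admissible_slightly_right)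
    show "admissible l" if "l \<le> 0" "\<And>m. m < l \<Longrightarrow> admissible m" for l
      using that by (rule admissible_limit)
  qed simp
  have p: "pole_gap (2 * 0) (s, \<psi>) > 0"
    by (rule pole_gap_pos_off_axis) (use assms in simp)
  have "excess 0 (s, \<psi>) \<ge> 0" by (rule admissibleD[OF g _ p]) (use assms in simp)
  thus ?thesis by (simp only: excess_def fst_conv snd_conv mult_zero_right diff_0 diff_ge_0_iff_ge)
qed

end

section \<open>The spherical Laplacian in Mercator coordinates with a horizontal axis\<close>

lemma sgn_unit: "norm x = 1 \<Longrightarrow> sgn x = (x :: real^3)"
  by (simp add: sgn_div_norm)

lemma GDERIV_unique:
  assumes "GDERIV f x :> D" "GDERIV f x :> D'"
  shows "D = D'"
proof -
  have "(\<lambda>h. h \<bullet> D) = (\<lambda>h. h \<bullet> D')"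
    using assms unfolding gderiv_def by (rule has_derivative_unique)
  hence "\<forall>h. h \<bullet> D = h \<bullet> D'" by (simp add: fun_eq_iff)
  thus ?thesis by (simp only: vector_eq_ldot)
qed

lemma has_derivative_sgn_unit:
  fixes \<theta> :: "real^3"
  assumes "norm \<theta> = 1"
  shows "(sgn has_derivative (\<lambda>h. h - (\<theta> \<bullet> h) *\<^sub>R \<theta>)) (at \<theta>)"
proof -
  have nz: "\<theta> \<noteq> 0" using assms by auto
  have n: "(norm has_derivative (\<lambda>h. h \<bullet> sgn \<theta>)) (at \<theta>)" by (rule has_derivative_norm[OF nz])
  have i: "((\<lambda>x. inverse (norm x)) has_derivative (\<lambda>h. - (inverse (norm \<theta>) * (h \<bullet> sgn \<theta>) * inverse (norm \<theta>)))) (at \<theta>)"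
    by (rule Deriv.has_derivative_inverse[OF _ n]) (use nz in simp)
  have "((\<lambda>x. inverse (norm x) *\<^sub>R x) has_derivative
      (\<lambda>h. inverse (norm \<theta>) *\<^sub>R h + (- (inverse (norm \<theta>) * (h \<bullet> sgn \<theta>) * inverse (norm \<theta>))) *\<^sub>R \<theta>)) (at \<theta>)"
    by (rule has_derivative_scaleR[OF i has_derivative_ident])
  moreover have "(\<lambda>x::real^3. inverse (norm x) *\<^sub>R x) = sgn" by (rule ext) (simp only: sgn_div_norm)
  moreover have "(\<lambda>h. inverse (norm \<theta>) *\<^sub>R h + (- (inverse (norm \<theta>) * (h \<bullet> sgn \<theta>) * inverse (norm \<theta>))) *\<^sub>R \<theta>)
      = (\<lambda>h. h - (\<theta> \<bullet> h) *\<^sub>R \<theta>)"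
    unfolding sgn_unit[OF assms] assms by (rule ext) (simp add: inner_commute)
  ultimately show ?thesis by simp
qed

text \<open>
  The derivatives of the extension of \<open>v\<close> that is constant along rays from the origin.
\<close>

locale ray_extension =
  fixes v :: "real^3 \<Rightarrow> real" and W :: "(real^3) set"
    and g' :: "real^3 \<Rightarrow> (real^3) \<Rightarrow>\<^sub>L real"
    and g'' :: "real^3 \<Rightarrow> (real^3) \<Rightarrow>\<^sub>L ((real^3) \<Rightarrow>\<^sub>L real)"
  assumes open_W: "open W"
    and deriv1: "x \<in> W \<Longrightarrow> ((\<lambda>x. v (sgn x)) has_derivative blinfun_apply (g' x)) (at x)"
    and deriv2: "x \<in> W \<Longrightarrow> (g' has_derivative blinfun_apply (g'' x)) (at x)"
    and sgn_W: "x \<in> W \<Longrightarrow> sgn x \<in> W"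
begin

definition grad :: "real^3 \<Rightarrow> real^3" where
  "grad x = (\<Sum>b\<in>Basis. g' x b *\<^sub>R b)"

lemma inner_grad: "h \<bullet> grad x = g' x h"
proof -
  have "h \<bullet> grad x = (\<Sum>b\<in>Basis. (h \<bullet> b) * g' x b)"
    by (simp add: grad_def inner_sum_right mult.commute)
  also have "\<dots> = g' x (\<Sum>b\<in>Basis. (h \<bullet> b) *\<^sub>R b)"
    by (simp add: blinfun.sum_right blinfun.scaleR_right)
  finally show ?thesis by (simp add: euclidean_representation)
qed

lemma sphere_grad_eq: "x \<in> W \<Longrightarrow> sphere_grad v x = grad x"
proof -
  assume x: "x \<in> W"
  have "blinfun_apply (g' x) = (\<lambda>h. h \<bullet> grad x)" by (simp add: inner_grad)
  hence G: "GDERIV (\<lambda>x. v (sgn x)) x :> grad x"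
    unfolding gderiv_def using deriv1[OF x] by simp
  show ?thesis unfolding sphere_grad_def
  proof (rule the_equality)
    show "GDERIV (\<lambda>x. v (sgn x)) x :> grad x" by (rule G)
  qed (rule GDERIV_unique[OF _ G])
qed

lemma has_derivative_grad_sgn:
  assumes \<theta>: "norm \<theta> = 1" "\<theta> \<in> W"
  shows "((\<lambda>x. sphere_grad v (sgn x)) has_derivative
    (\<lambda>h. \<Sum>b\<in>Basis. g'' \<theta> (h - (\<theta> \<bullet> h) *\<^sub>R \<theta>) b *\<^sub>R b)) (at \<theta>)"
proof -
  have s: "sgn \<theta> = \<theta>" using \<theta> by (simp add: sgn_unit)
  have "(g' has_derivative g'' \<theta>) (at (sgn \<theta>))" using deriv2[OF \<theta>(2)] by (simp add: s)
  from has_derivative_compose[OF has_derivative_sgn_unit[OF \<theta>(1)] this]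
  have 1: "((\<lambda>x. g' (sgn x)) has_derivative (\<lambda>h. g'' \<theta> (h - (\<theta> \<bullet> h) *\<^sub>R \<theta>))) (at \<theta>)" .
  have 2: "((\<lambda>x. blinfun_apply (g' (sgn x)) b) has_derivative (\<lambda>h. g'' \<theta> (h - (\<theta> \<bullet> h) *\<^sub>R \<theta>) b)) (at \<theta>)" for b
    using blinfun.FDERIV[OF 1 has_derivative_const[of b]] by (simp add: blinfun.zero_right)
  have "((\<lambda>x. grad (sgn x)) has_derivative
    (\<lambda>h. \<Sum>b\<in>Basis. g'' \<theta> (h - (\<theta> \<bullet> h) *\<^sub>R \<theta>) b *\<^sub>R b)) (at \<theta>)"
    unfolding grad_def by (intro has_derivative_sum has_derivative_scaleR_left 2)
  thus ?thesis
    by (rule has_derivative_transform_within_open[OF _ open_W \<theta>(2)]) (simp add: sphere_grad_eq sgn_W)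
qed

text \<open>
  The derivative of \<open>sgn\<close> at \<open>\<theta>\<close> is the orthogonal projection to the tangent plane, so the divergence of the
  gradient is the trace of the Hessian of the extension over that plane, in any orthonormal basis.
\<close>

lemma sphere_laplacian_frame:
  assumes \<theta>: "norm \<theta> = 1" "\<theta> \<in> W"
    and frame: "\<And>x. x = (\<theta> \<bullet> x) *\<^sub>R \<theta> + (e \<bullet> x) *\<^sub>R e + (w \<bullet> x) *\<^sub>R w"
  shows "sphere_laplacian v \<theta> = g'' \<theta> e e + g'' \<theta> w w"
proof -
  have "frechet_derivative (\<lambda>x. sphere_grad v (sgn x)) (at \<theta>) =
      (\<lambda>h. \<Sum>b\<in>Basis. g'' \<theta> (h - (\<theta> \<bullet> h) *\<^sub>R \<theta>) b *\<^sub>R b)"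
    using has_derivative_grad_sgn[OF \<theta>] by (rule frechet_derivative_at[symmetric])
  hence "sphere_laplacian v \<theta> =
      (\<Sum>c\<in>Basis. (\<Sum>b\<in>Basis. g'' \<theta> (c - (\<theta> \<bullet> c) *\<^sub>R \<theta>) b *\<^sub>R b) \<bullet> c)"
    by (simp add: sphere_laplacian_def sphere_div_def)
  also have "\<dots> = (\<Sum>c\<in>Basis. g'' \<theta> (c - (\<theta> \<bullet> c) *\<^sub>R \<theta>) c)"
    by (intro sum.cong refl) (simp add: inner_sum_left inner_Basis if_distrib sum.delta cong: if_cong)
  also have "\<dots> = (\<Sum>c\<in>Basis. (e \<bullet> c) * g'' \<theta> e c + (w \<bullet> c) * g'' \<theta> w c)"
  proof (intro sum.cong refl)
    fix c :: "real^3"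
    have "c - (\<theta> \<bullet> c) *\<^sub>R \<theta> = (e \<bullet> c) *\<^sub>R e + (w \<bullet> c) *\<^sub>R w"
      using frame[of c] by (metis add.assoc add_diff_cancel_left')
    thus "g'' \<theta> (c - (\<theta> \<bullet> c) *\<^sub>R \<theta>) c = (e \<bullet> c) * g'' \<theta> e c + (w \<bullet> c) * g'' \<theta> w c"
      by (simp add: blinfun.add_right blinfun.add_left blinfun.scaleR_right blinfun.scaleR_left)
  qed
  also have "\<dots> = g'' \<theta> e (\<Sum>c\<in>Basis. (e \<bullet> c) *\<^sub>R c) + g'' \<theta> w (\<Sum>c\<in>Basis. (w \<bullet> c) *\<^sub>R c)"
    by (simp add: sum.distrib blinfun.sum_right blinfun.scaleR_right)
  finally show ?thesis by (simp add: euclidean_representation)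
qed

lemma deriv_radial:
  assumes "norm \<theta> = 1" "\<theta> \<in> W"
  shows "g' \<theta> \<theta> = 0"
proof -
  have "((\<lambda>t::real. t *\<^sub>R \<theta>) has_derivative (\<lambda>h. h *\<^sub>R \<theta>)) (at 1)"
    by (auto intro!: derivative_eq_intros)
  from has_derivative_compose[OF this, of "\<lambda>x. v (sgn x)" "g' \<theta>"] deriv1[OF assms(2)]
  have 1: "((\<lambda>t. v (sgn (t *\<^sub>R \<theta>))) has_derivative (\<lambda>h. g' \<theta> (h *\<^sub>R \<theta>))) (at 1)" by simp
  have "((\<lambda>t::real. v (sgn \<theta>)) has_derivative (\<lambda>h. 0)) (at 1)" by simp
  hence "((\<lambda>t. v (sgn (t *\<^sub>R \<theta>))) has_derivative (\<lambda>h. 0)) (at 1)"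
    by (rule has_derivative_transform_within_open[of _ _ _ _ "{0<..}"]) (auto simp: sgn_scaleR)
  from has_derivative_unique[OF 1 this] have "g' \<theta> (1 *\<^sub>R \<theta>) = 0" by (rule fun_cong)
  thus ?thesis by simp
qed

lemma second_derivative_along_curve:
  assumes "\<gamma> t \<in> W"
    and \<gamma>1: "\<And>y. (\<gamma> has_vector_derivative \<gamma>1 y) (at y)"
    and \<gamma>2: "(\<gamma>1 has_vector_derivative \<gamma>2) (at t)"
  shows "has_second_derivative (\<lambda>t. v (sgn (\<gamma> t)))
           (g'' (\<gamma> t) (\<gamma>1 t) (\<gamma>1 t) + g' (\<gamma> t) \<gamma>2) t"
proof (rule has_second_derivativeI[of "\<gamma> -` W" _ "\<lambda>y. g' (\<gamma> y) (\<gamma>1 y)"])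
  have "isCont \<gamma> y" for y using \<gamma>1 has_derivative_continuous unfolding has_vector_derivative_def by blast
  thus "open (\<gamma> -` W)" by (intro continuous_open_vimage open_W) (simp add: continuous_on_eq_continuous_at)
  show "t \<in> \<gamma> -` W" using assms(1) by simp
  show "((\<lambda>t. v (sgn (\<gamma> t))) has_real_derivative g' (\<gamma> y) (\<gamma>1 y)) (at y)" if "y \<in> \<gamma> -` W" for y
  proof -
    have "((\<lambda>t. v (sgn (\<gamma> t))) has_derivative (\<lambda>h. g' (\<gamma> y) (h *\<^sub>R \<gamma>1 y))) (at y)"
      by (rule has_derivative_compose[OF \<gamma>1[of y, unfolded has_vector_derivative_def]])
         (use deriv1 that in auto)
    thus ?thesis by (simp add: has_field_derivative_def blinfun.scaleR_right mult_commute_abs)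
  qed
  have "((\<lambda>y. g' (\<gamma> y)) has_derivative (\<lambda>h. g'' (\<gamma> t) (h *\<^sub>R \<gamma>1 t))) (at t)"
    by (rule has_derivative_compose[OF \<gamma>1[of t, unfolded has_vector_derivative_def] deriv2[OF assms(1)]])
  from blinfun.FDERIV[OF this \<gamma>2[unfolded has_vector_derivative_def]]
  have "((\<lambda>y. g' (\<gamma> y) (\<gamma>1 y)) has_derivative
      (\<lambda>h. g' (\<gamma> t) (h *\<^sub>R \<gamma>2) + g'' (\<gamma> t) (h *\<^sub>R \<gamma>1 t) (\<gamma>1 t))) (at t)" .
  moreover have "(\<lambda>h. g' (\<gamma> t) (h *\<^sub>R \<gamma>2) + g'' (\<gamma> t) (h *\<^sub>R \<gamma>1 t) (\<gamma>1 t)) =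
      (*) (g'' (\<gamma> t) (\<gamma>1 t) (\<gamma>1 t) + g' (\<gamma> t) \<gamma>2)"
    by (auto simp: fun_eq_iff blinfun.scaleR_right blinfun.scaleR_left algebra_simps)
  ultimately show "((\<lambda>y. g' (\<gamma> y) (\<gamma>1 y)) has_real_derivative
      g'' (\<gamma> t) (\<gamma>1 t) (\<gamma>1 t) + g' (\<gamma> t) \<gamma>2) (at t)"
    by (simp add: has_field_derivative_def)
qed

end

locale horizontal_frame =
  fixes c d :: real
  assumes unit: "c\<^sup>2 + d\<^sup>2 = 1"
begin

definition a :: "real^3" where "a = vector [c, d, 0]"
definition b :: "real^3" where "b = vector [- d, c, 0]"

lemma frame_expand: "x = (a \<bullet> x) *\<^sub>R a + (b \<bullet> x) *\<^sub>R b + (north \<bullet> x) *\<^sub>R north"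
proof -
  have "(c * x$1 + d * x$2) * c - (- d * x$1 + c * x$2) * d = x$1 * (c\<^sup>2 + d\<^sup>2)"
    "(c * x$1 + d * x$2) * d + (- d * x$1 + c * x$2) * c = x$2 * (c\<^sup>2 + d\<^sup>2)"
    by (auto simp: power2_eq_square algebra_simps)
  thus ?thesis
    by (simp add: vec_eq_iff forall_3 a_def b_def north_def inner_vec_def sum_3 vector_3 axis_def unit)
qed

lemma frame_orthonormal:
  "a \<bullet> a = 1" "b \<bullet> b = 1" "north \<bullet> north = 1"
  "a \<bullet> b = 0" "b \<bullet> a = 0" "a \<bullet> north = 0" "north \<bullet> a = 0" "b \<bullet> north = 0" "north \<bullet> b = 0"
  using unit
  by (simp_all add: a_def b_def north_def inner_vec_def sum_3 vector_3 axis_def power2_eq_square)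

definition radial :: "real \<Rightarrow> real^3" where
  "radial \<psi> = cos \<psi> *\<^sub>R b + sin \<psi> *\<^sub>R north"
definition parallel_tangent :: "real \<Rightarrow> real^3" where
  "parallel_tangent \<psi> = (- sin \<psi>) *\<^sub>R b + cos \<psi> *\<^sub>R north"

lemma radial_parallel_orthonormal:
  "radial \<psi> \<bullet> radial \<psi> = 1" "parallel_tangent \<psi> \<bullet> parallel_tangent \<psi> = 1" "radial \<psi> \<bullet> parallel_tangent \<psi> = 0" "parallel_tangent \<psi> \<bullet> radial \<psi> = 0"
  "a \<bullet> radial \<psi> = 0" "radial \<psi> \<bullet> a = 0" "a \<bullet> parallel_tangent \<psi> = 0" "parallel_tangent \<psi> \<bullet> a = 0"
  using sin_cos_squared_add[of \<psi>]
  by (simp_all add: radial_def parallel_tangent_def inner_simps frame_orthonormal power2_eq_square algebra_simps)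

lemma radial_parallel_expand: "x = (a \<bullet> x) *\<^sub>R a + (radial \<psi> \<bullet> x) *\<^sub>R radial \<psi> + (parallel_tangent \<psi> \<bullet> x) *\<^sub>R parallel_tangent \<psi>"
proof -
  define p where "p = b \<bullet> x"
  define q where "q = north \<bullet> x"
  have cs: "cos \<psi> * cos \<psi> + sin \<psi> * sin \<psi> = 1" using sin_cos_squared_add2[of \<psi>] by (simp add: power2_eq_square)
  have "(radial \<psi> \<bullet> x) *\<^sub>R radial \<psi> + (parallel_tangent \<psi> \<bullet> x) *\<^sub>R parallel_tangent \<psi> =
      ((cos \<psi> * p + sin \<psi> * q) * cos \<psi> - (- sin \<psi> * p + cos \<psi> * q) * sin \<psi>) *\<^sub>R b +
      ((cos \<psi> * p + sin \<psi> * q) * sin \<psi> + (- sin \<psi> * p + cos \<psi> * q) * cos \<psi>) *\<^sub>R north"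
    by (simp add: radial_def parallel_tangent_def inner_simps p_def q_def algebra_simps)
  also have "(cos \<psi> * p + sin \<psi> * q) * cos \<psi> - (- sin \<psi> * p + cos \<psi> * q) * sin \<psi> = p"
    using cs by algebra
  also have "(cos \<psi> * p + sin \<psi> * q) * sin \<psi> + (- sin \<psi> * p + cos \<psi> * q) * cos \<psi> = q"
    using cs by algebra
  finally show ?thesis using frame_expand[of x] by (simp add: p_def q_def add.assoc)
qed

text \<open>
  Mercator coordinates with axis \<open>a\<close>: both coordinate derivatives have length \<open>1 / cosh s\<close>.
\<close>

definition \<Theta> :: "real \<times> real \<Rightarrow> real^3" where
  "\<Theta> z = tanh (fst z) *\<^sub>R a + (1 / cosh (fst z)) *\<^sub>R radial (snd z)"

text \<open>
  Together with \<open>parallel_tangent\<close> an orthonormal basis of the tangent plane at \<open>\<Theta> z\<close>; the meridians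
  and parallels are those of the axis \<open>a\<close>.
\<close>

definition meridian_tangent :: "real \<times> real \<Rightarrow> real^3" where
  "meridian_tangent z = (1 / cosh (fst z)) *\<^sub>R a - tanh (fst z) *\<^sub>R radial (snd z)"

lemma sech_tanh: "(tanh s)\<^sup>2 + (1 / cosh s)\<^sup>2 = (1::real)"
proof -
  have "(sinh s)\<^sup>2 + 1 = (cosh s)\<^sup>2" using cosh_square_eq[of s] by simp
  hence "((sinh s)\<^sup>2 + 1) / (cosh s)\<^sup>2 = 1" by simp
  thus ?thesis by (simp add: tanh_def power_divide add_divide_distrib)
qed

lemma norm_\<Theta>: "norm (\<Theta> z) = 1"
proof -
  have "\<Theta> z \<bullet> \<Theta> z = (tanh (fst z))\<^sup>2 + (1 / cosh (fst z))\<^sup>2"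
    by (simp add: \<Theta>_def inner_simps frame_orthonormal radial_parallel_orthonormal power2_eq_square)
  thus ?thesis by (simp add: sech_tanh norm_eq_sqrt_inner)
qed

lemma \<Theta>_frame: "x = (\<Theta> z \<bullet> x) *\<^sub>R \<Theta> z + (meridian_tangent z \<bullet> x) *\<^sub>R meridian_tangent z + (parallel_tangent (snd z) \<bullet> x) *\<^sub>R parallel_tangent (snd z)"
proof -
  define T where "T = tanh (fst z)"
  define h where "h = 1 / cosh (fst z)"
  define p where "p = a \<bullet> x"
  define q where "q = radial (snd z) \<bullet> x"
  have Th: "T * T + h * h = 1" using sech_tanh[of "fst z"] by (simp add: T_def h_def power2_eq_square)
  have "(\<Theta> z \<bullet> x) *\<^sub>R \<Theta> z + (meridian_tangent z \<bullet> x) *\<^sub>R meridian_tangent z =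
      ((T * p + h * q) * T + (h * p - T * q) * h) *\<^sub>R a + ((T * p + h * q) * h - (h * p - T * q) * T) *\<^sub>R radial (snd z)"
    unfolding \<Theta>_def meridian_tangent_def T_def[symmetric] h_def[symmetric]
    by (simp add: inner_simps p_def q_def algebra_simps)
  also have "(T * p + h * q) * T + (h * p - T * q) * h = p * (T * T + h * h)" by (simp add: algebra_simps)
  also have "(T * p + h * q) * h - (h * p - T * q) * T = q * (T * T + h * h)" by (simp add: algebra_simps)
  finally show ?thesis using radial_parallel_expand[of x "snd z"] by (simp add: Th p_def q_def)
qed

lemma has_vector_derivative_scaleR_const:
  fixes x :: "'v :: real_normed_vector"
  assumes "(f has_real_derivative D) (at t)"
  shows "((\<lambda>t. f t *\<^sub>R x) has_vector_derivative D *\<^sub>R x) (at t)"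
  using has_vector_derivative_scaleR[OF assms has_vector_derivative_const[of x]] by simp

lemma has_real_derivative_sech: "((\<lambda>s. 1 / cosh s) has_real_derivative - tanh s / cosh s) (at s)"
  by (auto intro!: derivative_eq_intros simp: tanh_def)

lemma has_real_derivative_tanh: "(tanh has_real_derivative (1 / cosh s)\<^sup>2) (at (s::real))"
proof -
  have "1 - (tanh s)\<^sup>2 = (1 / cosh s)\<^sup>2" using sech_tanh[of s] by linarith
  thus ?thesis by (auto intro!: derivative_eq_intros)
qed

lemma \<Theta>_deriv_s:
  "((\<lambda>s. \<Theta> (s, \<psi>)) has_vector_derivative (1 / cosh s) *\<^sub>R meridian_tangent (s, \<psi>)) (at s)"
proof -
  have "((\<lambda>s. \<Theta> (s, \<psi>)) has_vector_derivative (1 / cosh s)\<^sup>2 *\<^sub>R a + (- tanh s / cosh s) *\<^sub>R radial \<psi>) (at s)"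
    unfolding \<Theta>_def fst_conv snd_conv
    by (intro has_vector_derivative_add has_vector_derivative_scaleR_const
        has_real_derivative_tanh has_real_derivative_sech)
  thus ?thesis by (simp add: meridian_tangent_def algebra_simps power2_eq_square)
qed

lemma \<Theta>_deriv_ss:
  "((\<lambda>s. (1 / cosh s) *\<^sub>R meridian_tangent (s, \<psi>)) has_vector_derivative
     (- 2 * (1 / cosh s)\<^sup>2 * tanh s) *\<^sub>R a + ((1 / cosh s) * (tanh s)\<^sup>2 - (1 / cosh s) ^ 3) *\<^sub>R radial \<psi>) (at s)"
proof -
  have eq: "(\<lambda>s. (1 / cosh s) *\<^sub>R meridian_tangent (s, \<psi>)) = (\<lambda>s. (1 / cosh s)\<^sup>2 *\<^sub>R a + (- (1 / cosh s * tanh s)) *\<^sub>R radial \<psi>)"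
    by (auto simp: meridian_tangent_def algebra_simps power2_eq_square)
  have 1: "((\<lambda>s. (1 / cosh s)\<^sup>2) has_real_derivative - 2 * (1 / cosh s)\<^sup>2 * tanh s) (at s)"
    using DERIV_power[OF has_real_derivative_sech[of s], of 2] by (simp add: power2_eq_square)
  have "((\<lambda>s. 1 / cosh s * tanh s) has_real_derivative - tanh s / cosh s * tanh s + (1 / cosh s)\<^sup>2 * (1 / cosh s)) (at s)"
    by (rule DERIV_mult[OF has_real_derivative_sech has_real_derivative_tanh])
  from DERIV_minus[OF this]
  have 2: "((\<lambda>s. - (1 / cosh s * tanh s)) has_real_derivative (1 / cosh s) * (tanh s)\<^sup>2 - (1 / cosh s) ^ 3) (at s)"
    by (simp add: power2_eq_square power3_eq_cube)
  show ?thesis unfolding eq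
    by (intro has_vector_derivative_add has_vector_derivative_scaleR_const 1 2)
qed

lemma \<Theta>_deriv_\<psi>:
  "((\<lambda>\<psi>. \<Theta> (s, \<psi>)) has_vector_derivative (1 / cosh s) *\<^sub>R parallel_tangent \<psi>) (at \<psi>)"
  unfolding \<Theta>_def radial_def parallel_tangent_def fst_conv snd_conv
  by (auto intro!: derivative_eq_intros simp: has_vector_derivative_def algebra_simps)

lemma \<Theta>_deriv_\<psi>\<psi>:
  "((\<lambda>\<psi>. (1 / cosh s) *\<^sub>R parallel_tangent \<psi>) has_vector_derivative (- (1 / cosh s)) *\<^sub>R radial \<psi>) (at \<psi>)"
  unfolding radial_def parallel_tangent_def
  by (auto intro!: derivative_eq_intros simp: has_vector_derivative_def algebra_simps)

text \<open>
  The chain rule yields the Hessian on the two tangent vectors, scaled by the conformal factor, and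
  the first derivative in the direction of the Laplacian of \<open>\<Theta>\<close>. The latter is radial, as the coordinate
  functions are eigenfunctions of the spherical Laplacian, and radial derivatives
  of the extension vanish.
\<close>

lemma has_laplacian_sphere:
  assumes "ray_extension v W g' g''" and "\<Theta> z \<in> W"
  shows "has_laplacian (\<lambda>z. v (\<Theta> z)) ((1 / cosh (fst z))\<^sup>2 * sphere_laplacian v (\<Theta> z)) z"
proof -
  interpret ray_extension v W g' g'' by fact
  obtain s \<psi> where z: "z = (s, \<psi>)" by (cases z)
  have W: "\<Theta> (s, \<psi>) \<in> W" using assms z by simp
  define h where "h = 1 / cosh s"
  have sg: "sgn (\<Theta> y) = \<Theta> y" for y by (rule sgn_unit[OF norm_\<Theta>])
  let ?e = "meridian_tangent (s, \<psi>)" and ?w = "parallel_tangent \<psi>" and ?x = "\<Theta> (s, \<psi>)"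
  have 1: "has_second_derivative (\<lambda>t. v (\<Theta> (t, \<psi>)))
      (g'' ?x (h *\<^sub>R ?e) (h *\<^sub>R ?e) + g' ?x ((- 2 * h\<^sup>2 * tanh s) *\<^sub>R a + (h * (tanh s)\<^sup>2 - h ^ 3) *\<^sub>R radial \<psi>)) s"
    using second_derivative_along_curve[OF W \<Theta>_deriv_s \<Theta>_deriv_ss] unfolding sg h_def .
  have 2: "has_second_derivative (\<lambda>t. v (\<Theta> (s, t))) (g'' ?x (h *\<^sub>R ?w) (h *\<^sub>R ?w) + g' ?x ((- h) *\<^sub>R radial \<psi>)) \<psi>"
    using second_derivative_along_curve[of "\<lambda>\<psi>. \<Theta> (s, \<psi>)", OF W \<Theta>_deriv_\<psi> \<Theta>_deriv_\<psi>\<psi>] unfolding sg h_def .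
  \<comment> \<open>the coordinate functions are eigenfunctions\<close>
  have T2: "(tanh s)\<^sup>2 = 1 - h\<^sup>2" using sech_tanh[of s] by (simp add: h_def)
  let ?ss = "(- 2 * h\<^sup>2 * tanh s) *\<^sub>R a + (h * (tanh s)\<^sup>2 - h ^ 3) *\<^sub>R radial \<psi>"
  have eig: "?ss + (- h) *\<^sub>R radial \<psi> = (- 2 * h\<^sup>2) *\<^sub>R ?x"
    unfolding T2 by (simp add: \<Theta>_def h_def[symmetric] algebra_simps power2_eq_square power3_eq_cube)
  have "g' ?x ?ss + g' ?x ((- h) *\<^sub>R radial \<psi>) = g' ?x (?ss + (- h) *\<^sub>R radial \<psi>)"
    by (rule blinfun.add_right[symmetric])
  also have "\<dots> = 0"
    unfolding eig blinfun.scaleR_right deriv_radial[OF norm_\<Theta> W] by simp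
  finally have "g' ?x ?ss + g' ?x ((- h) *\<^sub>R radial \<psi>) = 0" .
  moreover have "sphere_laplacian v ?x = g'' ?x ?e ?e + g'' ?x ?w ?w"
    by (rule sphere_laplacian_frame[OF norm_\<Theta> W]) (use \<Theta>_frame[of _ "(s, \<psi>)"] in simp)
  ultimately show ?thesis unfolding z
    by (intro has_laplacianI[OF 1 2]) (simp add: h_def[symmetric] blinfun.scaleR_right blinfun.scaleR_left power2_eq_square algebra_simps)
qed

end

section \<open>Axially symmetric functions on the sphere and behaviour at the poles\<close>

lemma sphere_components: "norm \<theta> = 1 \<Longrightarrow> (\<theta>$1)\<^sup>2 + (\<theta>$2)\<^sup>2 + (\<theta>$3)\<^sup>2 = 1" for \<theta> :: "real^3"
  by (simp add: norm_eq_sqrt_inner inner_vec_def sum_3 power2_eq_square)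

lemma norm_components: "(x$1)\<^sup>2 + (x$2)\<^sup>2 + (x$3)\<^sup>2 = 1 \<Longrightarrow> norm x = 1" for x :: "real^3"
  by (simp add: norm_eq_sqrt_inner inner_vec_def sum_3 power2_eq_square)

lemma punctured_S2_iff: "\<theta> \<in> punctured_S2 \<longleftrightarrow> norm \<theta> = 1 \<and> (\<theta>$3)\<^sup>2 < 1"
proof (cases "norm \<theta> = 1")
  case True
  note c = sphere_components[OF True]
  have "\<theta> = north \<or> \<theta> = south \<longleftrightarrow> (\<theta>$3)\<^sup>2 = 1"
  proof
    assume "(\<theta>$3)\<^sup>2 = 1"
    hence "(\<theta>$1)\<^sup>2 + (\<theta>$2)\<^sup>2 = 0" "\<theta>$3 = 1 \<or> \<theta>$3 = -1" using c by (auto simp: power2_eq_1_iff)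
    thus "\<theta> = north \<or> \<theta> = south"
      by (auto simp: vec_eq_iff forall_3 north_def south_def axis_def sum_power2_eq_zero_iff)
  qed (auto simp: north_def south_def axis_def)
  moreover have "(\<theta>$3)\<^sup>2 \<le> 1" using c zero_le_power2[of "\<theta>$1"] zero_le_power2[of "\<theta>$2"] by linarith
  ultimately show ?thesis using True by auto
qed simp

definition meridian :: "real \<Rightarrow> real^3" where
  "meridian z = vector [sqrt (1 - z\<^sup>2), 0, z]"

lemma meridian_3 [simp]: "meridian z $ 3 = z" by (simp add: meridian_def)

lemma meridian_punctured: "z\<^sup>2 < 1 \<Longrightarrow> meridian z \<in> punctured_S2"
  unfolding punctured_S2_iff by (auto intro!: norm_components simp: meridian_def)

lemma rotate_to_meridian:
  assumes "norm \<theta> = 1"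
  shows "\<exists>Q::real^3^3. rotation_matrix Q \<and> Q *v north = north \<and> Q *v \<theta> = meridian (\<theta>$3)"
proof -
  define r where "r = sqrt (1 - (\<theta>$3)\<^sup>2)"
  have c: "(\<theta>$1)\<^sup>2 + (\<theta>$2)\<^sup>2 = 1 - (\<theta>$3)\<^sup>2" using sphere_components[OF assms] by linarith
  have r2: "r\<^sup>2 = (\<theta>$1)\<^sup>2 + (\<theta>$2)\<^sup>2"
    unfolding r_def by (metis c real_sqrt_pow2 sum_power2_ge_zero)
  have "\<exists>p q. p\<^sup>2 + q\<^sup>2 = 1 \<and> \<theta>$1 = r * p \<and> \<theta>$2 = r * q"
  proof (cases "r = 0")
    case True
    hence "\<theta>$1 = 0" "\<theta>$2 = 0" using r2 by (auto simp: sum_power2_eq_zero_iff)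
    thus ?thesis using True by (intro exI[of _ 1] exI[of _ 0]) simp
  next
    case False
    hence "(\<theta>$1 / r)\<^sup>2 + (\<theta>$2 / r)\<^sup>2 = 1" by (simp add: power_divide r2[symmetric] add_divide_distrib[symmetric])
    thus ?thesis using False by (intro exI[of _ "\<theta>$1 / r"] exI[of _ "\<theta>$2 / r"]) simp
  qed
  then obtain p q where pq: "p\<^sup>2 + q\<^sup>2 = 1" "\<theta>$1 = r * p" "\<theta>$2 = r * q" by blast
  have pq': "p * p + q * q = 1" using pq(1) by (simp add: power2_eq_square)
  define Q :: "real^3^3" where "Q = vector [vector [p, q, 0], vector [- q, p, 0], vector [0, 0, 1]]"
  have row: "Q$1$1 = p" "Q$1$2 = q" "Q$1$3 = 0" "Q$2$1 = - q" "Q$2$2 = p" "Q$2$3 = 0"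
     "Q$3$1 = 0" "Q$3$2 = 0" "Q$3$3 = 1" by (simp_all add: Q_def)
  have "orthogonal_matrix Q"
    unfolding orthogonal_matrix matrix_matrix_mult_def transpose_def mat_def
    using pq' by (simp add: vec_eq_iff forall_3 sum_3 row add.commute)
  moreover have "det Q = 1" using pq' by (simp add: det_3 row)
  moreover have "Q *v north = north"
    by (simp add: vec_eq_iff forall_3 matrix_vector_mult_def sum_3 row north_def axis_def)
  moreover have "Q *v \<theta> = meridian (\<theta>$3)"
  proof -
    have "p * (r * p) + q * (r * q) = r" using pq' by algebra
    thus ?thesis
      by (simp add: vec_eq_iff forall_3 matrix_vector_mult_def sum_3 row pq(2,3) meridian_def r_def[symmetric])
  qed
  ultimately show ?thesis unfolding rotation_matrix_def by blast
qed

lemma axial_meridian: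
  assumes "rotationally_symmetric g" "\<theta> \<in> punctured_S2"
  shows "g \<theta> = g (meridian (\<theta>$3))"
proof -
  have "norm \<theta> = 1" using assms(2) by (simp add: punctured_S2_iff)
  from rotate_to_meridian[OF this] assms show ?thesis unfolding rotationally_symmetric_def by metis
qed

lemma axial_eq:
  assumes "rotationally_symmetric g" "\<theta> \<in> punctured_S2" "\<theta>' \<in> punctured_S2" "\<theta>$3 = \<theta>'$3"
  shows "g \<theta> = g \<theta>'"
  using axial_meridian[OF assms(1,2)] axial_meridian[OF assms(1,3)] assms(4) by simp

lemma meridian_great_circle:
  defines "C \<equiv> S2 \<inter> {x::real^3. axis 2 1 \<bullet> x = 0}"
  shows "great_circle C" "north \<in> C" "south \<in> C" "z\<^sup>2 < 1 \<Longrightarrow> meridian z \<in> C - {north, south}"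
proof -
  have "dim {x::real^3. axis 2 1 \<bullet> x = 0} = 2"
  proof -
    have "(axis 2 1 :: real^3) \<in> Basis" by (auto simp: Basis_vec_def)
    from dim_special_hyperplane[OF this] show ?thesis by simp
  qed
  moreover have "subspace {x::real^3. axis 2 1 \<bullet> x = 0}" by (rule subspace_hyperplane)
  ultimately show "great_circle C" unfolding great_circle_def C_def by blast
  show "north \<in> C" "south \<in> C"
    by (auto simp: C_def north_def south_def inner_axis_axis)
  assume "z\<^sup>2 < 1"
  from meridian_punctured[OF this] show "meridian z \<in> C - {north, south}"
    by (auto simp: C_def inner_axis' meridian_def)
qed

text \<open>
  Axial symmetry moves both points to one great circle through the poles, where monotonicity is assumed.
\<close>

lemma axial_mono:
  assumes sym: "rotationally_symmetric g" and mono: "increasing_to_poles g"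
    and \<theta>: "\<theta> \<in> punctured_S2" "\<theta>' \<in> punctured_S2"
    and le: "0 \<le> \<theta>$3 * \<theta>'$3" "\<bar>\<theta>$3\<bar> \<le> \<bar>\<theta>'$3\<bar>"
  shows "g \<theta> \<le> g \<theta>'"
proof (cases "\<theta>$3 = \<theta>'$3")
  case True
  thus ?thesis using axial_eq[OF sym \<theta>] by simp
next
  case False
  let ?z = "\<theta>$3" and ?z' = "\<theta>'$3"
  have z: "?z\<^sup>2 < 1" "?z'\<^sup>2 < 1" using \<theta> unfolding punctured_S2_iff by blast+
  have cases: "(?z' > ?z \<and> ?z \<ge> 0) \<or> (?z' < ?z \<and> ?z \<le> 0)"
    using False le by (auto simp: zero_le_mult_iff abs_if split: if_splits)
  have "g (meridian ?z) \<le> g (meridian ?z')"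
    using mono meridian_great_circle(1-3) meridian_great_circle(4)[OF z(1)] meridian_great_circle(4)[OF z(2)] cases
    unfolding increasing_to_poles_def by (metis meridian_3)
  thus ?thesis using axial_meridian[OF sym \<theta>(1)] axial_meridian[OF sym \<theta>(2)] by simp
qed

text \<open>
  The logarithm of the distance is negative near \<open>p\<close>, so an upper bound on the quotient is a lower bound on
  \<open>v\<close>. The distance is bounded below by its sine, \<open>sqrt (1 - (\<theta> \<bullet> p)\<^sup>2)\<close>, which is algebraic in the height.
\<close>

lemma growth_at_pole:
  fixes p :: "real^3"
  assumes p: "norm p = 1" and \<epsilon>: "\<epsilon> > 0"
    and limsup: "Limsup (at p within A) (\<lambda>\<theta>. ereal (v \<theta> / ln (geodesic_dist \<theta> p))) \<le> 0"
  shows "\<exists>\<rho>>0. \<forall>\<theta>\<in>A. norm \<theta> = 1 \<and> \<theta> \<bullet> p > 0 \<and> 0 < 1 - (\<theta> \<bullet> p)\<^sup>2 \<and> 1 - (\<theta> \<bullet> p)\<^sup>2 < \<rho> \<longrightarrow>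
           v \<theta> \<ge> \<epsilon> / 2 * ln (1 - (\<theta> \<bullet> p)\<^sup>2)"
proof -
  have "\<forall>\<^sub>F \<theta> in at p within A. ereal (v \<theta> / ln (geodesic_dist \<theta> p)) < ereal \<epsilon>"
    using limsup \<epsilon> unfolding Limsup_le_iff by (metis ereal_less(2))
  then obtain \<delta> where \<delta>: "\<delta> > 0" "\<And>\<theta>. \<theta> \<in> A \<Longrightarrow> \<theta> \<noteq> p \<Longrightarrow> dist \<theta> p < \<delta> \<Longrightarrow> v \<theta> / ln (geodesic_dist \<theta> p) < \<epsilon>"
    unfolding eventually_at by auto
  have cos1: "cos (1::real) < 1" using cos_one_2pi[of 1] cos_le_one[of "1::real"] pi_gt3
    by (metis cos_monotone_0_pi cos_zero order.refl order.strict_trans2 less_imp_le zero_less_one one_less_numeral_iff semiring_norm(77))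
  (* the second bound makes the distance to p less than 1, so that its logarithm is negative *)
  define \<rho> where "\<rho> = min (\<delta>\<^sup>2 / 2) (1 - cos 1)"
  have "\<rho> > 0" using \<delta>(1) cos1 by (simp add: \<rho>_def)
  moreover have "v \<theta> \<ge> \<epsilon> / 2 * ln (1 - (\<theta> \<bullet> p)\<^sup>2)"
    if \<theta>: "\<theta> \<in> A" "norm \<theta> = 1" "\<theta> \<bullet> p > 0" "0 < 1 - (\<theta> \<bullet> p)\<^sup>2" "1 - (\<theta> \<bullet> p)\<^sup>2 < \<rho>" for \<theta>
  proof -
    define y where "y = \<theta> \<bullet> p"
    have y: "0 < y" "y < 1" using \<theta> by (auto simp: y_def power_less_one_iff abs_square_less_1)
    have "1 - y\<^sup>2 = (1 - y) * (1 + y)" by (simp add: power2_eq_square algebra_simps)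
    moreover have "(1 - y) * 1 \<le> (1 - y) * (1 + y)" using y by (intro mult_left_mono) auto
    ultimately have small: "1 - y < \<rho>" using \<theta>(5) by (simp add: y_def)
    have "(dist \<theta> p)\<^sup>2 = 2 - 2 * y"
      using p \<theta>(2) by (simp add: dist_norm power2_norm_eq_inner inner_simps y_def inner_commute norm_eq_1)
    also have "\<dots> < \<delta>\<^sup>2" using small by (auto simp: \<rho>_def)
    finally have near: "dist \<theta> p < \<delta>" using \<delta>(1) by (simp add: power_less_imp_less_base)
    have np: "\<theta> \<noteq> p" using y p by (auto simp: y_def norm_eq_1)
    define D where "D = geodesic_dist \<theta> p"
    have D: "D = arccos y" by (simp add: D_def geodesic_dist_def y_def)
    have sinD: "sin D = sqrt (1 - y\<^sup>2)" unfolding D using y by (intro sin_arccos) auto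
    have pos: "sqrt (1 - y\<^sup>2) > 0" using \<theta>(4) by (simp add: y_def)
    have "D \<ge> 0" unfolding D using y by (intro arccos_lbound) auto
    hence le: "sqrt (1 - y\<^sup>2) \<le> D" using sin_x_le_x[of D] sinD by simp
    have "cos 1 < y" using small by (simp add: \<rho>_def)
    hence "arccos y < arccos (cos 1)" using y by (intro arccos_less_arccos) auto
    also have "arccos (cos 1) = (1::real)" using pi_gt3 by (intro arccos_cos) auto
    finally have D1: "D < 1" by (simp add: D)
    have lnD: "ln D < 0" by (rule ln_less_zero[OF less_le_trans[OF pos le] D1])
    have "v \<theta> / ln D < \<epsilon>" using \<delta>(2)[OF \<theta>(1) np near] by (simp add: D_def)
    hence "\<epsilon> * ln D < v \<theta>" using lnD by (simp add: neg_divide_less_eq)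
    moreover have "\<epsilon> * ln (sqrt (1 - y\<^sup>2)) \<le> \<epsilon> * ln D"
      using \<epsilon> by (intro mult_left_mono ln_mono le pos) simp
    moreover have "\<epsilon> / 2 * ln (1 - y\<^sup>2) = \<epsilon> * ln (sqrt (1 - y\<^sup>2))" using pos by (simp add: ln_sqrt)
    ultimately have "\<epsilon> / 2 * ln (1 - y\<^sup>2) \<le> v \<theta>" by (simp only: less_imp_le order_trans)
    thus ?thesis by (simp only: y_def)
  qed
  ultimately show ?thesis by blast
qed

lemma lipschitz_from_deriv:
  fixes \<phi> :: "real \<Rightarrow> real"
  assumes "\<And>t. (\<phi> has_real_derivative \<phi>' t) (at t)" "\<And>t. \<bar>\<phi>' t\<bar> \<le> 1"
  shows "\<bar>\<phi> s - \<phi> s'\<bar> \<le> \<bar>s - s'\<bar>"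
proof -
  have "norm (\<phi> s - \<phi> s') \<le> 1 * norm (s - s')"
    by (rule field_differentiable_bound[of UNIV \<phi> \<phi>' 1])
       (use assms in \<open>auto intro: has_field_derivative_at_within\<close>)
  thus ?thesis by simp
qed

context horizontal_frame
begin

lemma frame_3: "a $ 3 = 0" "b $ 3 = 0" "north $ 3 = 1"
  by (simp_all add: a_def b_def north_def axis_def)

lemma \<Theta>_3: "\<Theta> z $ 3 = sin (snd z) / cosh (fst z)"
  by (simp add: \<Theta>_def radial_def frame_3)

lemma pole_gap_\<Theta>: "1 - (\<Theta> z $ 3)\<^sup>2 = pole_gap 0 z / (cosh (fst z))\<^sup>2"
proof -
  have "(cosh (fst z))\<^sup>2 - (sin (snd z))\<^sup>2 = pole_gap 0 z"
    by (simp add: pole_gap_def cosh_square_eq sin_squared_eq)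
  moreover have "(cosh (fst z))\<^sup>2 \<noteq> 0" by simp
  ultimately show ?thesis unfolding \<Theta>_3 power_divide by (metis diff_divide_distrib divide_self)
qed

lemma \<Theta>_punctured_iff: "\<Theta> z \<in> punctured_S2 \<longleftrightarrow> pole_gap 0 z > 0"
proof -
  have "(\<Theta> z $ 3)\<^sup>2 < 1 \<longleftrightarrow> pole_gap 0 z / (cosh (fst z))\<^sup>2 > 0"
    using pole_gap_\<Theta>[of z] by auto
  also have "\<dots> \<longleftrightarrow> pole_gap 0 z > 0" by (simp add: zero_less_divide_iff)
  finally show ?thesis unfolding punctured_S2_iff by (simp only: norm_\<Theta> simp_thms)
qed

lemma continuous_on_\<Theta>: "continuous_on A \<Theta>"
  unfolding \<Theta>_def radial_def by (intro continuous_intros) auto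

text \<open>
  The closed region around the equator that contains all points with \<open>\<bar>s\<bar> \<ge> r\<close>, for every choice of the axis.
\<close>

definition belt :: "real \<Rightarrow> (real^3) set" where
  "belt r = {\<theta>. norm \<theta> = 1 \<and> \<bar>\<theta>$3\<bar> \<le> 1 / cosh r}"

lemma compact_belt: "compact (belt r)"
proof -
  have "belt r = sphere 0 1 \<inter> {\<theta>. \<bar>\<theta>$3\<bar> \<le> 1 / cosh r}" by (auto simp: belt_def)
  moreover have "closed {\<theta>::real^3. \<bar>\<theta>$3\<bar> \<le> 1 / cosh r}" by (intro closed_Collect_le continuous_intros)
  ultimately show ?thesis by (metis compact_Int_closed compact_sphere)
qed

lemma belt_punctured: "r > 0 \<Longrightarrow> belt r \<subseteq> punctured_S2"
proof
  fix \<theta> assume r: "r > 0" and \<theta>: "\<theta> \<in> belt r"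
  have "cosh r > 1" using r cosh_real_nonneg_less_iff[of 0 r] by simp
  hence "\<bar>\<theta>$3\<bar> < 1" using \<theta> by (auto simp: belt_def intro: le_less_trans)
  thus "\<theta> \<in> punctured_S2" using \<theta> unfolding punctured_S2_iff belt_def by (simp add: abs_square_less_1)
qed

lemma \<Theta>_belt: "r \<ge> 0 \<Longrightarrow> r \<le> \<bar>fst z\<bar> \<Longrightarrow> \<Theta> z \<in> belt r"
proof -
  assume r: "r \<ge> 0" "r \<le> \<bar>fst z\<bar>"
  have "cosh r \<le> cosh \<bar>fst z\<bar>" using r by (subst cosh_real_nonneg_le_iff) auto
  hence le: "cosh r \<le> cosh (fst z)" by simp
  have "\<bar>\<Theta> z $ 3\<bar> = \<bar>sin (snd z)\<bar> / cosh (fst z)" by (simp add: \<Theta>_3 abs_divide)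
  also have "\<dots> \<le> 1 / cosh r" using le by (intro frac_le) auto
  finally show ?thesis by (simp add: belt_def norm_\<Theta>)
qed

lemma \<Theta>_lipschitz: "dist (\<Theta> (s', \<psi>)) (\<Theta> (s, \<psi>)) \<le> 2 * \<bar>s' - s\<bar>"
proof -
  have sech1: "1 / cosh t \<le> 1" "1 / cosh t > 0" for t :: real using cosh_real_ge_1[of t] by auto
  have tanh1: "\<bar>tanh t\<bar> \<le> 1" for t :: real using tanh_real_bounds[of t] by auto
  have 1: "\<bar>tanh s' - tanh s\<bar> \<le> \<bar>s' - s\<bar>"
    by (rule lipschitz_from_deriv[OF has_real_derivative_tanh]) (use sech1 in \<open>simp add: power_le_one\<close>)
  have "\<bar>- tanh t / cosh t\<bar> \<le> 1" for t :: real
    using mult_mono[OF tanh1[of t] sech1(1)[of t]] by (simp add: abs_divide)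
  hence 2: "\<bar>1 / cosh s' - 1 / cosh s\<bar> \<le> \<bar>s' - s\<bar>"
    by (rule lipschitz_from_deriv[OF has_real_derivative_sech])
  have n: "norm a = 1" "norm (radial \<psi>) = 1"
    by (simp_all add: norm_eq_sqrt_inner frame_orthonormal radial_parallel_orthonormal)
  have "\<Theta> (s', \<psi>) - \<Theta> (s, \<psi>) = (tanh s' - tanh s) *\<^sub>R a + (1 / cosh s' - 1 / cosh s) *\<^sub>R radial \<psi>"
    by (simp add: \<Theta>_def algebra_simps)
  hence "dist (\<Theta> (s', \<psi>)) (\<Theta> (s, \<psi>)) \<le> \<bar>tanh s' - tanh s\<bar> + \<bar>1 / cosh s' - 1 / cosh s\<bar>"
    unfolding dist_norm using norm_triangle_ineq[of "(tanh s' - tanh s) *\<^sub>R a" "(1 / cosh s' - 1 / cosh s) *\<^sub>R radial \<psi>"]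
    by (simp add: n)
  also have "\<dots> \<le> \<bar>s' - s\<bar> + \<bar>s' - s\<bar>" by (rule add_mono[OF 1 2])
  finally show ?thesis by (simp only: mult_2)
qed

end

lemma abs_ln_cosh_le: "\<bar>ln (cosh s) - \<bar>s\<bar>\<bar> \<le> ln 2" for s :: real
proof -
  have "exp \<bar>s\<bar> / 2 \<le> cosh \<bar>s\<bar>" "cosh \<bar>s\<bar> \<le> exp \<bar>s\<bar>"
    by (simp_all add: cosh_def)
  hence "ln (exp \<bar>s\<bar> / 2) \<le> ln (cosh s)" "ln (cosh s) \<le> ln (exp \<bar>s\<bar>)"
    by (subst ln_le_cancel_iff; simp add: cosh_real_pos)+
  thus ?thesis by (simp add: ln_div abs_le_iff)
qed

lemma ln_cosh_deriv: "((\<lambda>s. ln (cosh s)) has_real_derivative tanh s) (at (s::real))"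
  by (auto intro!: derivative_eq_intros simp: tanh_def cosh_real_pos divide_simps)

section \<open>From the sphere to the cylinder and back\<close>

text \<open>
  The hypotheses of the theorem, fixed in order to work with varying horizontal frames.
\<close>

locale mean_field_solution =
  fixes K f v :: "real^3 \<Rightarrow> real"
  assumes K_cont: "continuous_on punctured_S2 K"
    and K_nonneg: "\<forall>\<theta>\<in>punctured_S2. K \<theta> \<ge> 0"
    and f_nonneg: "\<forall>\<theta>\<in>punctured_S2. f \<theta> \<ge> 0"
    and K_mono: "increasing_to_poles K"
    and f_mono: "increasing_to_poles f"
    and nontrivial: "\<not> ((\<forall>\<theta>\<in>punctured_S2. f \<theta> = 0) \<and> (\<exists>c. \<forall>\<theta>\<in>punctured_S2. K \<theta> = c))"
    and K_sym: "rotationally_symmetric K"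
    and f_sym: "rotationally_symmetric f"
    and v_C2: "sphere_C2_on v punctured_S2"
    and eq: "\<forall>\<theta>\<in>punctured_S2. - sphere_laplacian v \<theta> + 1 = K \<theta> * exp (2 * v \<theta>) + f \<theta>"
    and limsup_north:
      "Limsup (at north within punctured_S2) (\<lambda>\<theta>. ereal (v \<theta> / ln (geodesic_dist \<theta> north))) \<le> 0"
    and limsup_south:
      "Limsup (at south within punctured_S2) (\<lambda>\<theta>. ereal (v \<theta> / ln (geodesic_dist \<theta> south))) \<le> 0"
begin

definition W :: "(real^3) set" where "W = {x. sgn x \<in> punctured_S2}"

lemma punctured_subset_W: "\<theta> \<in> punctured_S2 \<Longrightarrow> \<theta> \<in> W"
  unfolding W_def by (simp add: sgn_unit)

lemma ray_extension_exists: "\<exists>g' g''. ray_extension v W g' g''"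
proof -
  obtain g' g'' where "open W"
      "\<forall>x\<in>W. ((\<lambda>x. v (sgn x)) has_derivative blinfun_apply (g' x)) (at x)"
      "\<forall>x\<in>W. (g' has_derivative blinfun_apply (g'' x)) (at x)"
    using v_C2 unfolding sphere_C2_on_def C2_on_def W_def by blast
  moreover have "sgn x \<in> W" if "x \<in> W" for x
    using that by (intro punctured_subset_W) (simp only: W_def mem_Collect_eq)
  ultimately have "ray_extension v W g' g''" unfolding ray_extension_def by blast
  thus ?thesis by blast
qed

lemma v_cont: "continuous_on punctured_S2 v"
proof -
  obtain g' g'' where "ray_extension v W g' g''" using ray_extension_exists by blast
  then interpret ray_extension v W g' g'' .
  have "continuous_on W (\<lambda>x. v (sgn x))"
    using deriv1 by (intro continuous_at_imp_continuous_on ballI has_derivative_continuous) blast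
  hence "continuous_on punctured_S2 (\<lambda>x. v (sgn x))"
    by (rule continuous_on_subset) (use punctured_subset_W in blast)
  thus ?thesis by (rule continuous_on_eq) (simp add: sgn_unit)
qed

lemma growth_near_poles:
  assumes "\<epsilon> > 0"
  shows "\<exists>\<rho>>0. \<forall>\<theta>\<in>punctured_S2. 1 - (\<theta>$3)\<^sup>2 < \<rho> \<longrightarrow> v \<theta> \<ge> \<epsilon> / 2 * ln (1 - (\<theta>$3)\<^sup>2)"
proof -
  have ns: "norm north = 1" "norm south = 1" by (simp_all add: north_def south_def)
  have ip: "\<theta> \<bullet> north = \<theta>$3" "\<theta> \<bullet> south = - \<theta>$3" for \<theta> :: "real^3"
    by (simp_all add: north_def south_def inner_axis)
  obtain \<rho>1 where \<rho>1: "\<rho>1 > 0" "\<forall>\<theta>\<in>punctured_S2. norm \<theta> = 1 \<and> \<theta>$3 > 0 \<and> 0 < 1 - (\<theta>$3)\<^sup>2 \<and> 1 - (\<theta>$3)\<^sup>2 < \<rho>1 \<longrightarrow>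
      v \<theta> \<ge> \<epsilon> / 2 * ln (1 - (\<theta>$3)\<^sup>2)"
    using growth_at_pole[OF ns(1) assms limsup_north] unfolding ip by blast
  obtain \<rho>2 where \<rho>2: "\<rho>2 > 0" "\<forall>\<theta>\<in>punctured_S2. norm \<theta> = 1 \<and> - \<theta>$3 > 0 \<and> 0 < 1 - (\<theta>$3)\<^sup>2 \<and> 1 - (\<theta>$3)\<^sup>2 < \<rho>2 \<longrightarrow>
      v \<theta> \<ge> \<epsilon> / 2 * ln (1 - (\<theta>$3)\<^sup>2)"
    using growth_at_pole[OF ns(2) assms limsup_south] unfolding ip power2_minus by blast
  have "v \<theta> \<ge> \<epsilon> / 2 * ln (1 - (\<theta>$3)\<^sup>2)" if \<theta>: "\<theta> \<in> punctured_S2" "1 - (\<theta>$3)\<^sup>2 < min 1 (min \<rho>1 \<rho>2)" for \<theta>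
  proof -
    have "norm \<theta> = 1" "0 < 1 - (\<theta>$3)\<^sup>2" using \<theta>(1) unfolding punctured_S2_iff by auto
    moreover have "\<theta>$3 > 0 \<or> - \<theta>$3 > 0" using \<theta>(2) by (cases "\<theta>$3 = 0") auto
    ultimately show ?thesis using \<rho>1(2) \<rho>2(2) \<theta> by auto
  qed
  thus ?thesis using \<rho>1(1) \<rho>2(1) by (intro exI[of _ "min 1 (min \<rho>1 \<rho>2)"]) auto
qed

end

locale mean_field_solution_in_frame = mean_field_solution + horizontal_frame
begin

definition U :: "real \<times> real \<Rightarrow> real" where
  "U z = v (\<Theta> z) - ln (cosh (fst z))"

definition source :: "real \<times> real \<Rightarrow> real" where
  "source z = f (\<Theta> z) * (1 / cosh (fst z))\<^sup>2"

lemma angular_\<Theta>: "cos \<psi> = cos \<psi>' \<Longrightarrow> sin \<psi> = sin \<psi>' \<Longrightarrow> \<Theta> (s, \<psi>) = \<Theta> (s, \<psi>')"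
  by (simp add: \<Theta>_def radial_def)

lemma U_equation:
  assumes p: "pole_gap 0 z > 0"
  shows "has_laplacian U (- (K (\<Theta> z) * exp (2 * U z) + source z)) z"
proof -
  obtain s \<psi> where z: "z = (s, \<psi>)" by (cases z)
  obtain g' g'' where R: "ray_extension v W g' g''" using ray_extension_exists by blast
  define h where "h = 1 / cosh s"
  define L where "L = sphere_laplacian v (\<Theta> z)"
  have \<Theta>: "\<Theta> z \<in> punctured_S2" using p by (simp only: \<Theta>_punctured_iff)
  have 1: "has_laplacian (\<lambda>z. v (\<Theta> z)) (h\<^sup>2 * L) z"
    using has_laplacian_sphere[OF R punctured_subset_W[OF \<Theta>]] by (simp add: h_def L_def z)
  have a: "has_second_derivative (\<lambda>s. ln (cosh s)) (h\<^sup>2) s"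
    unfolding h_def
    by (rule has_second_derivativeI[of UNIV _ tanh]) (auto intro: ln_cosh_deriv has_real_derivative_tanh)
  have b: "has_second_derivative (\<lambda>t. ln (cosh s)) 0 \<psi>"
    by (rule has_second_derivativeI[of UNIV _ "\<lambda>_. 0"]) auto
  have 2: "has_laplacian (\<lambda>z. ln (cosh (fst z))) (h\<^sup>2) z"
    unfolding z by (rule has_laplacianI) (use a b in auto)
  have "exp (2 * U z) = exp (2 * v (\<Theta> z)) * h\<^sup>2"
    by (simp add: U_def z h_def right_diff_distrib exp_diff exp_double power_divide cosh_real_pos)
  moreover have "h\<^sup>2 * (- L + 1) = h\<^sup>2 * (K (\<Theta> z) * exp (2 * v (\<Theta> z)) + f (\<Theta> z))"
    using eq \<Theta> by (simp only: L_def) 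
  ultimately have "h\<^sup>2 * L - h\<^sup>2 = - (K (\<Theta> z) * exp (2 * U z) + source z)"
    by (simp add: source_def z h_def[symmetric] algebra_simps)
  with has_laplacian_diff[OF 1 2] show ?thesis by (simp add: U_def[abs_def])
qed

lemma \<Theta>_height:
  assumes "\<bar>s'\<bar> \<le> \<bar>s\<bar>"
  shows "0 \<le> \<Theta> (s, \<psi>) $ 3 * \<Theta> (s', \<psi>) $ 3" "\<bar>\<Theta> (s, \<psi>) $ 3\<bar> \<le> \<bar>\<Theta> (s', \<psi>) $ 3\<bar>"
proof -
  show "0 \<le> \<Theta> (s, \<psi>) $ 3 * \<Theta> (s', \<psi>) $ 3" by (simp add: \<Theta>_3)
  have "cosh \<bar>s'\<bar> \<le> cosh \<bar>s\<bar>" using assms by (subst cosh_real_nonneg_le_iff) auto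
  thus "\<bar>\<Theta> (s, \<psi>) $ 3\<bar> \<le> \<bar>\<Theta> (s', \<psi>) $ 3\<bar>"
    by (simp add: \<Theta>_3 abs_divide frac_le)
qed

lemma axial_\<Theta>_mono:
  assumes "rotationally_symmetric g" "increasing_to_poles g"
    and "\<bar>s'\<bar> \<le> \<bar>s\<bar>" "pole_gap 0 (s, \<psi>) > 0" "pole_gap 0 (s', \<psi>) > 0"
  shows "g (\<Theta> (s, \<psi>)) \<le> g (\<Theta> (s', \<psi>))"
  by (rule axial_mono[OF assms(1,2) _ _ \<Theta>_height[OF assms(3)]])
     (use assms(4,5) in \<open>simp_all only: \<Theta>_punctured_iff\<close>)

lemma sech_mono: "\<bar>s'\<bar> \<le> \<bar>s\<bar> \<Longrightarrow> (1 / cosh s)\<^sup>2 \<le> (1 / cosh s' :: real)\<^sup>2"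
proof -
  assume "\<bar>s'\<bar> \<le> \<bar>s\<bar>"
  hence "cosh \<bar>s'\<bar> \<le> cosh \<bar>s\<bar>" by (subst cosh_real_nonneg_le_iff) auto
  hence "1 / cosh s \<le> 1 / cosh s'" by (intro frac_le) auto
  thus ?thesis by (intro power_mono) auto
qed

lemma source_mono:
  assumes "\<bar>s'\<bar> \<le> \<bar>s\<bar>" "pole_gap 0 (s, \<psi>) > 0" "pole_gap 0 (s', \<psi>) > 0"
  shows "source (s, \<psi>) \<le> source (s', \<psi>)"
proof -
  have "\<Theta> (s', \<psi>) \<in> punctured_S2" using assms(3) by (simp only: \<Theta>_punctured_iff)
  hence "f (\<Theta> (s', \<psi>)) \<ge> 0" using f_nonneg by blast
  thus ?thesis unfolding source_def fst_conv
    using axial_\<Theta>_mono[OF f_sym f_mono assms] sech_mono[OF assms(1)] by (intro mult_mono) auto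
qed

lemma bounded_on_belt:
  fixes g :: "real^3 \<Rightarrow> real"
  assumes "continuous_on punctured_S2 g" "r > 0"
  shows "\<exists>M. \<forall>z. \<bar>fst z\<bar> \<ge> r \<longrightarrow> \<bar>g (\<Theta> z)\<bar> \<le> M"
proof -
  have "compact (g ` belt r)"
    using continuous_on_subset[OF assms(1) belt_punctured[OF assms(2)]] compact_belt
    by (rule compact_continuous_image)
  then obtain M where M: "\<forall>x\<in>g ` belt r. norm x \<le> M" using compact_imp_bounded bounded_iff by blast
  have "\<bar>g (\<Theta> z)\<bar> \<le> M" if "\<bar>fst z\<bar> \<ge> r" for z
    using M \<Theta>_belt[of r z] that assms(2) by auto
  thus ?thesis by blast
qed

lemma U_asymptotics:
  assumes "r > 0"
  shows "\<exists>C. \<forall>z. \<bar>fst z\<bar> \<ge> r \<longrightarrow> \<bar>U z + \<bar>fst z\<bar>\<bar> \<le> C"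
proof -
  obtain M where M: "\<And>z. \<bar>fst z\<bar> \<ge> r \<Longrightarrow> \<bar>v (\<Theta> z)\<bar> \<le> M" using bounded_on_belt[OF v_cont assms] by blast
  have "\<bar>U z + \<bar>fst z\<bar>\<bar> \<le> M + ln 2" if "\<bar>fst z\<bar> \<ge> r" for z
  proof -
    have "U z + \<bar>fst z\<bar> = v (\<Theta> z) - (ln (cosh (fst z)) - \<bar>fst z\<bar>)" by (simp add: U_def)
    hence "\<bar>U z + \<bar>fst z\<bar>\<bar> \<le> \<bar>v (\<Theta> z)\<bar> + \<bar>ln (cosh (fst z)) - \<bar>fst z\<bar>\<bar>" by (simp only: abs_triangle_ineq4)
    also have "\<dots> \<le> M + ln 2" by (rule add_mono[OF M[OF that] abs_ln_cosh_le])
    finally show ?thesis .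
  qed
  thus ?thesis by blast
qed

lemma U_uniformly_continuous:
  assumes "r > 0" "e > 0"
  shows "\<exists>d>0. \<forall>s s' \<psi>. s \<le> - r \<and> s' \<le> s \<and> s - s' \<le> d \<longrightarrow> \<bar>U (s', \<psi>) - U (s, \<psi>)\<bar> \<le> e"
proof -
  have "uniformly_continuous_on (belt r) v"
    using continuous_on_subset[OF v_cont belt_punctured[OF assms(1)]] compact_belt
    by (rule compact_uniformly_continuous)
  then obtain d0 where d0: "d0 > 0"
      "\<And>x y. x \<in> belt r \<Longrightarrow> y \<in> belt r \<Longrightarrow> dist y x < d0 \<Longrightarrow> dist (v y) (v x) < e / 2"
    using half_gt_zero[OF assms(2)] unfolding uniformly_continuous_on_def by metis
  define d where "d = min (d0 / 3) (e / 2)"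
  have "\<bar>U (s', \<psi>) - U (s, \<psi>)\<bar> \<le> e" if s: "s \<le> - r" "s' \<le> s" "s - s' \<le> d" for s s' \<psi>
  proof -
    have small: "\<bar>s' - s\<bar> \<le> d0 / 3" "\<bar>s' - s\<bar> \<le> e / 2" using s by (auto simp: d_def)
    have "dist (\<Theta> (s', \<psi>)) (\<Theta> (s, \<psi>)) \<le> 2 * \<bar>s' - s\<bar>" by (rule \<Theta>_lipschitz)
    also have "\<dots> < d0" using small(1) d0(1) by (simp add: field_simps)
    finally have "dist (v (\<Theta> (s', \<psi>))) (v (\<Theta> (s, \<psi>))) < e / 2"
      using s assms(1) by (intro d0(2) \<Theta>_belt) auto
    hence 1: "\<bar>v (\<Theta> (s', \<psi>)) - v (\<Theta> (s, \<psi>))\<bar> \<le> e / 2" by (simp add: dist_real_def)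
    have "\<bar>ln (cosh s') - ln (cosh s)\<bar> \<le> \<bar>s' - s\<bar>"
      by (rule lipschitz_from_deriv[OF ln_cosh_deriv]) (use tanh_real_bounds in \<open>auto simp: abs_le_iff less_imp_le minus_le_iff\<close>)
    hence 2: "\<bar>ln (cosh s') - ln (cosh s)\<bar> \<le> e / 2" using small(2) by (rule order_trans)
    have "U (s', \<psi>) - U (s, \<psi>) = (v (\<Theta> (s', \<psi>)) - v (\<Theta> (s, \<psi>))) - (ln (cosh s') - ln (cosh s))"
      by (simp add: U_def)
    hence "\<bar>U (s', \<psi>) - U (s, \<psi>)\<bar> \<le> \<bar>v (\<Theta> (s', \<psi>)) - v (\<Theta> (s, \<psi>))\<bar> + \<bar>ln (cosh s') - ln (cosh s)\<bar>"
      by (simp only: abs_triangle_ineq4)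
    also have "\<dots> \<le> e / 2 + e / 2" by (rule add_mono[OF 1 2])
    finally show ?thesis by simp
  qed
  moreover have "d > 0" using d0(1) assms(2) by (simp add: d_def)
  ultimately show ?thesis by blast
qed

lemma U_growth:
  assumes \<epsilon>: "\<epsilon> > 0"
  shows "\<exists>r>0. \<forall>z. 0 < pole_gap 0 z \<and> pole_gap 0 z < r \<longrightarrow> U z \<ge> \<epsilon> * ln (pole_gap 0 z)"
proof -
  obtain \<rho> where \<rho>: "\<rho> > 0" "\<And>\<theta>. \<theta> \<in> punctured_S2 \<Longrightarrow> 1 - (\<theta>$3)\<^sup>2 < \<rho> \<Longrightarrow> v \<theta> \<ge> \<epsilon> / 2 * ln (1 - (\<theta>$3)\<^sup>2)"
    using growth_near_poles[OF \<epsilon>] by blast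
  define r where "r = min (min \<rho> 1) (exp (- 2 * (\<epsilon> + 1) / \<epsilon>))"
  have "U z \<ge> \<epsilon> * ln (pole_gap 0 z)" if z: "0 < pole_gap 0 z" "pole_gap 0 z < r" for z
  proof -
    define D where "D = pole_gap 0 z"
    define C where "C = cosh (fst z)"
    have D: "0 < D" "D < \<rho>" "D < 1" "D < exp (- 2 * (\<epsilon> + 1) / \<epsilon>)" using z by (auto simp: D_def r_def)
    have C1: "C \<ge> 1" by (simp add: C_def cosh_real_ge_1)
    have "(sinh (fst z))\<^sup>2 \<le> D" by (simp add: D_def pole_gap_def)
    hence "C\<^sup>2 \<le> 2" using D(3) by (simp add: C_def cosh_square_eq)
    hence "C\<^sup>2 \<le> 2\<^sup>2" by simp
    hence C2: "C \<le> 2" by (rule power2_le_imp_le) simp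
    have lnC: "0 \<le> ln C" "ln C \<le> 1"
      using C1 C2 ln_le_minus_one[of C] by auto
    have "ln D < ln (exp (- 2 * (\<epsilon> + 1) / \<epsilon>))" using D by (subst ln_less_cancel_iff) auto
    hence lnD: "\<epsilon> / 2 * ln D \<le> - (\<epsilon> + 1)" using \<epsilon> by (simp add: field_simps)
    have \<Theta>: "\<Theta> z \<in> punctured_S2" using z(1) by (simp only: \<Theta>_punctured_iff)
    have g: "1 - (\<Theta> z $ 3)\<^sup>2 = D / C\<^sup>2" by (simp add: pole_gap_\<Theta> D_def C_def)
    have "D / C\<^sup>2 \<le> D / 1" using D(1) C1 by (intro divide_left_mono) auto
    hence "v (\<Theta> z) \<ge> \<epsilon> / 2 * ln (D / C\<^sup>2)" using \<rho>(2)[OF \<Theta>] D(2) unfolding g by simp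
    also have "\<epsilon> / 2 * ln (D / C\<^sup>2) = \<epsilon> / 2 * ln D - \<epsilon> * ln C"
      using D(1) C1 by (simp add: ln_div ln_realpow algebra_simps)
    finally have "U z \<ge> \<epsilon> / 2 * ln D - \<epsilon> * ln C - ln C" by (simp add: U_def C_def)
    moreover have "\<epsilon> * ln C \<le> \<epsilon> * 1" using lnC \<epsilon> by (intro mult_left_mono) auto
    moreover have "\<epsilon> * ln D = \<epsilon> / 2 * ln D + \<epsilon> / 2 * ln D" by simp
    ultimately show ?thesis using lnD lnC unfolding D_def[symmetric] by linarith
  qed
  moreover have "r > 0" using \<rho>(1) by (simp add: r_def)
  ultimately show ?thesis by blast
qed

text \<open>
  Suppose that the coefficients are symmetric about \<open>s = l\<close>. The points \<open>s = 2 l\<close> and \<open>s = 0\<close> correspond. Between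
  them \<open>f\<close> does not decrease while \<open>1 / (cosh s)\<^sup>2\<close> strictly increases, so \<open>f\<close> vanishes at \<open>s = 0\<close>. For \<open>K\<close>,
  which is also even in \<open>s\<close>, the values at \<open>s = 2 l j\<close> agree for all \<open>j\<close>, and for large
  \<open>j\<close> these points approach the equator. Every height occurs at \<open>s = 0\<close>.
\<close>

lemma coefficients_not_reflection_symmetric:
  assumes l: "l < 0"
  shows "\<exists>s \<psi>. s < l \<and> pole_gap (2 * l) (s, \<psi>) > 0 \<and>
    (K (\<Theta> (2 * l - s, \<psi>)) \<noteq> K (\<Theta> (s, \<psi>)) \<or> source (2 * l - s, \<psi>) \<noteq> source (s, \<psi>))"
proof (rule ccontr)
  assume "\<not> ?thesis"
  hence H: "K (\<Theta> (2 * l - s, \<psi>)) = K (\<Theta> (s, \<psi>))" "source (2 * l - s, \<psi>) = source (s, \<psi>)"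
    if "s < l" "pole_gap (2 * l) (s, \<psi>) > 0" for s \<psi> using that by blast+
  have "f \<theta> = 0 \<and> K \<theta> = K (meridian 0)" if \<theta>: "\<theta> \<in> punctured_S2" for \<theta>
  proof -
    define y where "y = \<theta>$3"
    have y1: "y\<^sup>2 < 1" using \<theta> unfolding punctured_S2_iff y_def by blast
    hence y: "\<bar>y\<bar> < 1" by (simp add: abs_square_less_1)
    define \<psi> where "\<psi> = arcsin y"
    have sin: "sin \<psi> = y" using y by (simp add: \<psi>_def)
    have "(cos \<psi>)\<^sup>2 > 0" using y1 by (simp add: cos_squared_eq sin)
    hence "cos \<psi> \<noteq> 0" by auto
    hence gap: "pole_gap s0 (s, \<psi>) > 0" for s0 s by (simp add: pole_gap_pos_iff)
    have P: "\<Theta> (s, \<psi>) \<in> punctured_S2" for s using gap by (simp only: \<Theta>_punctured_iff)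
    have ax: "g \<theta> = g (\<Theta> (0, \<psi>))" if "rotationally_symmetric g" for g :: "real^3 \<Rightarrow> real"
      by (rule axial_eq[OF that \<theta> P]) (simp add: \<Theta>_3 sin y_def)
    have "f \<theta> = 0"
    proof -
      define h where "h = (1 / cosh (2 * l))\<^sup>2"
      have "cosh (2 * l) > 1" using l cosh_real_nonneg_less_iff[of 0 "- 2 * l"] by simp
      hence h: "0 \<le> h" "h < 1" unfolding h_def by (auto simp: power_divide)
      have e: "f (\<Theta> (0, \<psi>)) = f (\<Theta> (2 * l, \<psi>)) * h" using H(2)[of "2 * l" \<psi>] l gap by (simp add: source_def h_def)
      have le: "f (\<Theta> (2 * l, \<psi>)) \<le> f (\<Theta> (0, \<psi>))" by (rule axial_\<Theta>_mono[OF f_sym f_mono]) (use gap in auto)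
      have "f (\<Theta> (0, \<psi>)) \<le> f (\<Theta> (0, \<psi>)) * h" using mult_right_mono[OF le h(1)] e by simp
      hence "f (\<Theta> (0, \<psi>)) * (1 - h) \<le> 0" by (simp add: algebra_simps)
      hence "f (\<Theta> (0, \<psi>)) \<le> 0" using h(2) by (simp add: mult_le_0_iff)
      moreover have "f (\<Theta> (0, \<psi>)) \<ge> 0" using f_nonneg P by blast
      ultimately show ?thesis using ax[OF f_sym] by simp
    qed
    moreover have "K \<theta> = K (meridian 0)"
    proof -
      define x where "x j = 2 * l * real j" for j :: nat
      have const: "K (\<Theta> (x j, \<psi>)) = K (\<Theta> (0, \<psi>))" for j
      proof (induction j)
        case (Suc j)
        have "2 * l * real j \<le> 0" using l by (simp add: mult_nonpos_nonneg)
        hence "x (Suc j) < l" using l by (simp add: x_def algebra_simps)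
        moreover have "2 * l - x (Suc j) = - x j" by (simp add: x_def algebra_simps)
        ultimately have "K (\<Theta> (x (Suc j), \<psi>)) = K (\<Theta> (- x j, \<psi>))" using H(1)[of "x (Suc j)" \<psi>] gap by simp
        also have "\<dots> = K (\<Theta> (x j, \<psi>))" by (rule axial_eq[OF K_sym P P]) (simp add: \<Theta>_3)
        finally show ?case using Suc by simp
      qed (simp add: x_def)
      define w where "w j = y / cosh (x j)" for j
      have w: "(w j)\<^sup>2 < 1" for j
        using P[of "x j"] unfolding punctured_S2_iff by (simp add: \<Theta>_3 sin w_def)
      have Kw: "K (meridian (w j)) = K \<theta>" for j
        using const[of j] ax[OF K_sym] axial_meridian[OF K_sym P[of "x j"]] by (simp add: \<Theta>_3 sin w_def)
      have "filterlim x at_bot sequentially"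
        unfolding x_def by (rule filterlim_tendsto_neg_mult_at_bot[OF tendsto_const _ filterlim_real_sequentially]) (use l in simp)
      hence "filterlim (\<lambda>j. cosh (x j)) at_top sequentially"
        by (rule filterlim_compose[OF cosh_real_at_bot])
      hence "w \<longlonglongrightarrow> 0" unfolding w_def
        by (intro tendsto_divide_0[OF tendsto_const] filterlim_at_top_imp_at_infinity)
      hence "(\<lambda>j. sqrt (1 - (w j)\<^sup>2) *\<^sub>R axis 1 1 + w j *\<^sub>R axis 3 1 :: real^3) \<longlonglongrightarrow> sqrt (1 - 0\<^sup>2) *\<^sub>R axis 1 1 + 0 *\<^sub>R axis 3 1"
        by (intro tendsto_intros)
      moreover have mer: "meridian t = sqrt (1 - t\<^sup>2) *\<^sub>R axis 1 1 + t *\<^sub>R axis 3 1" for t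
        by (simp add: meridian_def vec_eq_iff forall_3 axis_def)
      ultimately have lim: "(\<lambda>j. meridian (w j)) \<longlonglongrightarrow> meridian 0" by (simp only: mer)
      have "(\<lambda>j. K (meridian (w j))) \<longlonglongrightarrow> K (meridian 0)"
        by (rule continuous_on_tendsto_compose[OF K_cont lim])
           (use meridian_punctured[OF w] meridian_punctured[of 0] in auto)
      hence "(\<lambda>j::nat. K \<theta>) \<longlonglongrightarrow> K (meridian 0)" by (simp only: Kw)
      thus ?thesis by (simp add: LIMSEQ_const_iff)
    qed
    ultimately show ?thesis by blast
  qed
  thus False using nontrivial by blast
qed

sublocale cylinder_equation U "\<lambda>z. K (\<Theta> z)" source
proof
  show "angular U"
  proof (rule angularI)
    fix s \<psi> \<psi>' :: real assume "cos \<psi> = cos \<psi>'" "sin \<psi> = sin \<psi>'"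
    from angular_\<Theta>[OF this] show "U (s, \<psi>) = U (s, \<psi>')" by (simp add: U_def)
  qed
  show "continuous_on {z. pole_gap 0 z > 0} U"
  proof -
    have "continuous_on {z. pole_gap 0 z > 0} (\<lambda>z. v (\<Theta> z))"
      by (rule continuous_on_compose2[OF v_cont continuous_on_\<Theta>], rule image_subsetI)
         (simp only: mem_Collect_eq \<Theta>_punctured_iff)
    thus ?thesis unfolding U_def by (intro continuous_intros) auto
  qed
  fix z assume p: "pole_gap 0 z > 0"
  show "has_laplacian U (- (K (\<Theta> z) * exp (2 * U z) + source z)) z" by (rule U_equation[OF p])
  have \<Theta>: "\<Theta> z \<in> punctured_S2" using p by (simp only: \<Theta>_punctured_iff)
  show "K (\<Theta> z) \<ge> 0" using K_nonneg \<Theta> by blast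
  have "f (\<Theta> z) \<ge> 0" using f_nonneg \<Theta> by blast
  thus "source z \<ge> 0" by (simp add: source_def)
next
  fix r :: real assume "r > 0"
  then obtain M where "\<And>z. r \<le> \<bar>fst z\<bar> \<Longrightarrow> \<bar>K (\<Theta> z)\<bar> \<le> M" using bounded_on_belt[OF K_cont] by blast
  hence "\<forall>z. r \<le> \<bar>fst z\<bar> \<longrightarrow> K (\<Theta> z) \<le> M" using abs_le_D1 by blast
  thus "\<exists>M. \<forall>z. r \<le> \<bar>fst z\<bar> \<longrightarrow> K (\<Theta> z) \<le> M" by blast
qed (fact axial_\<Theta>_mono[OF K_sym K_mono] source_mono U_growth U_asymptotics U_uniformly_continuous
       coefficients_not_reflection_symmetric)+

lemma reflected_value_le:
  assumes "s < 0"
  shows "v (\<Theta> (s, \<psi>)) \<le> v (\<Theta> (- s, \<psi>))"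
  using reflection_inequality[OF assms, of \<psi>] by (simp add: U_def)

end

context mean_field_solution
begin

text \<open>
  The axis \<open>a\<close> points from \<open>\<theta>\<close> to \<open>\<theta>'\<close>, so that the two points have the coordinates \<open>(s, \<psi>)\<close> and \<open>(- s, \<psi>)\<close>
  with \<open>s < 0\<close>. Antipodal points are excluded because they would be the ends of the axis.
\<close>

lemma equal_height_le:
  assumes \<theta>: "\<theta> \<in> punctured_S2" "\<theta>' \<in> punctured_S2" "\<theta>$3 = \<theta>'$3" "\<theta> \<noteq> \<theta>'" "\<theta> \<noteq> - \<theta>'"
  shows "v \<theta> \<le> v \<theta>'"
proof -
  define N where "N = norm (\<theta>' - \<theta>)"
  have n: "norm \<theta> = 1" "norm \<theta>' = 1" using \<theta>(1,2) unfolding punctured_S2_iff by auto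
  have N: "N > 0" using \<theta>(4) by (simp add: N_def)
  have N2: "N\<^sup>2 = 2 - 2 * (\<theta> \<bullet> \<theta>')"
    using n by (simp add: N_def power2_norm_eq_inner inner_simps inner_commute norm_eq_1)
  have "(norm (\<theta> + \<theta>'))\<^sup>2 = 2 + 2 * (\<theta> \<bullet> \<theta>')"
    using n by (simp add: power2_norm_eq_inner inner_simps inner_commute norm_eq_1)
  moreover have "norm (\<theta> + \<theta>') > 0" using \<theta>(5) by (simp add: eq_neg_iff_add_eq_0)
  ultimately have N4: "N\<^sup>2 < 4" using N2 zero_less_power[of "norm (\<theta> + \<theta>')" 2] by linarith
  have h0: "(\<theta>' - \<theta>)$3 = 0" using \<theta>(3) by simp
  define c where "c = (\<theta>' - \<theta>)$1 / N"
  define d where "d = (\<theta>' - \<theta>)$2 / N"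
  have N12: "N\<^sup>2 = ((\<theta>' - \<theta>)$1)\<^sup>2 + ((\<theta>' - \<theta>)$2)\<^sup>2"
    unfolding N_def power2_norm_eq_inner inner_vec_def sum_3 h0 by (simp add: power2_eq_square)
  have "c\<^sup>2 + d\<^sup>2 = (((\<theta>' - \<theta>)$1)\<^sup>2 + ((\<theta>' - \<theta>)$2)\<^sup>2) / N\<^sup>2"
    unfolding c_def d_def power_divide by (rule add_divide_distrib[symmetric])
  also have "\<dots> = 1" unfolding N12[symmetric] using N by simp
  finally have cd: "c\<^sup>2 + d\<^sup>2 = 1" .
  interpret mean_field_solution_in_frame K f v c d by unfold_locales (rule cd)
  have a: "\<theta>' - \<theta> = N *\<^sub>R a"
  proof -
    have "\<theta>'$1 - \<theta>$1 = N * c" "\<theta>'$2 - \<theta>$2 = N * d" using N by (simp_all add: c_def d_def)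
    thus ?thesis using h0 by (simp add: vec_eq_iff forall_3 a_def)
  qed
  define p where "p = a \<bullet> \<theta>"
  define q where "q = b \<bullet> \<theta>"
  define z where "z = north \<bullet> \<theta>"
  have expand: "\<theta> = p *\<^sub>R a + q *\<^sub>R b + z *\<^sub>R north" using frame_expand[of \<theta>] by (simp add: p_def q_def z_def)
  have "N * p = (\<theta>' - \<theta>) \<bullet> \<theta>" by (simp add: a p_def)
  also have "\<dots> = \<theta> \<bullet> \<theta>' - 1" using n by (simp add: inner_simps inner_commute norm_eq_1)
  also have "\<dots> = - (N * N) / 2" using N2 by (simp add: power2_eq_square)
  finally have "N * (N + 2 * p) = 0" by (simp add: algebra_simps)
  hence pN: "N = - 2 * p" using N by (simp add: eq_neg_iff_add_eq_0)
  have p: "p < 0" "p\<^sup>2 < 1" using N N4 unfolding pN by (auto simp: power_mult_distrib)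
  have "\<theta> \<bullet> \<theta> = p * p + q * q + z * z"
    by (subst (1 2) expand) (simp add: inner_simps frame_orthonormal)
  hence one: "p\<^sup>2 + q\<^sup>2 + z\<^sup>2 = 1" using n by (simp add: norm_eq_1 power2_eq_square)
  define m where "m = sqrt (1 - p\<^sup>2)"
  have m: "m > 0" "m\<^sup>2 = 1 - p\<^sup>2" using p by (auto simp: m_def)
  define s where "s = arsinh (p / m)"
  have sinh: "sinh s = p / m" by (simp add: s_def)
  have "(cosh s)\<^sup>2 = (p\<^sup>2 + m\<^sup>2) / m\<^sup>2" unfolding cosh_square_eq sinh using m(1) by (simp add: power_divide add_divide_distrib)
  also have "p\<^sup>2 + m\<^sup>2 = 1" using m(2) by simp
  also have "1 / m\<^sup>2 = (1 / m)\<^sup>2" by (simp add: power_divide)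
  finally have "cosh s = 1 / m" by (rule power2_eq_imp_eq) (use m in auto)
  hence sech: "1 / cosh s = m" by simp
  have tanh: "tanh s = p" using m sech by (simp add: tanh_def sinh divide_inverse)
  have "s < 0" using tanh p(1) tanh_real_neg_iff by metis
  have "(q / m)\<^sup>2 + (z / m)\<^sup>2 = (q\<^sup>2 + z\<^sup>2) / m\<^sup>2" by (simp add: power_divide add_divide_distrib)
  also have "q\<^sup>2 + z\<^sup>2 = m\<^sup>2" using one m(2) by simp
  also have "m\<^sup>2 / m\<^sup>2 = 1" using m(1) by simp
  finally obtain \<psi> where \<psi>: "q / m = cos \<psi>" "z / m = sin \<psi>" using sincos_total_2pi by metis
  have radial: "m *\<^sub>R radial \<psi> = q *\<^sub>R b + z *\<^sub>R north"
    unfolding radial_def \<psi>[symmetric] using m(1) by (simp add: scaleR_add_right)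
  have "\<Theta> (s, \<psi>) = \<theta>" by (simp add: \<Theta>_def sech tanh radial) (simp add: expand[symmetric] add.assoc[symmetric])
  moreover have "\<Theta> (- s, \<psi>) = \<theta>'"
  proof -
    have "\<Theta> (- s, \<psi>) = - p *\<^sub>R a + (q *\<^sub>R b + z *\<^sub>R north)" by (simp add: \<Theta>_def sech tanh radial)
    also have "\<dots> = \<theta> + (- 2 * p) *\<^sub>R a"
    proof -
      have "- 2 * p = - p + - p" by simp
      hence two: "(- 2 * p) *\<^sub>R a = - p *\<^sub>R a + - p *\<^sub>R a" by (simp only: scaleR_left_distrib)
      show ?thesis unfolding two by (subst expand) simp
    qed
    also have "\<dots> = \<theta> + N *\<^sub>R a" by (simp only: pN)
    also have "\<dots> = \<theta>'" using a by (simp add: algebra_simps)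
    finally show ?thesis .
  qed
  ultimately show ?thesis using reflected_value_le[OF \<open>s < 0\<close>, of \<psi>] by simp
qed

text \<open>
  Antipodal points of equal height lie on the equator and are joined through a third equatorial point.
\<close>

lemma equal_height_eq:
  assumes \<theta>: "\<theta> \<in> punctured_S2" "\<theta>' \<in> punctured_S2" "\<theta>$3 = \<theta>'$3"
  shows "v \<theta> = v \<theta>'"
proof -
  have gen: "v x = v y" if x: "x \<in> punctured_S2" "y \<in> punctured_S2" "x$3 = y$3" "x \<noteq> - y" for x y
  proof (cases "x = y")
    case False
    have "y \<noteq> - x" using x(4) by (metis minus_minus)
    thus ?thesis using equal_height_le[OF x(1,2,3) False x(4)] equal_height_le[OF x(2,1) x(3)[symmetric]] False
      by (intro antisym) auto
  qed simp
  show ?thesis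
  proof (cases "\<theta> = - \<theta>'")
    case True
    hence z: "\<theta>$3 = 0" "\<theta>'$3 = 0" using \<theta>(3) by auto
    have "norm \<theta> = 1" using \<theta>(1) unfolding punctured_S2_iff by blast
    hence c: "(\<theta>$1)\<^sup>2 + (\<theta>$2)\<^sup>2 = 1" using sphere_components[of \<theta>] z by simp
    (* a quarter turn of theta *)
    define x :: "real^3" where "x = vector [- \<theta>$2, \<theta>$1, 0]"
    have x1: "norm x = 1" by (rule norm_components) (use c in \<open>simp add: x_def add.commute\<close>)
    have xP: "x \<in> punctured_S2" unfolding punctured_S2_iff using x1 by (simp add: x_def)
    have x3: "x$3 = 0" by (simp add: x_def)
    have "x \<bullet> \<theta> = 0" by (simp add: x_def inner_vec_def sum_3)
    hence "\<theta> \<noteq> - x" "x \<noteq> \<theta>" using x1 by (auto simp: norm_eq_1)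
    hence "x \<noteq> - \<theta>'" using True by auto
    have "v \<theta> = v x" by (rule gen[OF \<theta>(1) xP _ \<open>\<theta> \<noteq> - x\<close>]) (simp add: z x3)
    also have "v x = v \<theta>'" by (rule gen[OF xP \<theta>(2) _ \<open>x \<noteq> - \<theta>'\<close>]) (simp add: z x3)
    finally show ?thesis .
  qed (use gen[OF \<theta>] in blast)
qed

lemma v_rotationally_symmetric: "rotationally_symmetric v"
  unfolding rotationally_symmetric_def
proof (intro allI impI ballI, elim conjE)
  fix Q :: "real^3^3" and \<theta>
  assume Q: "rotation_matrix Q" "Q *v north = north" and \<theta>: "\<theta> \<in> punctured_S2"
  have orth: "orthogonal_transformation ((*v) Q)"
    using Q(1) unfolding rotation_matrix_def by (simp add: orthogonal_transformation_matrix matrix_vector_mul_linear matrix_of_matrix_vector_mul)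
  have "(Q *v \<theta>) \<bullet> (Q *v north) = \<theta> \<bullet> north" using orth by (simp add: orthogonal_transformation_def)
  hence h: "(Q *v \<theta>)$3 = \<theta>$3" unfolding Q(2) by (simp add: north_def inner_axis)
  have "norm (Q *v \<theta>) = norm \<theta>" using orth by (simp add: orthogonal_transformation_norm)
  hence "Q *v \<theta> \<in> punctured_S2" using \<theta> h unfolding punctured_S2_iff by simp
  thus "v (Q *v \<theta>) = v \<theta>" using \<theta> h by (rule equal_height_eq)
qed

end

theorem theorem1p6:
  fixes K f v :: "real^3 \<Rightarrow> real"
  assumes K_cont: "continuous_on punctured_S2 K"
    and K_nonneg: "\<forall>\<theta>\<in>punctured_S2. K \<theta> \<ge> 0"
    and f_cont: "continuous_on punctured_S2 f"
    and f_nonneg: "\<forall>\<theta>\<in>punctured_S2. f \<theta> \<ge> 0"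
    and K_mono: "increasing_to_poles K"
    and f_mono: "increasing_to_poles f"
    and nontrivial: "\<not> ((\<forall>\<theta>\<in>punctured_S2. f \<theta> = 0) \<and> (\<exists>c. \<forall>\<theta>\<in>punctured_S2. K \<theta> = c))"
    and K_sym: "rotationally_symmetric K"
    and f_sym: "rotationally_symmetric f"
    and v_C2: "sphere_C2_on v punctured_S2"
    and eq: "\<forall>\<theta>\<in>punctured_S2. - sphere_laplacian v \<theta> + 1 = K \<theta> * exp (2 * v \<theta>) + f \<theta>"
    and limsup_north:
      "Limsup (at north within punctured_S2) (\<lambda>\<theta>. ereal (v \<theta> / ln (geodesic_dist \<theta> north))) \<le> 0"
    and limsup_south:
      "Limsup (at south within punctured_S2) (\<lambda>\<theta>. ereal (v \<theta> / ln (geodesic_dist \<theta> south))) \<le> 0"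
  shows "rotationally_symmetric v"
proof -
  interpret mean_field_solution K f v by unfold_locales fact+
  show ?thesis by (rule v_rotationally_symmetric)
qed

end
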